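(* Let $H \leq \mathbb{Q}_+^\times$ be a subgroup of the multiplicative group of positive rational numbers. Then there exist a dimension group $(D,\leq,u)$ and a group isomorphism $h \mapsto \varphi_h$ from $H$ onto the group $\operatorname{Aut}(D,\leq)$ of order-preserving automorphisms of $D$ such that $\varphi_h(u) = h u$ for every $h \in H$ (that is, if $h = a/b$ with $a,b$ positive integers, then $b\,\varphi_h(u) = a u$).
   Context: An order unit in a partially ordered abelian group is a positive element $u$ ($u>0$) such that for every element $x$ there is a positive integer $n$ with $nu \geq x$. A dimension group $(D,\leq,u)$ is a countable partially ordered abelian group $(D,\leq)$ with an order unit $u$ such that every finite subset of $D$ is contained in a subgroup which (with the order restricted from $D$) is isomorphic, as a partially ordered abelian group, to a direct product of finitely many copies of $(\mathbb{Z},\leq)$ (with the product, i.e. coordinatewise, order). $\operatorname{Aut}(D,\leq)$ denotes the group of automorphisms of $D$ as a partially ordered abelian group; these are not required to preserve the order unit. *)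

theory Defs
  imports "HOL-Algebra.Bij" "HOL-Algebra.Product_Groups"
begin

text \<open>
  Groups follow the multiplicative notation of HOL-Algebra: the sum of \<open>x\<close> and \<open>y\<close> in an abelian
  group \<open>D\<close> is \<open>x \<otimes>\<^bsub>D\<^esub> y\<close>, and the multiple \<open>n x\<close> is \<open>x [^]\<^bsub>D\<^esub> n\<close>. An order is a binary predicate of
  which only the restriction to the carrier matters.
\<close>

locale po_abelian_group = comm_group D for D (structure) +
  fixes leq :: "'a \<Rightarrow> 'a \<Rightarrow> bool" (infix \<open>\<preceq>\<close> 50)
  assumes le_refl: "reflp_on (carrier D) (\<preceq>)"
    and le_antisym: "antisymp_on (carrier D) (\<preceq>)"
    and le_trans: "transp_on (carrier D) (\<preceq>)"
    and le_translate: "\<lbrakk>x \<in> carrier D; y \<in> carrier D; z \<in> carrier D; x \<preceq> y\<rbrakk> \<Longrightarrow> x \<otimes> z \<preceq> y \<otimes> z"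

definition order_unit :: "('a, 'b) monoid_scheme \<Rightarrow> ('a \<Rightarrow> 'a \<Rightarrow> bool) \<Rightarrow> 'a \<Rightarrow> bool" where
  "order_unit D leq u \<longleftrightarrow> u \<in> carrier D \<and> leq \<one>\<^bsub>D\<^esub> u \<and> u \<noteq> \<one>\<^bsub>D\<^esub> \<and>
     (\<forall>x\<in>carrier D. \<exists>n::nat. n > 0 \<and> leq x (u [^]\<^bsub>D\<^esub> n))"

definition simplicial_subgroup :: "('a, 'b) monoid_scheme \<Rightarrow> ('a \<Rightarrow> 'a \<Rightarrow> bool) \<Rightarrow> 'a set \<Rightarrow> bool" where
  "simplicial_subgroup D leq S \<longleftrightarrow> subgroup S D \<and>
     (\<exists>(k::nat) \<psi>. \<psi> \<in> iso (D\<lparr>carrier := S\<rparr>) (product_group {..<k} (\<lambda>_. integer_group)) \<and>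
        (\<forall>x\<in>S. \<forall>y\<in>S. leq x y \<longleftrightarrow> (\<forall>i<k. \<psi> x i \<le> \<psi> y i)))"

locale dimension_group = po_abelian_group D leq for D (structure) and leq (infix \<open>\<preceq>\<close> 50) +
  fixes u
  assumes countable_carrier: "countable (carrier D)"
    and order_unit: "order_unit D (\<preceq>) u"
    and finite_in_simplicial:
      "\<lbrakk>F \<subseteq> carrier D; finite F\<rbrakk> \<Longrightarrow> \<exists>S. F \<subseteq> S \<and> simplicial_subgroup D (\<preceq>) S"

text \<open>
  The automorphisms of \<open>(D, \<le>)\<close> preserve the order in both directions. As in \<^const>\<open>AutoGroup\<close>, they are
  represented by functions that are undefined outside the carrier, so that the group operation is
  composition.
\<close>

definition order_auto_group ::
    "('a, 'b) monoid_scheme \<Rightarrow> ('a \<Rightarrow> 'a \<Rightarrow> bool) \<Rightarrow> ('a \<Rightarrow> 'a) monoid" where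
  "order_auto_group D leq = (AutoGroup D)
     \<lparr>carrier := {f \<in> auto D. \<forall>x\<in>carrier D. \<forall>y\<in>carrier D. leq x y \<longleftrightarrow> leq (f x) (f y)}\<rparr>"

definition pos_rat_group :: "rat monoid" where
  "pos_rat_group = \<lparr>carrier = {q. q > 0}, mult = (*), one = 1\<rparr>"

end

theory Submission
  imports Defs "HOL-Computational_Algebra.Primes"
begin

text \<open>
  For \<open>H = {1}\<close> the group \<open>\<int>\<close> works. Otherwise \<open>D\<close> consists of rational functions, ordered pointwise, on
  \<open>\<nat> \<times> H\<close> together with a point at infinity, and \<open>u\<close> is the constant \<open>1\<close>. Up to a constant, a function
  in \<open>D\<close> has finite support in finitely many initial rows, and in each later row \<open>j\<close> its value at \<open>h\<close> is
  the average, with weights \<open>1/B\<^sub>j\<close> and \<open>1 - 1/B\<^sub>j\<close>, of its values at \<open>h\<close> and \<open>g\<^sub>j h\<close> in the parent row of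
  \<open>j\<close>. Its values at \<open>(i, h)\<close> lie in \<open>(h/c) \<int>\<close>, where \<open>c\<close> depends on \<open>i\<close> and on the number of initial rows.
  For \<open>k \<in> H\<close> the map \<open>f \<mapsto> ((i, h) \<mapsto> k f(i, h/k))\<close> preserves these conditions and sends \<open>1\<close> to \<open>k\<close>.

  Conversely, an order automorphism permutes the evaluations at points, up to a common factor \<open>\<lambda>\<close>. Since
  the \<open>B\<^sub>j\<close> grow fast, the weights occurring in row \<open>j\<close> determine \<open>j\<close>, so the permutation preserves the rows
  and the pairs \<open>(h, g\<^sub>j h)\<close>; as every element of \<open>H - {1}\<close> is \<open>g\<^sub>j\<close> for infinitely many children \<open>j\<close> of
  each row, row \<open>i\<close> is translated by some \<open>k\<^sub>i \<in> H\<close>. If \<open>\<lambda> k\<^sub>i \<noteq> 1\<close> for some \<open>i\<close>, then multiplication by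
  \<open>\<lambda> k\<^sub>i\<close> maps a nontrivial subgroup of \<open>D\<close> onto itself, which is impossible because only the constants
  are divisible by all powers of a prime. Hence the automorphism is the scaling by \<open>\<lambda> = 1/k\<^sub>i\<close>.
\<close>

section \<open>Dimension groups of rational-valued functions\<close>

text \<open>The final clause of \<open>simplicial\<close> lets positivity of a combination be read
  off its coefficients; applied with both signs it also gives independence of the
  \<open>b i\<close>.\<close>

locale function_dimension_group =
  fixes C :: "('x \<Rightarrow> rat) set" and u :: "'x \<Rightarrow> rat"
  assumes countable_C: "countable C"
    and zero_mem: "(\<lambda>_. 0) \<in> C"
    and add_mem: "f \<in> C \<Longrightarrow> g \<in> C \<Longrightarrow> (\<lambda>x. f x + g x) \<in> C"
    and neg_mem: "f \<in> C \<Longrightarrow> (\<lambda>x. - f x) \<in> C"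
    and u_mem: "u \<in> C"
    and u_nonneg: "0 \<le> u x"
    and u_nonzero: "\<exists>x. u x \<noteq> 0"
    and u_dominates: "f \<in> C \<Longrightarrow> \<exists>n::nat. \<forall>x. f x \<le> of_nat n * u x"
    and simplicial: "finite F \<Longrightarrow> F \<subseteq> C \<Longrightarrow>
      \<exists>(k::nat) b. (\<forall>i<k. b i \<in> C \<and> (\<forall>x. 0 \<le> b i x)) \<and>
        (\<forall>f\<in>F. \<exists>n::nat \<Rightarrow> int. f = (\<lambda>x. \<Sum>i<k. of_int (n i) * b i x)) \<and>
        (\<forall>n::nat \<Rightarrow> int. (\<forall>x. 0 \<le> (\<Sum>i<k. of_int (n i) * b i x)) \<longrightarrow> (\<forall>i<k. 0 \<le> n i))"
begin

section \<open>Coding the functions in \<open>C\<close> by natural numbers\<close>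

abbreviation enc :: "('x \<Rightarrow> rat) \<Rightarrow> nat" where "enc \<equiv> to_nat_on C"
abbreviation dec :: "nat \<Rightarrow> 'x \<Rightarrow> rat" where "dec \<equiv> from_nat_into C"

definition G :: "nat monoid" where
  "G = \<lparr>carrier = enc ` C, monoid.mult = (\<lambda>a b. enc (\<lambda>x. dec a x + dec b x)), one = enc (\<lambda>_. 0)\<rparr>"

definition le :: "nat \<Rightarrow> nat \<Rightarrow> bool" where
  "le a b \<longleftrightarrow> (\<forall>x. dec a x \<le> dec b x)"

lemma dec_enc [simp]: "f \<in> C \<Longrightarrow> dec (enc f) = f"
  by (simp add: countable_C)

lemma carrier_G: "carrier G = enc ` C"
  by (simp add: G_def)

lemma one_G: "\<one>\<^bsub>G\<^esub> = enc (\<lambda>_. 0)"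
  by (simp add: G_def)

lemma mult_G: "f \<in> C \<Longrightarrow> g \<in> C \<Longrightarrow> enc f \<otimes>\<^bsub>G\<^esub> enc g = enc (\<lambda>x. f x + g x)"
  by (simp add: G_def)

lemma le_enc: "f \<in> C \<Longrightarrow> g \<in> C \<Longrightarrow> le (enc f) (enc g) \<longleftrightarrow> (\<forall>x. f x \<le> g x)"
  by (simp add: le_def)

lemma enc_eq_iff: "f \<in> C \<Longrightarrow> g \<in> C \<Longrightarrow> enc f = enc g \<longleftrightarrow> f = g"
  by (metis dec_enc)

lemma comm_group_G: "comm_group G"
proof (rule comm_groupI)
  fix a assume "a \<in> carrier G"
  then obtain f where f: "f \<in> C" "a = enc f" by (auto simp: carrier_G)
  then show "\<one>\<^bsub>G\<^esub> \<otimes>\<^bsub>G\<^esub> a = a"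
    by (simp add: one_G mult_G zero_mem)
  show "\<exists>b\<in>carrier G. b \<otimes>\<^bsub>G\<^esub> a = \<one>\<^bsub>G\<^esub>"
    using f by (intro bexI[of _ "enc (\<lambda>x. - f x)"]) (auto simp: one_G mult_G neg_mem carrier_G)
qed (auto simp: carrier_G one_G mult_G zero_mem add_mem add_ac)

lemma pow_G: "f \<in> C \<Longrightarrow> enc f [^]\<^bsub>G\<^esub> (n::nat) = enc (\<lambda>x. of_nat n * f x) \<and> (\<lambda>x. of_nat n * f x) \<in> C"
proof (induction n)
  case 0
  then show ?case
    using zero_mem by (simp add: one_G)
next
  case (Suc n)
  moreover have "(\<lambda>x. of_nat n * f x + f x) = (\<lambda>x. of_nat (Suc n) * f x)"
    by (simp add: fun_eq_iff algebra_simps)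
  ultimately show ?case
    using add_mem[of "\<lambda>x. of_nat n * f x" f] by (simp add: mult_G)
qed

lemma lincomb_mem:
  assumes "\<And>i. i < (k::nat) \<Longrightarrow> b i \<in> C"
  shows "(\<lambda>x. \<Sum>i<k. of_int (n i) * b i x) \<in> C"
  using assms
proof (induction k)
  case 0
  then show ?case using zero_mem by simp
next
  case (Suc k)
  have nat_mult: "(\<lambda>x. of_nat m * f x) \<in> C" if "f \<in> C" for m f
    using pow_G[OF that] by blast
  have "(\<lambda>x. of_int (n k) * b k x) \<in> C"
  proof (cases "n k \<ge> 0")
    case True
    then show ?thesis using nat_mult[of "b k" "nat (n k)"] Suc.prems by simp
  next
    case False
    then have "(\<lambda>x. of_int (n k) * b k x) = (\<lambda>x. - (of_nat (nat (- n k)) * b k x))"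
      by (simp add: fun_eq_iff)
    then show ?thesis using neg_mem[OF nat_mult[of "b k" "nat (- n k)"]] Suc.prems by simp
  qed
  then show ?case using add_mem Suc by simp
qed

text \<open>Applied to differences of coefficients, \<open>pos\<close> turns the pointwise order of
  combinations into the coordinatewise order. By antisymmetry the coefficients are unique and give
  the isomorphism.\<close>

lemma simplicial_subgroup_G:
  assumes b: "\<And>i. i < (k::nat) \<Longrightarrow> b i \<in> C" "\<And>i x. i < k \<Longrightarrow> 0 \<le> b i x"
    and pos: "\<And>n::nat \<Rightarrow> int. (\<And>x. 0 \<le> (\<Sum>i<k. of_int (n i) * b i x)) \<Longrightarrow> (\<forall>i<k. 0 \<le> n i)"
  shows "simplicial_subgroup G le (range (\<lambda>n::nat \<Rightarrow> int. enc (\<lambda>x. \<Sum>i<k. of_int (n i) * b i x)))"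
proof -
  interpret comm_group G by (rule comm_group_G)
  define l where "l n x = (\<Sum>i<k. of_int (n i) * b i x)" for n :: "nat \<Rightarrow> int" and x
  let ?S = "range (\<lambda>n. enc (l n))"
  have l: "l n \<in> C" for n
    using lincomb_mem[OF b(1)] by (simp add: l_def[abs_def])
  have l_add: "(\<lambda>x. l n x + l m x) = l (\<lambda>i. n i + m i)" for n m
    by (simp add: l_def fun_eq_iff sum.distrib algebra_simps)
  have l_zero: "l (\<lambda>_. 0) = (\<lambda>_. 0)"
    by (simp add: l_def fun_eq_iff)
  have l_le: "(\<forall>x. l n x \<le> l m x) \<longleftrightarrow> (\<forall>i<k. n i \<le> m i)" for n m
  proof
    assume "\<forall>x. l n x \<le> l m x"
    then have "0 \<le> l (\<lambda>i. m i - n i) x" for x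
      by (simp add: l_def left_diff_distrib sum_subtractf)
    then show "\<forall>i<k. n i \<le> m i" using pos[of "\<lambda>i. m i - n i"] by (simp add: l_def)
  next
    assume "\<forall>i<k. n i \<le> m i"
    then show "\<forall>x. l n x \<le> l m x"
      by (auto intro!: sum_mono mult_right_mono simp: l_def b(2))
  qed
  have l_eq: "l n = l m \<longleftrightarrow> (\<forall>i<k. n i = m i)" for n m
  proof
    assume "l n = l m"
    then have "\<forall>x. l n x \<le> l m x" "\<forall>x. l m x \<le> l n x" by (metis order_refl)+
    then show "\<forall>i<k. n i = m i" unfolding l_le by force
  qed (auto simp: l_def fun_eq_iff intro!: sum.cong)
  have sub: "subgroup ?S G"
  proof (rule subgroupI)
    show "?S \<subseteq> carrier G" using l by (auto simp: carrier_G)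
    show "?S \<noteq> {}" by simp
  next
    fix a assume "a \<in> ?S"
    then obtain n where n: "a = enc (l n)" by blast
    have "enc (l (\<lambda>i. - n i)) \<otimes>\<^bsub>G\<^esub> a = \<one>\<^bsub>G\<^esub>"
      using l_zero by (simp add: n mult_G l l_add one_G)
    then have "inv\<^bsub>G\<^esub> a = enc (l (\<lambda>i. - n i))"
      by (rule inv_equality) (auto simp: n carrier_G l)
    then show "inv\<^bsub>G\<^esub> a \<in> ?S" by blast
  next
    fix a a' assume "a \<in> ?S" "a' \<in> ?S"
    then obtain n m where "a = enc (l n)" "a' = enc (l m)" by blast
    then have "a \<otimes>\<^bsub>G\<^esub> a' = enc (l (\<lambda>i. n i + m i))" by (simp add: mult_G l l_add)
    then show "a \<otimes>\<^bsub>G\<^esub> a' \<in> ?S" by blast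
  qed
  let ?Z = "product_group {..<k} (\<lambda>_. integer_group)"
  interpret Z: group ?Z by simp
  define \<theta> where "\<theta> n = enc (l n)" for n
  have iso: "\<theta> \<in> iso ?Z (G\<lparr>carrier := ?S\<rparr>)"
  proof (rule isoI)
    show "\<theta> \<in> hom ?Z (G\<lparr>carrier := ?S\<rparr>)"
    proof (rule homI)
      fix n m
      have "l (\<lambda>i\<in>{..<k}. n i + m i) = l (\<lambda>i. n i + m i)" by (simp add: l_eq)
      then show "\<theta> (n \<otimes>\<^bsub>?Z\<^esub> m) = \<theta> n \<otimes>\<^bsub>G\<lparr>carrier := ?S\<rparr>\<^esub> \<theta> m"
        by (simp add: \<theta>_def mult_G l l_add)
    qed (simp add: \<theta>_def)
    have "\<exists>n \<in> carrier ?Z. enc (l m) = \<theta> n" for m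
      by (intro bexI[of _ "restrict m {..<k}"]) (auto simp: \<theta>_def enc_eq_iff l l_eq)
    moreover have "inj_on \<theta> (carrier ?Z)"
    proof (rule inj_onI)
      fix n m assume nm: "n \<in> carrier ?Z" "m \<in> carrier ?Z" "\<theta> n = \<theta> m"
      then have "\<forall>i<k. n i = m i" by (simp add: \<theta>_def enc_eq_iff l l_eq)
      then show "n = m" using nm by (intro PiE_ext[of n "{..<k}" "\<lambda>_. UNIV" m]) auto
    qed
    ultimately show "bij_betw \<theta> (carrier ?Z) (carrier (G\<lparr>carrier := ?S\<rparr>))"
      by (auto simp: bij_betw_def \<theta>_def)
  qed
  define \<psi> where "\<psi> = inv_into (carrier ?Z) \<theta>"
  have \<psi>: "\<psi> \<in> iso (G\<lparr>carrier := ?S\<rparr>) ?Z"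
    unfolding \<psi>_def by (rule Z.iso_set_sym[OF iso])
  have \<psi>_eq: "\<psi> (enc (l n)) i = n i" if "i < k" for n i
  proof -
    have "enc (l n) \<in> \<theta> ` carrier ?Z"
      using iso by (auto simp: iso_def bij_betw_def)
    then have "\<theta> (\<psi> (enc (l n))) = enc (l n)"
      unfolding \<psi>_def by (rule f_inv_into_f)
    then show ?thesis using that by (simp add: \<theta>_def enc_eq_iff l l_eq)
  qed
  have le: "\<forall>x\<in>?S. \<forall>y\<in>?S. le x y \<longleftrightarrow> (\<forall>i<k. \<psi> x i \<le> \<psi> y i)"
    by (auto simp: le_enc l l_le \<psi>_eq)
  have "simplicial_subgroup G le ?S"
    unfolding simplicial_subgroup_def
    by (intro conjI exI[of _ k] exI[of _ \<psi>] sub \<psi> le)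
  then show ?thesis
    by (simp add: l_def[abs_def])
qed

lemma dimension_group_G: "dimension_group G le (enc u)"
proof -
  interpret comm_group G by (rule comm_group_G)
  show ?thesis
  proof unfold_locales
    show "reflp_on (carrier G) le" "transp_on (carrier G) le"
      by (auto simp: reflp_on_def transp_on_def le_def intro: order_trans)
    show "antisymp_on (carrier G) le"
      by (auto simp: antisymp_on_def carrier_G le_enc enc_eq_iff fun_eq_iff intro: order_antisym)
    show "le (x \<otimes>\<^bsub>G\<^esub> z) (y \<otimes>\<^bsub>G\<^esub> z)"
      if "x \<in> carrier G" "y \<in> carrier G" "z \<in> carrier G" "le x y" for x y z
      using that by (auto simp: carrier_G mult_G le_enc add_mem)
    show "countable (carrier G)" by simp
    have "\<exists>n::nat>0. le (enc f) (enc u [^]\<^bsub>G\<^esub> n)" if f: "f \<in> C" for f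
    proof -
      obtain n :: nat where n: "\<And>x. f x \<le> of_nat n * u x" using u_dominates[OF f] by blast
      \<comment> \<open>\<open>Suc n\<close> because an order unit requires a positive multiple;
        \<open>u\<close> being non-negative keeps the bound.\<close>
      have "f x \<le> of_nat (Suc n) * u x" for x
        using n[of x] u_nonneg[of x] by (simp add: algebra_simps)
      then have "le (enc f) (enc u [^]\<^bsub>G\<^esub> Suc n)"
        unfolding pow_G[OF u_mem, THEN conjunct1] using le_enc[OF f pow_G[OF u_mem, THEN conjunct2]] by blast
      then show ?thesis by blast
    qed
    moreover have "enc u \<noteq> enc (\<lambda>_. 0)"
      using u_nonzero by (auto simp: enc_eq_iff u_mem zero_mem)
    moreover have "le (enc (\<lambda>_. 0)) (enc u)"
      by (simp add: le_enc u_mem zero_mem u_nonneg)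
    ultimately show "order_unit G le (enc u)"
      unfolding order_unit_def carrier_G one_G by (simp add: u_mem)
  next
    fix F assume F: "F \<subseteq> carrier G" "finite F"
    then have dF: "finite (dec ` F)" "dec ` F \<subseteq> C" by (auto simp: carrier_G)
    obtain k b where
      b: "\<forall>i<k::nat. b i \<in> C \<and> (\<forall>x. 0 \<le> b i x)"
      and span: "\<forall>f\<in>dec ` F. \<exists>n::nat \<Rightarrow> int. f = (\<lambda>x. \<Sum>i<k. of_int (n i) * b i x)"
      and pos: "\<forall>n::nat \<Rightarrow> int. (\<forall>x. 0 \<le> (\<Sum>i<k. of_int (n i) * b i x)) \<longrightarrow> (\<forall>i<k. 0 \<le> n i)"
      using simplicial[OF dF] by (elim exE conjE) (rule that)
    have "F \<subseteq> range (\<lambda>n::nat \<Rightarrow> int. enc (\<lambda>x. \<Sum>i<k. of_int (n i) * b i x))"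
    proof
      fix a assume a: "a \<in> F"
      then obtain n :: "nat \<Rightarrow> int" where "dec a = (\<lambda>x. \<Sum>i<k. of_int (n i) * b i x)"
        using span by blast
      moreover have "a = enc (dec a)" using a F by (auto simp: carrier_G)
      ultimately show "a \<in> range (\<lambda>n::nat \<Rightarrow> int. enc (\<lambda>x. \<Sum>i<k. of_int (n i) * b i x))" by simp
    qed
    moreover have "simplicial_subgroup G le
        (range (\<lambda>n::nat \<Rightarrow> int. enc (\<lambda>x. \<Sum>i<k. of_int (n i) * b i x)))"
      by (rule simplicial_subgroup_G) (simp_all add: b pos)
    ultimately show "\<exists>S. F \<subseteq> S \<and> simplicial_subgroup G le S"
      by (intro exI conjI)
  qed
qed

text \<open>The action \<open>\<Phi>\<close> is transported to codes. It is faithful because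
  \<open>u\<close> is nonzero somewhere and is multiplied by \<open>h\<close>; it is onto by
  \<open>all\<close>, applied to an automorphism carried back to functions.\<close>

lemma iso_order_auto_group:
  fixes H :: "rat set" and \<Phi> :: "rat \<Rightarrow> ('x \<Rightarrow> rat) \<Rightarrow> 'x \<Rightarrow> rat"
  assumes H: "subgroup H pos_rat_group"
    and bij: "\<And>h. h \<in> H \<Longrightarrow> bij_betw (\<Phi> h) C C"
    and add: "\<And>h f g. h \<in> H \<Longrightarrow> f \<in> C \<Longrightarrow> g \<in> C \<Longrightarrow> \<Phi> h (\<lambda>x. f x + g x) = (\<lambda>x. \<Phi> h f x + \<Phi> h g x)"
    and mono: "\<And>h f g. h \<in> H \<Longrightarrow> f \<in> C \<Longrightarrow> g \<in> C \<Longrightarrow>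
      (\<forall>x. f x \<le> g x) \<longleftrightarrow> (\<forall>x. \<Phi> h f x \<le> \<Phi> h g x)"
    and mult: "\<And>h k f. h \<in> H \<Longrightarrow> k \<in> H \<Longrightarrow> f \<in> C \<Longrightarrow> \<Phi> (h * k) f = \<Phi> h (\<Phi> k f)"
    and unit: "\<And>h. h \<in> H \<Longrightarrow> \<Phi> h u = (\<lambda>x. h * u x)"
    and all: "\<And>\<psi>. bij_betw \<psi> C C \<Longrightarrow>
      (\<And>f g. f \<in> C \<Longrightarrow> g \<in> C \<Longrightarrow> \<psi> (\<lambda>x. f x + g x) = (\<lambda>x. \<psi> f x + \<psi> g x)) \<Longrightarrow>
      (\<And>f g. f \<in> C \<Longrightarrow> g \<in> C \<Longrightarrow> (\<forall>x. f x \<le> g x) \<longleftrightarrow> (\<forall>x. \<psi> f x \<le> \<psi> g x)) \<Longrightarrow>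
      \<exists>h\<in>H. \<forall>f\<in>C. \<psi> f = \<Phi> h f"
  defines "\<phi> \<equiv> \<lambda>h. \<lambda>a\<in>enc ` C. enc (\<Phi> h (dec a))"
  shows "\<phi> \<in> iso (pos_rat_group\<lparr>carrier := H\<rparr>) (order_auto_group G le)"
    and "\<forall>h\<in>H. \<forall>(a::nat) (b::nat). a > 0 \<longrightarrow> b > 0 \<longrightarrow> h = of_nat a / of_nat b \<longrightarrow>
       \<phi> h (enc u) [^]\<^bsub>G\<^esub> b = enc u [^]\<^bsub>G\<^esub> a"
proof -
  have \<Phi>_mem: "\<Phi> h f \<in> C" if "h \<in> H" "f \<in> C" for h f
    using bij[OF that(1)] that(2) by (auto simp: bij_betw_def)
  have \<phi>_enc: "\<phi> h (enc f) = enc (\<Phi> h f)" if "f \<in> C" for h f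
    using that by (simp add: \<phi>_def)
  have enc_bij: "bij_betw enc C (enc ` C)"
    by (simp add: bij_betw_def inj_on_to_nat_on countable_C)
  have \<phi>_Bij: "\<phi> h \<in> Bij (enc ` C)" if h: "h \<in> H" for h
  proof -
    have "bij_betw (enc \<circ> \<Phi> h \<circ> dec) (enc ` C) (enc ` C)"
    proof (intro bij_betw_trans)
      show "bij_betw dec (enc ` C) C"
        by (rule bij_betw_byWitness[of _ enc]) auto
    qed (use bij[OF h] enc_bij in auto)
    moreover have "(enc \<circ> \<Phi> h \<circ> dec) a = \<phi> h a" if "a \<in> enc ` C" for a
      using that by (auto simp: \<phi>_def)
    ultimately show ?thesis
      by (simp add: Bij_def \<phi>_def cong: bij_betw_cong)
  qed
  have \<phi>_hom: "\<phi> h \<in> hom G G" if h: "h \<in> H" for h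
    by (rule homI) (auto simp: carrier_G mult_G \<phi>_enc \<Phi>_mem add_mem add h)
  have \<phi>_mem: "\<phi> h \<in> carrier (order_auto_group G le)" if h: "h \<in> H" for h
    using \<phi>_Bij[OF h] \<phi>_hom[OF h] mono[OF h]
    by (auto simp: order_auto_group_def auto_def carrier_G le_enc \<phi>_enc \<Phi>_mem h)
  have H_mult: "h * k \<in> H" if "h \<in> H" "k \<in> H" for h k
    using subgroup.m_closed[OF H that] by (simp add: pos_rat_group_def)
  show "\<phi> \<in> iso (pos_rat_group\<lparr>carrier := H\<rparr>) (order_auto_group G le)"
  proof (rule isoI)
    show "\<phi> \<in> hom (pos_rat_group\<lparr>carrier := H\<rparr>) (order_auto_group G le)"
    proof (rule homI)
      fix h k assume "h \<in> carrier (pos_rat_group\<lparr>carrier := H\<rparr>)" "k \<in> carrier (pos_rat_group\<lparr>carrier := H\<rparr>)"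
      then have h: "h \<in> H" and k: "k \<in> H" by simp_all
      have "\<phi> (h * k) = compose (enc ` C) (\<phi> h) (\<phi> k)"
      proof (rule extensionalityI[of _ "enc ` C"])
        fix a assume "a \<in> enc ` C"
        then obtain f where f: "f \<in> C" "a = enc f" by blast
        then show "\<phi> (h * k) a = compose (enc ` C) (\<phi> h) (\<phi> k) a"
          by (simp add: compose_def \<phi>_enc mult h k \<Phi>_mem)
      qed (auto simp: \<phi>_def)
      then show "\<phi> (h \<otimes>\<^bsub>pos_rat_group\<lparr>carrier := H\<rparr>\<^esub> k) = \<phi> h \<otimes>\<^bsub>order_auto_group G le\<^esub> \<phi> k"
        using \<phi>_Bij[OF h] \<phi>_Bij[OF k]
        by (simp add: pos_rat_group_def order_auto_group_def AutoGroup_def BijGroup_def carrier_G)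
    qed (simp add: \<phi>_mem)
    have inj: "inj_on \<phi> H"
    proof (rule inj_onI)
      fix h k assume h: "h \<in> H" "k \<in> H" "\<phi> h = \<phi> k"
      then have "enc (\<Phi> h u) = enc (\<Phi> k u)" using \<phi>_enc[OF u_mem] by metis
      then have "(\<lambda>x. h * u x) = (\<lambda>x. k * u x)"
        using h by (metis enc_eq_iff \<Phi>_mem u_mem unit)
      then show "h = k" using u_nonzero by (metis mult_right_cancel)
    qed
    have surj: "\<exists>h\<in>H. \<psi> = \<phi> h" if \<psi>: "\<psi> \<in> carrier (order_auto_group G le)" for \<psi>
    proof -
      have ext: "\<psi> \<in> extensional (enc ` C)" and b: "bij_betw \<psi> (enc ` C) (enc ` C)"
        and hom: "\<psi> \<in> hom G G"
        and ord: "\<And>a b. a \<in> enc ` C \<Longrightarrow> b \<in> enc ` C \<Longrightarrow> le a b \<longleftrightarrow> le (\<psi> a) (\<psi> b)"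
        using \<psi> by (auto simp: order_auto_group_def auto_def Bij_def carrier_G)
      have \<psi>_mem: "\<psi> (enc f) \<in> enc ` C" if "f \<in> C" for f
        using b that by (auto simp: bij_betw_def)
      define \<psi>' where "\<psi>' f = dec (\<psi> (enc f))" for f
      have \<psi>': "\<psi>' f \<in> C" "enc (\<psi>' f) = \<psi> (enc f)" if "f \<in> C" for f
        using \<psi>_mem[OF that] by (auto simp: \<psi>'_def)
      have "bij_betw (dec \<circ> \<psi> \<circ> enc) C C"
      proof (intro bij_betw_trans)
        show "bij_betw dec (enc ` C) C"
          by (rule bij_betw_byWitness[of _ enc]) auto
      qed (use b enc_bij in auto)
      moreover have "dec \<circ> \<psi> \<circ> enc = \<psi>'"
        by (simp add: \<psi>'_def fun_eq_iff)
      ultimately have bij': "bij_betw \<psi>' C C"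
        by simp
      have "\<exists>h\<in>H. \<forall>f\<in>C. \<psi>' f = \<Phi> h f"
      proof (rule all[OF bij'])
        fix f g assume fg: "f \<in> C" "g \<in> C"
        have "enc (\<psi>' (\<lambda>x. f x + g x)) = \<psi> (enc f \<otimes>\<^bsub>G\<^esub> enc g)"
          using fg by (simp add: \<psi>' add_mem mult_G)
        also have "\<dots> = \<psi> (enc f) \<otimes>\<^bsub>G\<^esub> \<psi> (enc g)"
          using hom fg by (auto simp: hom_def carrier_G)
        also have "\<dots> = enc (\<lambda>x. \<psi>' f x + \<psi>' g x)"
          using fg by (simp add: \<psi>'(1) mult_G flip: \<psi>'(2))
        finally show "\<psi>' (\<lambda>x. f x + g x) = (\<lambda>x. \<psi>' f x + \<psi>' g x)"
          using enc_eq_iff[OF \<psi>'(1)[OF add_mem[OF fg]] add_mem[OF \<psi>'(1)[OF fg(1)] \<psi>'(1)[OF fg(2)]]]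
          by simp
        show "(\<forall>x. f x \<le> g x) \<longleftrightarrow> (\<forall>x. \<psi>' f x \<le> \<psi>' g x)"
          using ord[of "enc f" "enc g"] fg by (simp add: le_enc \<psi>'(1) flip: \<psi>'(2))
      qed
      then obtain h where h: "h \<in> H" "\<And>f. f \<in> C \<Longrightarrow> \<psi>' f = \<Phi> h f" by blast
      have "\<psi> = \<phi> h"
        by (rule extensionalityI[OF ext]) (auto simp: \<phi>_def h(2)[symmetric] \<psi>')
      then show ?thesis using h(1) by blast
    qed
    show "bij_betw \<phi> (carrier (pos_rat_group\<lparr>carrier := H\<rparr>)) (carrier (order_auto_group G le))"
      using inj surj \<phi>_mem by (auto simp: bij_betw_def)
  qed
  show "\<forall>h\<in>H. \<forall>(a::nat) (b::nat). a > 0 \<longrightarrow> b > 0 \<longrightarrow> h = of_nat a / of_nat b \<longrightarrow>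
       \<phi> h (enc u) [^]\<^bsub>G\<^esub> b = enc u [^]\<^bsub>G\<^esub> a"
  proof (intro ballI allI impI)
    fix h and a b :: nat assume h: "h \<in> H" and b: "b > 0" and eq: "h = of_nat a / of_nat b"
    then have "(\<lambda>x. of_nat b * \<Phi> h u x) = (\<lambda>x. of_nat a * u x)"
      by (simp add: unit)
    then show "\<phi> h (enc u) [^]\<^bsub>G\<^esub> b = enc u [^]\<^bsub>G\<^esub> a"
      using pow_G[OF \<Phi>_mem[OF h u_mem]] pow_G[OF u_mem] by (simp add: \<phi>_enc u_mem)
  qed
qed

lemma dimension_group_realization:
  fixes H :: "rat set" and \<Phi> :: "rat \<Rightarrow> ('x \<Rightarrow> rat) \<Rightarrow> 'x \<Rightarrow> rat"
  assumes "subgroup H pos_rat_group"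
    and "\<And>h. h \<in> H \<Longrightarrow> bij_betw (\<Phi> h) C C"
    and "\<And>h f g. h \<in> H \<Longrightarrow> f \<in> C \<Longrightarrow> g \<in> C \<Longrightarrow> \<Phi> h (\<lambda>x. f x + g x) = (\<lambda>x. \<Phi> h f x + \<Phi> h g x)"
    and "\<And>h f g. h \<in> H \<Longrightarrow> f \<in> C \<Longrightarrow> g \<in> C \<Longrightarrow>
      (\<forall>x. f x \<le> g x) \<longleftrightarrow> (\<forall>x. \<Phi> h f x \<le> \<Phi> h g x)"
    and "\<And>h k f. h \<in> H \<Longrightarrow> k \<in> H \<Longrightarrow> f \<in> C \<Longrightarrow> \<Phi> (h * k) f = \<Phi> h (\<Phi> k f)"
    and "\<And>h. h \<in> H \<Longrightarrow> \<Phi> h u = (\<lambda>x. h * u x)"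
    and "\<And>\<psi>. bij_betw \<psi> C C \<Longrightarrow>
      (\<And>f g. f \<in> C \<Longrightarrow> g \<in> C \<Longrightarrow> \<psi> (\<lambda>x. f x + g x) = (\<lambda>x. \<psi> f x + \<psi> g x)) \<Longrightarrow>
      (\<And>f g. f \<in> C \<Longrightarrow> g \<in> C \<Longrightarrow> (\<forall>x. f x \<le> g x) \<longleftrightarrow> (\<forall>x. \<psi> f x \<le> \<psi> g x)) \<Longrightarrow>
      \<exists>h\<in>H. \<forall>f\<in>C. \<psi> f = \<Phi> h f"
  shows "\<exists>(D :: nat monoid) (leq :: nat \<Rightarrow> nat \<Rightarrow> bool) (u :: nat) (\<phi> :: rat \<Rightarrow> nat \<Rightarrow> nat).
    dimension_group D leq u \<and>
    \<phi> \<in> iso (pos_rat_group\<lparr>carrier := H\<rparr>) (order_auto_group D leq) \<and>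
    (\<forall>h\<in>H. \<forall>(a::nat) (b::nat). a > 0 \<longrightarrow> b > 0 \<longrightarrow> h = of_nat a / of_nat b \<longrightarrow>
       \<phi> h u [^]\<^bsub>D\<^esub> b = u [^]\<^bsub>D\<^esub> a)"
  by (intro exI conjI, rule dimension_group_G, rule iso_order_auto_group(1)[OF assms],
      assumption+, rule iso_order_auto_group(2)[OF assms], assumption+)

end

section \<open>The trivial subgroup and the ordered group of integers\<close>

lemma function_dimension_group_int:
  "function_dimension_group (range (\<lambda>z :: int. \<lambda>_ :: unit. rat_of_int z)) (\<lambda>_. 1)"
proof
  let ?C = "range (\<lambda>z :: int. \<lambda>_ :: unit. rat_of_int z)"
  show "countable ?C" by simp
  show "(\<lambda>_. 0) \<in> ?C" by (rule range_eqI[of _ _ 0]) simp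
  show "(\<lambda>_. 1) \<in> ?C" by (rule range_eqI[of _ _ 1]) simp
  show "(\<lambda>x. f x + g x) \<in> ?C" if "f \<in> ?C" "g \<in> ?C" for f g
  proof -
    obtain y z where "f = (\<lambda>_. of_int y)" "g = (\<lambda>_. of_int z)" using \<open>f \<in> ?C\<close> \<open>g \<in> ?C\<close> by blast
    then show ?thesis by (intro range_eqI[of _ _ "y + z"]) simp
  qed
  show "(\<lambda>x. - f x) \<in> ?C" if "f \<in> ?C" for f
  proof -
    obtain z where "f = (\<lambda>_. of_int z)" using \<open>f \<in> ?C\<close> by blast
    then show ?thesis by (intro range_eqI[of _ _ "- z"]) simp
  qed
  show "\<exists>n::nat. \<forall>x. f x \<le> of_nat n * 1" if "f \<in> ?C" for f :: "unit \<Rightarrow> rat"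
    using real_arch_simple[of "f ()"] by simp
  fix F assume F: "F \<subseteq> ?C"
  have "\<exists>n::nat \<Rightarrow> int. f = (\<lambda>x. \<Sum>i<1. of_int (n i) * 1)" if f: "f \<in> F" for f
  proof -
    obtain z where "f = (\<lambda>_. of_int z)" using f F by blast
    then show ?thesis by (intro exI[of _ "\<lambda>_. z"]) simp
  qed
  then show "\<exists>(k::nat) b. (\<forall>i<k. b i \<in> ?C \<and> (\<forall>x. 0 \<le> b i x)) \<and>
      (\<forall>f\<in>F. \<exists>n::nat \<Rightarrow> int. f = (\<lambda>x. \<Sum>i<k. of_int (n i) * b i x)) \<and>
      (\<forall>n::nat \<Rightarrow> int. (\<forall>x. 0 \<le> (\<Sum>i<k. of_int (n i) * b i x)) \<longrightarrow> (\<forall>i<k. 0 \<le> n i))"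
    by (intro exI[of _ 1] exI[of _ "\<lambda>_ _. 1"]) (use \<open>(\<lambda>_. 1) \<in> ?C\<close> in simp)
qed simp_all

text \<open>Additivity makes \<open>\<psi>\<close> multiplication by the image \<open>w\<close> of
  \<open>1\<close>; order gives \<open>0 \<le> w\<close>, and surjectivity makes \<open>w\<close> a
  unit.\<close>

lemma int_order_automorphism:
  fixes \<psi> :: "(unit \<Rightarrow> rat) \<Rightarrow> unit \<Rightarrow> rat"
  defines "C \<equiv> range (\<lambda>z :: int. \<lambda>_ :: unit. rat_of_int z)"
  assumes bij: "bij_betw \<psi> C C"
    and add: "\<And>f g. f \<in> C \<Longrightarrow> g \<in> C \<Longrightarrow> \<psi> (\<lambda>x. f x + g x) = (\<lambda>x. \<psi> f x + \<psi> g x)"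
    and mono: "\<And>f g. f \<in> C \<Longrightarrow> g \<in> C \<Longrightarrow> (\<forall>x. f x \<le> g x) \<longleftrightarrow> (\<forall>x. \<psi> f x \<le> \<psi> g x)"
    and f: "f \<in> C"
  shows "\<psi> f = f"
proof -
  have mem: "(\<lambda>_. of_int z) \<in> C" for z by (simp add: C_def)
  have "\<psi> (\<lambda>_. of_int 1) \<in> C" by (rule bij_betwE[OF bij, rule_format, OF mem])
  then obtain w where w: "\<psi> (\<lambda>_. of_int 1) = (\<lambda>_. of_int w)" by (auto simp: C_def)
  have step: "\<psi> (\<lambda>_. of_int (z + 1)) = (\<lambda>x. \<psi> (\<lambda>_. of_int z) x + of_int w)" for z
    using add[OF mem[of z] mem[of 1]] w by simp
  have zero: "\<psi> (\<lambda>_. of_int 0) = (\<lambda>_. 0)"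
    using add[OF mem[of 0] mem[of 0]] by (simp add: fun_eq_iff)
  have val: "\<psi> (\<lambda>_. of_int z) = (\<lambda>_. of_int (z * w))" for z
  proof (induction z rule: int_induct[of _ 0])
    case (step1 i)
    then show ?case using step[of i] by (simp add: algebra_simps)
  next
    case (step2 i)
    then show ?case using step[of "i - 1"] by (simp add: fun_eq_iff algebra_simps)
  qed (use zero in simp)
  have "0 \<le> w" using mono[OF mem[of 0] mem[of 1]] w zero by simp
  moreover have "\<exists>z. z * w = 1"
  proof -
    have "(\<lambda>_. of_int 1) \<in> \<psi> ` C" using bij mem[of 1] by (simp add: bij_betw_def)
    then obtain z where "(\<lambda>_ :: unit. rat_of_int 1) = \<psi> (\<lambda>_. of_int z)" by (auto simp: C_def)
    then have "(\<lambda>_ :: unit. rat_of_int 1) = (\<lambda>_. of_int (z * w))" unfolding val .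
    then have "rat_of_int 1 = of_int (z * w)" by (rule fun_cong)
    then have "1 = z * w" by (simp only: of_int_eq_iff)
    then show ?thesis by metis
  qed
  ultimately have "w = 1" by (auto simp: zmult_eq_1_iff)
  then show ?thesis using f val by (auto simp: C_def)
qed

section \<open>Functions with averaging rows\<close>

text \<open>The product of the absolute numerators works. Applied to inverses, this clears
  denominators.\<close>

lemma finite_common_multiplier:
  fixes S :: "rat set"
  assumes "finite S" "\<And>h. h \<in> S \<Longrightarrow> h \<noteq> 0"
  shows "\<exists>K::nat>0. \<forall>h\<in>S. of_nat K / h \<in> \<int>"
  using assms
proof (induction S rule: finite_induct)
  case empty
  then show ?case by (intro exI[of _ 1]) auto
next
  case (insert h S)
  then obtain K :: nat where K: "K > 0" "\<forall>h\<in>S. of_nat K / h \<in> \<int>" by auto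
  obtain a b where ab: "quotient_of h = (a, b)" by force
  then have b: "b > 0" and h: "h = of_int a / of_int b"
    by (auto simp: quotient_of_denom_pos quotient_of_div)
  have a: "a \<noteq> 0" using h insert.prems[of h] by auto
  have "of_nat (nat \<bar>a\<bar>) / h \<in> \<int>"
    using a b by (cases "a > 0") (auto simp: h)
  then have "of_nat K * (of_nat (nat \<bar>a\<bar>) / h) \<in> \<int>" by (intro Ints_mult) auto
  moreover have "of_nat (nat \<bar>a\<bar>) * (of_nat K / h') \<in> \<int>" if "h' \<in> S" for h'
    using K(2) that by (intro Ints_mult) auto
  ultimately show ?case
    using K(1) a by (intro exI[of _ "nat \<bar>a\<bar> * K"]) (auto simp: mult_ac)
qed

lemma prime_mult_notin_Ints:
  fixes y :: rat and p a :: int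
  assumes "prime p" "of_int p * y \<in> \<int>" "y \<notin> \<int>" "\<not> p dvd a"
  shows "of_int a * y \<notin> \<int>"
proof
  assume ay: "of_int a * y \<in> \<int>"
  have "coprime p a" using assms by (simp add: prime_imp_coprime)
  then obtain u v where "u * p + v * a = 1" by (metis bezout_int coprime_iff_gcd_eq_1)
  then have "y = of_int (u * p + v * a) * y" by (simp del: of_int_add of_int_mult)
  also have "\<dots> = of_int u * (of_int p * y) + of_int v * (of_int a * y)"
    by (simp add: algebra_simps)
  also have "\<dots> \<in> \<int>" 
    using Ints_mult[OF Ints_of_int[of u] assms(2)] Ints_mult[OF Ints_of_int[of v] ay] by (rule Ints_add)
  finally show False using assms(3) by simp
qed

text \<open>Row \<open>0\<close> is the root. By \<open>cofinal\<close> every nontrivial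
  \<open>k\<close> is the twist \<open>g j\<close> of arbitrarily late children of each row; this is
  the source both of rigidity and of divisibility. \<open>g 0\<close> also serves as a sample
  nontrivial element of \<open>H\<close>.\<close>

locale averaging_tower =
  fixes H :: "rat set" and par :: "nat \<Rightarrow> nat" and g :: "nat \<Rightarrow> rat"
  assumes H_pos: "h \<in> H \<Longrightarrow> 0 < h"
    and one_H: "1 \<in> H"
    and mult_H: "h \<in> H \<Longrightarrow> k \<in> H \<Longrightarrow> h * k \<in> H"
    and inverse_H: "h \<in> H \<Longrightarrow> inverse h \<in> H"
    and par_less: "0 < j \<Longrightarrow> par j < j"
    and g_H: "g j \<in> H"
    and g_neq_1: "g j \<noteq> 1"
    and cofinal: "k \<in> H \<Longrightarrow> k \<noteq> 1 \<Longrightarrow> \<exists>j\<ge>m. 0 < j \<and> par j = i \<and> g j = k"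
begin

section \<open>Weights and normalising constants\<close>

definition den :: "nat \<Rightarrow> int" where "den j = snd (quotient_of (g j))"
definition num :: "nat \<Rightarrow> int" where "num j = fst (quotient_of (g j))"

text \<open>The product of the \<open>B i\<close> with \<open>i < j\<close>, written out because
  \<open>B j\<close> depends on \<open>P j\<close>. It is a common denominator of the values of
  \<open>ind\<close> in the rows before \<open>j\<close>.\<close>

primrec P :: "nat \<Rightarrow> int" where
  "P 0 = 1"
| "P (Suc j) = P j * (4 * den j * fact j * (P j)\<^sup>2)"

text \<open>The factor \<open>4 * (P j)\<^sup>2\<close> makes the weight \<open>1 / B j\<close>
  small against earlier denominators, \<open>fact j\<close> makes late \<open>B j\<close> divisible
  by any given integer, and \<open>den j\<close> ensures that a prime divisor of
  \<open>den j\<close> does not divide \<open>B j - 1\<close>.\<close>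

definition B :: "nat \<Rightarrow> int" where "B j = 4 * den j * fact j * (P j)\<^sup>2"

text \<open>In stage \<open>n\<close> the values at \<open>(i, h)\<close> are multiples of
  \<open>h / c n i\<close>. The factor \<open>den n * B n\<close> makes the averaged values of the
  new row \<open>n\<close> admissible; the parent row receives it too and becomes more
  divisible.\<close>

primrec c :: "nat \<Rightarrow> nat \<Rightarrow> int" where
  "c 0 = (\<lambda>_. 1)"
| "c (Suc n) = (\<lambda>i. if i = n then c n (par n) * (den n * B n)
     else if i = par n then c n i * (den n * B n) else c n i)"

definition averaging :: "nat \<Rightarrow> (nat \<times> rat \<Rightarrow> rat) \<Rightarrow> bool" where
  "averaging n f \<longleftrightarrow> (\<forall>j\<ge>n. \<forall>h. f (j, h) =
     f (par j, h) / of_int (B j) + (1 - 1 / of_int (B j)) * f (par j, g j * h))"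

text \<open>The free abelian group on the points over \<open>H\<close> in the first \<open>n\<close>
  rows, with basis \<open>unit_vec n x\<close>; later rows are determined by averaging. For
  \<open>n = 0\<close> even the root would have to be an average.\<close>

definition D0 :: "nat \<Rightarrow> (nat \<times> rat \<Rightarrow> rat) set" where
  "D0 n = {f. 0 < n \<and> averaging n f \<and> finite {x. fst x < n \<and> f x \<noteq> 0} \<and>
     (\<forall>i<n. \<forall>h. f (i, h) \<noteq> 0 \<longrightarrow> h \<in> H) \<and> (\<forall>i<n. \<forall>h. of_int (c n i) * f (i, h) / h \<in> \<int>)}"

definition D :: "(nat \<times> rat \<Rightarrow> rat) set" where
  "D = {(\<lambda>x. q + f x) |q f n. f \<in> D0 n}"

lemma H_divide: "h \<in> H \<Longrightarrow> k \<in> H \<Longrightarrow> h / k \<in> H"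
  by (simp add: divide_inverse mult_H inverse_H)

lemma zero_notin_H: "0 \<notin> H"
  using H_pos by force

lemma g_pos: "0 < g j"
  using H_pos g_H by blast

lemma g_mult_in_H_iff: "g j * h \<in> H \<longleftrightarrow> h \<in> H"
  using H_divide[of "g j * h" "g j"] g_pos[of j] by (auto simp: mult_H g_H)

lemma g_eq: "g j = of_int (num j) / of_int (den j)"
  unfolding num_def den_def by (rule quotient_of_div) simp

lemma den_pos: "0 < den j"
  by (simp add: den_def quotient_of_denom_pos')

lemma coprime_num_den: "coprime (num j) (den j)"
  unfolding num_def den_def by (rule quotient_of_coprime[of "g j"]) simp

lemma num_pos: "0 < num j"
  using g_pos[of j] den_pos[of j] by (simp add: g_eq zero_less_divide_iff)

lemma P_Suc: "P (Suc j) = P j * B j"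
  by (simp add: B_def)

lemma P_pos: "0 < P j"
  by (induction j) (simp_all add: den_pos)

lemma B_ge: "4 * (P j)\<^sup>2 \<le> B j"
proof -
  have "1 \<le> den j * fact j" using den_pos[of j] by (simp add: int_one_le_iff_zero_less)
  then have "4 * (P j)\<^sup>2 * 1 \<le> 4 * (P j)\<^sup>2 * (den j * fact j)"
    by (intro mult_left_mono) auto
  then show ?thesis by (simp add: B_def mult_ac)
qed

lemma B_ge_P: "4 * P j \<le> B j"
proof -
  have "P j \<le> (P j)\<^sup>2" using P_pos[of j] by (simp add: power2_eq_square int_one_le_iff_zero_less)
  then show ?thesis using B_ge[of j] by linarith
qed

lemma B_ge_4: "4 \<le> B j"
  using B_ge_P[of j] P_pos[of j] by linarith

lemma B_pos: "0 < B j" using B_ge_4[of j] by linarith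

lemma den_dvd_B: "den j dvd B j"
  by (simp add: B_def)

lemma dvd_B:
  assumes "0 < q" "q \<le> j" shows "int q dvd B j"
proof -
  have "q dvd fact j" using assms by (intro dvd_fact) auto
  then have "int q dvd int (fact j)" by (simp only: int_dvd_int_iff)
  then have "int q dvd fact j" by (simp only: of_nat_fact)
  then show ?thesis unfolding B_def by (intro dvd_mult2 dvd_mult)
qed

lemma P_mono: "i \<le> j \<Longrightarrow> P i \<le> P j"
proof (induction j rule: dec_induct)
  case (step n)
  have "P n * 1 \<le> P n * B n" using P_pos[of n] B_pos[of n] by (intro mult_left_mono) auto
  then show ?case using step.IH by (simp add: P_Suc del: P.simps)
qed simp

lemma P_dvd: "i \<le> j \<Longrightarrow> P i dvd P j"
  by (induction j rule: dec_induct) (auto simp: P_Suc simp del: P.simps)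

lemma c_pos: "0 < c n i"
  by (induction n arbitrary: i) (auto simp: den_pos B_pos)

section \<open>Averaging functions and extended indicators\<close>

lemma averagingD:
  "averaging n f \<Longrightarrow> n \<le> j \<Longrightarrow>
    f (j, h) = f (par j, h) / of_int (B j) + (1 - 1 / of_int (B j)) * f (par j, g j * h)"
  by (simp add: averaging_def)

lemma averaging_mono: "averaging n f \<Longrightarrow> n \<le> m \<Longrightarrow> averaging m f"
  by (simp add: averaging_def)

lemma averaging_const: "averaging n (\<lambda>_. q)"
  by (simp add: averaging_def algebra_simps)

lemma averaging_lincomb:
  assumes "averaging n f" "averaging n f'"
  shows "averaging n (\<lambda>x. q * f x + q' * f' x)"
  unfolding averaging_def
proof (intro allI impI)
  fix j h assume "n \<le> j"
  then show "q * f (j, h) + q' * f' (j, h) = (q * f (par j, h) + q' * f' (par j, h)) / of_int (B j) +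
      (1 - 1 / of_int (B j)) * (q * f (par j, g j * h) + q' * f' (par j, g j * h))"
    unfolding averagingD[OF assms(1) \<open>n \<le> j\<close>] averagingD[OF assms(2) \<open>n \<le> j\<close>]
    by (simp add: algebra_simps add_divide_distrib)
qed

lemma averaging_add: "averaging n f \<Longrightarrow> averaging n f' \<Longrightarrow> averaging n (\<lambda>x. f x + f' x)"
  using averaging_lincomb[of n f f' 1 1] by simp

lemma averaging_cmult: "averaging n f \<Longrightarrow> averaging n (\<lambda>x. q * f x)"
  using averaging_lincomb[of n f f q 0] by simp

lemma averaging_diff: "averaging n f \<Longrightarrow> averaging n f' \<Longrightarrow> averaging n (\<lambda>x. f x - f' x)"
  using averaging_lincomb[of n f f' 1 "- 1"] by simp

lemma averaging_sum: "(\<And>s. s \<in> S \<Longrightarrow> averaging n (f s)) \<Longrightarrow> averaging n (\<lambda>x. \<Sum>s\<in>S. f s x)"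
  by (induction S rule: infinite_finite_induct) (auto simp: averaging_const averaging_add)

lemma weight_bounds: "0 < 1 / rat_of_int (B j)" "1 / rat_of_int (B j) < 1"
  using B_ge_4[of j] by (auto simp: divide_less_eq)

text \<open>Later values are convex combinations of two values in the parent row, so inequalities,
  and hence equalities, only have to be checked in the rows below \<open>n\<close>.\<close>

lemma averaging_nonneg:
  assumes "averaging n f" "0 < n" "\<And>i h. i < n \<Longrightarrow> 0 \<le> f (i, h)"
  shows "0 \<le> f x"
proof -
  have "0 \<le> f (j, h)" for j h
  proof (induction j arbitrary: h rule: less_induct)
    case (less j)
    show ?case
    proof (cases "j < n")
      case True
      then show ?thesis using assms by simp
    next
      case False
      then have "par j < j" using par_less[of j] assms(2) by simp
      then show ?thesis
        using less.IH[of "par j"] weight_bounds[of j] averagingD[OF assms(1), of j h] False B_pos[of j]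
        by simp
    qed
  qed
  then show ?thesis by (cases x) simp
qed

lemma averaging_le:
  assumes "averaging n f" "averaging n f'" "0 < n" "\<And>i h. i < n \<Longrightarrow> f (i, h) \<le> f' (i, h)"
  shows "f x \<le> f' x"
  using averaging_nonneg[OF averaging_diff[OF assms(2,1)] assms(3), of x] assms(4) by simp

lemma averaging_eqI:
  assumes "averaging n f" "averaging n f'" "0 < n" "\<And>i h. i < n \<Longrightarrow> f (i, h) = f' (i, h)"
  shows "f = f'"
  using averaging_le[OF assms(1,2,3)] averaging_le[OF assms(2,1,3)] assms(4)
  by (intro ext order_antisym) auto

text \<open>The guard \<open>j \<le> par j\<close> only serves to make the recursion total; it never holds for \<open>0 < j\<close>.\<close>

function extend :: "nat \<Rightarrow> (nat \<times> rat \<Rightarrow> rat) \<Rightarrow> nat \<Rightarrow> rat \<Rightarrow> rat" where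
  "extend n a j h = (if j < n \<or> j \<le> par j then a (j, h)
     else extend n a (par j) h / of_int (B j) + (1 - 1 / of_int (B j)) * extend n a (par j) (g j * h))"
  by auto
termination
  by (relation "measure (\<lambda>(n, a, j, h). j)") auto

declare extend.simps [simp del]

lemma extend_base: "j < n \<Longrightarrow> extend n a j h = a (j, h)"
  by (subst extend.simps) simp

text \<open>For \<open>0 < n\<close> the value at \<open>(j, h)\<close> is the probability that a
  random walk, moving from \<open>(j, h)\<close> to \<open>(par j, h)\<close> with probability
  \<open>1 / B j\<close> and to \<open>(par j, g j * h)\<close> otherwise, enters the rows below
  \<open>n\<close> at \<open>x\<close>.\<close>

definition ind :: "nat \<Rightarrow> nat \<times> rat \<Rightarrow> nat \<times> rat \<Rightarrow> rat" where
  "ind n x = (\<lambda>(j, h). extend n (\<lambda>y. if y = x then 1 else 0) j h)"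

lemma ind_averaging:
  assumes "0 < n" shows "averaging n (ind n x)"
  unfolding averaging_def ind_def
proof (intro allI impI)
  fix j h assume "n \<le> j"
  then have "\<not> (j < n \<or> j \<le> par j)" using par_less[of j] assms by auto
  then show "(case (j, h) of (j, h) \<Rightarrow> extend n (\<lambda>y. if y = x then 1 else 0) j h) =
      (case (par j, h) of (j, h) \<Rightarrow> extend n (\<lambda>y. if y = x then 1 else 0) j h) / of_int (B j) +
      (1 - 1 / of_int (B j)) *
      (case (par j, g j * h) of (j, h) \<Rightarrow> extend n (\<lambda>y. if y = x then 1 else 0) j h)"
    unfolding prod.case by (subst extend.simps) (simp only: if_False)
qed

lemma ind_base: "fst y < n \<Longrightarrow> ind n x y = (if y = x then 1 else 0)"
  by (cases y) (simp add: ind_def extend_base)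

lemma ind_nonneg: "0 < n \<Longrightarrow> 0 \<le> ind n x y"
  by (rule averaging_nonneg[OF ind_averaging]) (auto simp: ind_base)

lemma ind_le_1: "0 < n \<Longrightarrow> ind n x y \<le> 1"
  by (rule averaging_le[OF ind_averaging averaging_const]) (auto simp: ind_base)

section \<open>The stages \<open>D0 n\<close> and the group \<open>D\<close>\<close>

lemma c_Suc_new: "c (Suc n) n = c n (par n) * (den n * B n)"
  and c_Suc_par: "0 < n \<Longrightarrow> c (Suc n) (par n) = c n (par n) * (den n * B n)"
  and c_Suc_other: "i \<noteq> n \<Longrightarrow> i \<noteq> par n \<Longrightarrow> c (Suc n) i = c n i"
  using par_less[of n] by auto

declare c.simps(2) [simp del]

lemma c_dvd_Suc: "i < n \<Longrightarrow> c n i dvd c (Suc n) i"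
  by (cases "i = par n") (auto simp: c_Suc_par c_Suc_other)

lemma c_dvd: "n \<le> m \<Longrightarrow> i < n \<Longrightarrow> c n i dvd c m i"
proof (induction m rule: dec_induct)
  case (step m)
  then show ?case using c_dvd_Suc[of i m] by (meson dvd_trans less_le_trans)
qed simp

lemma D0_pos: "f \<in> D0 n \<Longrightarrow> 0 < n"
  and D0_averaging: "f \<in> D0 n \<Longrightarrow> averaging n f"
  and D0_finite: "f \<in> D0 n \<Longrightarrow> finite {x. fst x < n \<and> f x \<noteq> 0}"
  and D0_int: "f \<in> D0 n \<Longrightarrow> i < n \<Longrightarrow> of_int (c n i) * f (i, h) / h \<in> \<int>"
  by (auto simp: D0_def)

lemma averaging_support:
  assumes "averaging n f" "0 < n" "\<forall>i<n. \<forall>h. f (i, h) \<noteq> 0 \<longrightarrow> h \<in> H"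
  shows "f (j, h) \<noteq> 0 \<Longrightarrow> h \<in> H"
proof (induction j arbitrary: h rule: less_induct)
  case (less j)
  show ?case
  proof (cases "j < n")
    case False
    then have "f (par j, h) \<noteq> 0 \<or> f (par j, g j * h) \<noteq> 0"
      using averagingD[OF assms(1), of j h] less.prems by auto
    moreover have "par j < j" using par_less[of j] False assms(2) by simp
    ultimately show ?thesis using less.IH g_mult_in_H_iff by blast
  qed (use assms less.prems in auto)
qed

lemma D0_support: "f \<in> D0 n \<Longrightarrow> f (j, h) \<noteq> 0 \<Longrightarrow> h \<in> H"
  by (rule averaging_support[of n]) (auto simp: D0_def)

lemma D0_outside: "f \<in> D0 n \<Longrightarrow> h \<notin> H \<Longrightarrow> f (j, h) = 0"
  using D0_support by blast

text \<open>Multiplying the averaging equation by \<open>c n (par n) * den n * B n / h\<close>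
  clears denominators, and \<open>g n = num n / den n\<close> normalises the second term at
  \<open>g n * h\<close>. The integer coefficients serve to preserve integrality and to trace its
  failure.\<close>

lemma new_row:
  assumes "averaging n f"
  shows "of_int (c (Suc n) n) * f (n, h) / h = of_int (den n) * (of_int (c n (par n)) * f (par n, h) / h)
    + of_int (num n * (B n - 1)) * (of_int (c n (par n)) * f (par n, g n * h) / (g n * h))"
proof (cases "h = 0")
  case False
  have B: "rat_of_int (B n) \<noteq> 0" using B_pos[of n] by simp
  have d: "rat_of_int (den n) \<noteq> 0" using den_pos[of n] by simp
  have m: "rat_of_int (num n) \<noteq> 0" using num_pos[of n] by simp
  show ?thesis
    unfolding averagingD[OF assms order_refl] c_Suc_new using False B d m
    by (simp add: g_eq[of n] field_simps)
qed simp

lemma finite_rows_Suc: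
  assumes "averaging n f" "0 < n" "finite {x. fst x < n \<and> f x \<noteq> 0}"
  shows "finite {x. fst x < Suc n \<and> f x \<noteq> 0}"
proof -
  let ?S = "{x. fst x < n \<and> f x \<noteq> 0}"
  have "x \<in> ?S \<union> Pair n ` snd ` ?S \<union> Pair n ` (\<lambda>x. snd x / g n) ` ?S"
    if x: "fst x < Suc n" "f x \<noteq> 0" for x
  proof (cases "fst x = n")
    case True
    then obtain h where h: "x = (n, h)" by (cases x) auto
    have "f (par n, h) \<noteq> 0 \<or> f (par n, g n * h) \<noteq> 0"
      using averagingD[OF assms(1) order_refl, of h] x h by auto
    then consider "f (par n, h) \<noteq> 0" | "f (par n, g n * h) \<noteq> 0" by blast
    then show ?thesis
    proof cases
      case 1
      then have "(par n, h) \<in> ?S" using par_less assms(2) by auto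
      then show ?thesis using h by force
    next
      case 2
      then have "(par n, g n * h) \<in> ?S" using par_less assms(2) by auto
      moreover have "h = snd (par n, g n * h) / g n" using g_pos[of n] by simp
      ultimately show ?thesis using h by blast
    qed
  qed (use x in auto)
  then have "{x. fst x < Suc n \<and> f x \<noteq> 0} \<subseteq> ?S \<union> Pair n ` snd ` ?S \<union> Pair n ` (\<lambda>x. snd x / g n) ` ?S"
    by blast
  then show ?thesis by (rule finite_subset) (use assms in auto)
qed

text \<open>The stages increase, so finitely many elements of \<open>D\<close> can be treated at one
  late stage. Integrality comes from \<open>new_row\<close> in row \<open>n\<close> and from
  divisibility of the constants in older rows.\<close>

lemma D0_Suc: assumes f: "f \<in> D0 n" shows "f \<in> D0 (Suc n)"
proof -
  note n = D0_pos[OF f] and a = D0_averaging[OF f]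
  have "of_int (c (Suc n) i) * f (i, h) / h \<in> \<int>" if "i < Suc n" for i h
  proof (cases "i = n")
    case True
    have "par n < n" using par_less n by simp
    then show ?thesis
      unfolding True new_row[OF a] by (intro Ints_add Ints_mult D0_int[OF f]) auto
  next
    case False
    then have "i < n" using that by simp
    then obtain k where k: "c (Suc n) i = k * c n i" using c_dvd_Suc[of i n] by (auto simp: dvd_def mult.commute)
    have "of_int k * (of_int (c n i) * f (i, h) / h) \<in> \<int>"
      using \<open>i < n\<close> by (intro Ints_mult D0_int[OF f]) auto
    then show ?thesis by (simp add: k mult_ac)
  qed
  then show ?thesis
    using finite_rows_Suc[OF a n D0_finite[OF f]] averaging_mono[OF a, of "Suc n"] D0_support[OF f] n
    by (auto simp: D0_def)
qed

lemma D0_mono: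
  assumes "f \<in> D0 n" "n \<le> m" shows "f \<in> D0 m"
  using assms(2,1) by (induction m rule: dec_induct) (auto intro: D0_Suc)

lemma D0_lincomb:
  assumes "f \<in> D0 n" "f' \<in> D0 n"
  shows "(\<lambda>x. of_int a * f x + of_int b * f' x) \<in> D0 n"
proof -
  have "finite {x. fst x < n \<and> of_int a * f x + of_int b * f' x \<noteq> 0}"
    by (rule finite_subset[OF _ finite_UnI[OF D0_finite[OF assms(1)] D0_finite[OF assms(2)]]]) auto
  moreover have "of_int (c n i) * (of_int a * f (i, h) + of_int b * f' (i, h)) / h \<in> \<int>" if "i < n" for i h
  proof -
    have "of_int a * (of_int (c n i) * f (i, h) / h) + of_int b * (of_int (c n i) * f' (i, h) / h) \<in> \<int>"
      using that by (intro Ints_add Ints_mult D0_int[OF assms(1)] D0_int[OF assms(2)]) auto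
    then show ?thesis by (simp add: algebra_simps add_divide_distrib)
  qed
  moreover have "h \<in> H" if "of_int a * f (i, h) + of_int b * f' (i, h) \<noteq> 0" for i h
    using that D0_support[OF assms(1), of i h] D0_support[OF assms(2), of i h]
    by (cases "f (i, h) = 0"; cases "f' (i, h) = 0") simp_all
  ultimately show ?thesis
    using averaging_lincomb[OF D0_averaging D0_averaging, OF assms] D0_pos[OF assms(1)]
    by (auto simp: D0_def)
qed

lemma D0_add: "f \<in> D0 n \<Longrightarrow> f' \<in> D0 n \<Longrightarrow> (\<lambda>x. f x + f' x) \<in> D0 n"
  using D0_lincomb[of f n f' 1 1] by simp

lemma D0_zero: "0 < n \<Longrightarrow> (\<lambda>_. 0) \<in> D0 n"
  by (simp add: D0_def averaging_const)

lemma D0_sum: "0 < n \<Longrightarrow> (\<And>s. s \<in> S \<Longrightarrow> f s \<in> D0 n) \<Longrightarrow> (\<lambda>x. \<Sum>s\<in>S. f s x) \<in> D0 n"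
  by (induction S rule: infinite_finite_induct) (auto simp: D0_zero D0_add)

text \<open>No point \<open>(i, h)\<close> with \<open>h \<notin> H\<close> is in the support of a function in \<open>D0 n\<close>, so \<open>(0, 0)\<close> serves as
  the point at infinity.\<close>

lemma D_I: "f \<in> D0 n \<Longrightarrow> (\<lambda>x. q + f x) \<in> D"
  by (auto simp: D_def)

lemma D_iff: "f \<in> D \<longleftrightarrow> (\<exists>n. (\<lambda>x. f x - f (0, 0)) \<in> D0 n)"
proof
  assume "f \<in> D"
  then obtain q f0 n where f0: "f = (\<lambda>x. q + f0 x)" "f0 \<in> D0 n" by (auto simp: D_def)
  then have "(\<lambda>x. f x - f (0, 0)) = f0"
    using D0_outside[OF f0(2) zero_notin_H] by (simp add: fun_eq_iff)
  then show "\<exists>n. (\<lambda>x. f x - f (0, 0)) \<in> D0 n" using f0(2) by auto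
next
  assume "\<exists>n. (\<lambda>x. f x - f (0, 0)) \<in> D0 n"
  then have "(\<lambda>x. f (0, 0) + (f x - f (0, 0))) \<in> D" by (elim exE) (rule D_I)
  then show "f \<in> D" by simp
qed

lemma D0_subset_D: "f \<in> D0 n \<Longrightarrow> f \<in> D"
  using D_I[of f n 0] by simp

lemma const_mem_D: "(\<lambda>_. q) \<in> D"
  using D_I[OF D0_zero[of 1], of q] by simp

lemma D_common_stage:
  assumes "f \<in> D" "f' \<in> D"
  obtains n where "(\<lambda>x. f x - f (0, 0)) \<in> D0 n" "(\<lambda>x. f' x - f' (0, 0)) \<in> D0 n"
proof -
  obtain n n' where "(\<lambda>x. f x - f (0, 0)) \<in> D0 n" "(\<lambda>x. f' x - f' (0, 0)) \<in> D0 n'"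
    using assms by (auto simp: D_iff)
  then show ?thesis using that[of "max n n'"] D0_mono by (meson max.cobounded1 max.cobounded2)
qed

lemma D_lincomb:
  assumes "f \<in> D" "f' \<in> D"
  shows "(\<lambda>x. of_int a * f x + of_int b * f' x) \<in> D"
proof -
  obtain n where n: "(\<lambda>x. f x - f (0, 0)) \<in> D0 n" "(\<lambda>x. f' x - f' (0, 0)) \<in> D0 n"
    using D_common_stage[OF assms] .
  have "(\<lambda>x. (of_int a * f (0, 0) + of_int b * f' (0, 0)) +
      (of_int a * (f x - f (0, 0)) + of_int b * (f' x - f' (0, 0)))) \<in> D"
    by (rule D_I[OF D0_lincomb[OF n]])
  then show ?thesis by (simp add: algebra_simps)
qed

lemma D_add: "f \<in> D \<Longrightarrow> f' \<in> D \<Longrightarrow> (\<lambda>x. f x + f' x) \<in> D"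
  using D_lincomb[of f f' 1 1] by simp

lemma D_diff: "f \<in> D \<Longrightarrow> f' \<in> D \<Longrightarrow> (\<lambda>x. f x - f' x) \<in> D"
  using D_lincomb[of f f' 1 "- 1"] by simp

lemma D_cmult: "f \<in> D \<Longrightarrow> (\<lambda>x. of_int a * f x) \<in> D"
  using D_lincomb[of f f a 0] by simp

lemma D_averaging: "(\<lambda>x. f x - f (0, 0)) \<in> D0 n \<Longrightarrow> averaging n f"
  using averaging_add[OF D0_averaging averaging_const, of "\<lambda>x. f x - f (0, 0)" n "f (0, 0)"] by simp

lemma support_rows:
  assumes "f \<in> D" shows "finite {x. fst x < m \<and> f x \<noteq> f (0, 0)}"
proof -
  obtain n where n: "(\<lambda>x. f x - f (0, 0)) \<in> D0 n" using assms by (auto simp: D_iff)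
  then have "(\<lambda>x. f x - f (0, 0)) \<in> D0 (max n m)" by (rule D0_mono) simp
  then have "finite {x. fst x < max n m \<and> f x - f (0, 0) \<noteq> 0}" by (rule D0_finite)
  then show ?thesis by (rule rev_finite_subset) auto
qed

lemma D_bounded:
  assumes "f \<in> D" shows "\<exists>N::nat. \<forall>x. \<bar>f x\<bar> \<le> of_nat N"
proof -
  obtain n where n: "(\<lambda>x. f x - f (0, 0)) \<in> D0 n" using assms by (auto simp: D_iff)
  let ?S = "insert (0, 0) {x. fst x < n \<and> f x \<noteq> f (0, 0)}"
  have fin: "finite ?S" using support_rows[OF assms] by simp
  obtain N :: nat where "Max ((\<lambda>x. \<bar>f x\<bar>) ` ?S) \<le> of_nat N" using reals_Archimedean2 less_imp_le by blast
  then have "\<bar>f x\<bar> \<le> of_nat N" if "x \<in> ?S" for x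
    using fin that by (meson Max_ge finite_imageI imageI order_trans)
  then have base: "\<bar>f (i, h)\<bar> \<le> of_nat N" if "i < n" for i h
    using that by (cases "f (i, h) = f (0, 0)") fastforce+
  have a: "averaging n f" and n0: "0 < n" using n D_averaging D0_pos by auto
  have "f x \<le> of_nat N" for x
    by (rule averaging_le[OF a averaging_const n0]) (use base in \<open>auto simp: abs_le_iff\<close>)
  moreover have "- of_nat N \<le> f x" for x
    by (rule averaging_le[OF averaging_const a n0]) (use base in \<open>auto simp: abs_le_iff minus_le_iff\<close>)
  ultimately show ?thesis by (intro exI[of _ N]) (auto simp: abs_le_iff minus_le_iff)
qed

section \<open>Generators of the stages and countability\<close>

definition unit_vec :: "nat \<Rightarrow> nat \<times> rat \<Rightarrow> nat \<times> rat \<Rightarrow> rat" where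
  "unit_vec n x y = snd x / of_int (c n (fst x)) * ind n x y"

lemma ind_finite: "finite {y. fst y < n \<and> ind n x y \<noteq> 0}"
  by (rule finite_subset[of _ "{x}"]) (auto simp: ind_base split: if_splits)

lemma scaled_ind_mem:
  assumes "i < n" "h \<in> H" "of_int (c n i) * q / h \<in> \<int>"
  shows "(\<lambda>y. q * ind n (i, h) y) \<in> D0 n"
proof -
  have "finite {y. fst y < n \<and> q * ind n (i, h) y \<noteq> 0}"
    by (rule finite_subset[OF _ ind_finite]) auto
  then show ?thesis
    using assms by (auto simp: D0_def ind_base intro!: averaging_cmult ind_averaging split: if_splits)
qed

text \<open>The factor \<open>snd x / c n (fst x)\<close> is the least positive value that
  integrality permits at \<open>x\<close>.\<close>

lemma unit_vec_mem: "fst x < n \<Longrightarrow> snd x \<in> H \<Longrightarrow> unit_vec n x \<in> D0 n"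
  using scaled_ind_mem[of "fst x" n "snd x" "snd x / of_int (c n (fst x))"] c_pos[of n "fst x"]
    H_pos[of "snd x"]
  by (simp add: unit_vec_def[abs_def])

lemma unit_vec_scale_pos: "snd x \<in> H \<Longrightarrow> 0 < snd x / of_int (c n (fst x))"
  using c_pos[of n "fst x"] H_pos[of "snd x"] by simp

lemma averaging_expand:
  assumes "averaging n f" "0 < n" "finite S" "\<And>x. fst x < n \<Longrightarrow> f x \<noteq> 0 \<Longrightarrow> x \<in> S"
    and S: "\<And>x. x \<in> S \<Longrightarrow> fst x < n"
  shows "f = (\<lambda>y. \<Sum>x\<in>S. f x * ind n x y)"
proof (rule averaging_eqI[OF assms(1) _ assms(2)])
  show "averaging n (\<lambda>y. \<Sum>x\<in>S. f x * ind n x y)"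
    by (intro averaging_sum averaging_cmult ind_averaging assms(2))
  fix i h assume "i < n"
  then have "(\<Sum>x\<in>S. f x * ind n x (i, h)) = (\<Sum>x\<in>S. if x = (i, h) then f x else 0)"
    by (intro sum.cong) (auto simp: ind_base)
  also have "\<dots> = f (i, h)"
    using assms(3) assms(4)[of "(i, h)"] \<open>i < n\<close> by (cases "f (i, h) = 0") (auto simp: sum.delta')
  finally show "f (i, h) = (\<Sum>x\<in>S. f x * ind n x (i, h))" by simp
qed

lemma countable_D: "countable D"
proof -
  \<comment> \<open>Codes consist of the value at infinity, a stage, and the list of nonzero values
    below that stage; they form a countable type.\<close>
  define E where "E = (\<lambda>(q :: rat, n, xs) y. q + (\<Sum>z\<leftarrow>xs. snd z * ind n (fst z) y))"
  have "f \<in> range E" if "f \<in> D" for f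
  proof -
    obtain q f0 n where f0: "f = (\<lambda>x. q + f0 x)" "f0 \<in> D0 n" using \<open>f \<in> D\<close> by (auto simp: D_def)
    let ?S = "{x. fst x < n \<and> f0 x \<noteq> 0}"
    obtain xs where xs: "set xs = ?S" "distinct xs"
      using finite_distinct_list[OF D0_finite[OF f0(2)]] by blast
    have "f0 = (\<lambda>y. \<Sum>x\<in>?S. f0 x * ind n x y)"
      by (rule averaging_expand) (use f0 D0_pos D0_averaging D0_finite in auto)
    also have "\<dots> = (\<lambda>y. \<Sum>x\<leftarrow>xs. f0 x * ind n x y)"
      by (simp add: fun_eq_iff sum_list_distinct_conv_sum_set xs)
    finally have "f = E (q, n, map (\<lambda>x. (x, f0 x)) xs)"
      by (simp add: E_def f0(1) fun_eq_iff comp_def)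
    then show ?thesis by blast
  qed
  then show ?thesis by (meson countable_image countableI_type countable_subset subsetI)
qed

section \<open>Eventual divisibility and simplicial subgroups\<close>

lemma ex_child: "\<exists>j\<ge>m. 0 < j \<and> par j = i"
  using cofinal[OF g_H[of 0] g_neq_1[of 0], of m i] by blast

text \<open>Row \<open>i\<close> gains the factor \<open>B j\<close> whenever it is born (\<open>j = i\<close>) or has a child \<open>j\<close>, and \<open>B j\<close> is
  divisible by any given integer for large \<open>j\<close>.\<close>

lemma eventually_divisible:
  assumes f: "f \<in> D0 n" and q: "0 < (q::nat)"
  shows "\<exists>m0\<ge>n. \<forall>m\<ge>m0. \<forall>i<m. \<forall>h. f (i, h) \<noteq> 0 \<longrightarrow> of_int (c m i) / (of_nat q * h) \<in> \<int>"
proof -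
  note n = D0_pos[OF f] and a = D0_averaging[OF f]
  have fin: "finite (snd ` {x. fst x < n \<and> f x \<noteq> 0})" using D0_finite[OF f] by simp
  \<comment> \<open>\<open>K\<close> clears the denominators of \<open>1 / h\<close> for the
    finitely many \<open>h\<close> in the support below row \<open>n\<close>.\<close>
  obtain K :: nat where K: "K > 0"
    "\<And>i h. i < n \<Longrightarrow> f (i, h) \<noteq> 0 \<Longrightarrow> of_nat K / h \<in> \<int>"
  proof -
    assume that: "\<And>K::nat. 0 < K \<Longrightarrow> (\<And>i h. i < n \<Longrightarrow> f (i, h) \<noteq> 0 \<Longrightarrow> of_nat K / h \<in> \<int>) \<Longrightarrow> thesis"
    have "h \<noteq> 0" if "h \<in> snd ` {x. fst x < n \<and> f x \<noteq> 0}" for h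
      using that D0_support[OF f] zero_notin_H by force
    then obtain K :: nat where K: "K > 0" "\<forall>h\<in>snd ` {x. fst x < n \<and> f x \<noteq> 0}. of_nat K / h \<in> \<int>"
      using finite_common_multiplier[OF fin] by blast
    have "of_nat K / h \<in> \<int>" if "i < n" "f (i, h) \<noteq> 0" for i h
      using K(2)[rule_format, of h] image_eqI[of h snd "(i, h)"] that by simp
    then show thesis using that K(1) by blast
  qed
  \<comment> \<open>\<open>I\<close> is an invariant of all stages; \<open>good\<close> is the
    target, without the factor \<open>K\<close> and with \<open>q\<close> to spare.\<close>
  define I where "I m i \<longleftrightarrow> (\<forall>h. f (i, h) \<noteq> 0 \<longrightarrow> of_nat K * of_int (c m i) / h \<in> \<int>)" for m i
  define good where "good m i \<longleftrightarrow> (\<forall>h. f (i, h) \<noteq> 0 \<longrightarrow> of_int (c m i) / (of_nat q * h) \<in> \<int>)" for m i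
  \<comment> \<open>A row that has just gained the factor \<open>B m\<close> stays integral, up to
    \<open>K\<close>, after division by \<open>B m\<close>: a nonzero value in row \<open>m\<close>
    is traced to one of its two parent points.\<close>
  have born: "of_nat K * of_int (c (Suc m) i) / (of_int (B m) * h) \<in> \<int>"
    if m: "n \<le> m" and I: "\<forall>i<m. I m i" and i: "i = m \<or> i = par m" and h: "f (i, h) \<noteq> 0" for m i h
  proof -
    have p: "par m < m" using par_less[of m] m n by simp
    have B: "rat_of_int (B m) \<noteq> 0" using B_pos[of m] by simp
    have "c (Suc m) i = c m (par m) * (den m * B m)"
      using i c_Suc_new c_Suc_par[of m] m n by auto
    then have eq: "of_nat K * of_int (c (Suc m) i) / (of_int (B m) * h) =
        of_int (den m) * (of_nat K * of_int (c m (par m)) / h)"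
      using B by (simp add: field_simps)
    show ?thesis
    proof (cases "f (par m, h) = 0")
      case False
      then have "of_nat K * of_int (c m (par m)) / h \<in> \<int>" using I p by (simp add: I_def)
      then show ?thesis unfolding eq by (rule Ints_mult[OF Ints_of_int])
    next
      case True
      then have "f (par m, g m * h) \<noteq> 0"
        using h i averagingD[OF a m, of h] by auto
      then have "of_nat K * of_int (c m (par m)) / (g m * h) \<in> \<int>" using I p by (simp add: I_def)
      then have "of_int (num m) * (of_nat K * of_int (c m (par m)) / (g m * h)) \<in> \<int>"
        by (rule Ints_mult[OF Ints_of_int])
      also have "of_int (num m) * (of_nat K * of_int (c m (par m)) / (g m * h)) =
          of_int (den m) * (of_nat K * of_int (c m (par m)) / h)"
        using num_pos[of m] den_pos[of m] by (simp add: g_eq field_simps)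
      finally show ?thesis unfolding eq .
    qed
  qed
  have I: "\<forall>i<m. I m i" if "n \<le> m" for m
    using that
  proof (induction m rule: dec_induct)
    case base
    have "of_int (c n i) * (of_nat K / h) \<in> \<int>" if "i < n" "f (i, h) \<noteq> 0" for i h
      by (rule Ints_mult[OF Ints_of_int K(2)[OF that]])
    then show ?case by (auto simp: I_def mult_ac)
  next
    case (step m)
    have "I (Suc m) i" if "i < Suc m" for i
    proof (cases "i = m \<or> i = par m")
      case True
      have "of_nat K * of_int (c (Suc m) i) / h \<in> \<int>" if "f (i, h) \<noteq> 0" for h
      proof -
        have "of_int (B m) * (of_nat K * of_int (c (Suc m) i) / (of_int (B m) * h)) \<in> \<int>"
          by (rule Ints_mult[OF Ints_of_int born[OF step.hyps(1) step.IH True that]])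
        then show ?thesis using B_pos[of m] by simp
      qed
      then show ?thesis by (simp add: I_def)
    next
      case False
      then show ?thesis using step.IH that by (simp add: I_def c_Suc_other)
    qed
    then show ?case by blast
  qed
  \<comment> \<open>For \<open>K * q \<le> m\<close> the product \<open>K * q\<close> divides
    \<open>B m\<close>, which pays for both factors.\<close>
  have new: "good (Suc m) i" if m: "n \<le> m" "K * q \<le> m" and i: "i = m \<or> i = par m" for m i
    unfolding good_def
  proof (intro allI impI)
    fix h assume h: "f (i, h) \<noteq> 0"
    obtain k where k: "B m = int (K * q) * k" using dvd_B[of "K * q" m] K(1) q m(2) by (auto simp: dvd_def)
    have k0: "k \<noteq> 0" using k B_pos[of m] by auto
    have "of_int k * (of_nat K * of_int (c (Suc m) i) / (of_int (B m) * h)) \<in> \<int>"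
      by (rule Ints_mult[OF Ints_of_int born[OF m(1) I[OF m(1)] i h]])
    also have "of_int k * (of_nat K * of_int (c (Suc m) i) / (of_int (B m) * h)) =
        of_int (c (Suc m) i) / (of_nat q * h)"
      using K(1) q k0 by (simp add: k)
    finally show "of_int (c (Suc m) i) / (of_nat q * h) \<in> \<int>" .
  qed
  have good_mono: "good m' i" if good: "good m i" "m \<le> m'" "i < m" for m m' i
    unfolding good_def
  proof (intro allI impI)
    fix h assume h: "f (i, h) \<noteq> 0"
    obtain k where k: "c m' i = k * c m i" using c_dvd[OF good(2,3)] by (auto simp: dvd_def mult.commute)
    have "of_int k * (of_int (c m i) / (of_nat q * h)) \<in> \<int>"
      using good(1) h by (intro Ints_mult[OF Ints_of_int]) (auto simp: good_def)
    then show "of_int (c m' i) / (of_nat q * h) \<in> \<int>" by (simp add: k)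
  qed
  define m1 where "m1 = max n (K * q)"
  obtain ch where ch: "\<And>i. m1 \<le> ch i" "\<And>i. 0 < ch i" "\<And>i. par (ch i) = i"
    using ex_child[of m1] by metis
  \<comment> \<open>By stage \<open>m0\<close> every row below \<open>m1\<close> has had a child
    born at or after \<open>m1\<close>; rows from \<open>m1\<close> on are good from their
    birth.\<close>
  define m0 where "m0 = Suc (m1 + (\<Sum>i<m1. ch i))"
  have "good m i" if m: "m0 \<le> m" "i < m" for m i
  proof (cases "i < m1")
    case True
    then have "ch i \<le> (\<Sum>i<m1. ch i)" by (intro member_le_sum) auto
    then have "Suc (ch i) \<le> m" using m(1) by (simp add: m0_def)
    moreover have "good (Suc (ch i)) i" using ch[of i] by (intro new) (auto simp: m1_def)
    moreover have "i < Suc (ch i)" using ch(1)[of i] True by simp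
    ultimately show ?thesis using good_mono by blast
  next
    case False
    then have "good (Suc i) i" by (intro new) (auto simp: m1_def)
    then show ?thesis using good_mono[of "Suc i" i m] m by simp
  qed
  then show ?thesis
    by (intro exI[of _ m0]) (auto simp: good_def m0_def m1_def)
qed

text \<open>Eventual divisibility with \<open>q = 1\<close>: once \<open>c m i / h\<close> is an
  integer, the value \<open>1\<close> is admissible at \<open>(i, h)\<close>.\<close>

lemma eventually_ind_mem:
  assumes "h \<in> H"
  shows "\<exists>m0. \<forall>m\<ge>m0. i < m \<and> ind m (i, h) \<in> D0 m"
proof -
  have uv: "unit_vec (Suc i) (i, h) \<in> D0 (Suc i)" using assms by (intro unit_vec_mem) auto
  obtain m0 where m0: "m0 \<ge> Suc i"
    "\<forall>m\<ge>m0. \<forall>j<m. \<forall>k. unit_vec (Suc i) (i, h) (j, k) \<noteq> 0 \<longrightarrow> of_int (c m j) / (of_nat 1 * k) \<in> \<int>"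
    using eventually_divisible[OF uv, of 1, OF zero_less_one] by (elim exE conjE) (rule that)
  have nz: "unit_vec (Suc i) (i, h) (i, h) \<noteq> 0"
    using c_pos[of "Suc i" i] H_pos[OF assms] by (simp add: unit_vec_def ind_base)
  have "i < m \<and> ind m (i, h) \<in> D0 m" if "m \<ge> m0" for m
  proof -
    have "i < m" using m0(1) that by simp
    then have "of_int (c m i) / (of_nat 1 * h) \<in> \<int>" using m0(2) that nz by blast
    then have "of_int (c m i) * 1 / h \<in> \<int>" by simp
    then show ?thesis using scaled_ind_mem[of i m h 1] assms \<open>i < m\<close> by simp
  qed
  then show ?thesis by blast
qed

lemma eventually_ind_mem_D:
  assumes "snd x \<in> H"
  obtains m0 where "\<And>m. m \<ge> m0 \<Longrightarrow> fst x < m \<and> ind m x \<in> D0 m"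
  using eventually_ind_mem[OF assms, of "fst x"] that by auto

lemma ind_infinity: "0 < n \<Longrightarrow> snd x \<in> H \<Longrightarrow> h \<notin> H \<Longrightarrow> ind n x (j, h) = 0"
  using averaging_support[OF ind_averaging, of n x j h] by (force simp: ind_base split: if_splits)

text \<open>The basis of a simplicial subgroup containing a finite set: at a late stage \<open>m\<close>, a multiple of
  \<open>ind m x\<close> for each point \<open>x\<close> of the rows below \<open>m\<close> where some element differs from its value at infinity,
  together with a fraction of the remaining part of the constant function.\<close>

lemma simplicial_D:
  assumes F: "finite F" "F \<subseteq> D"
  shows "\<exists>(k::nat) b. (\<forall>i<k. b i \<in> D \<and> (\<forall>x. 0 \<le> b i x)) \<and>
    (\<forall>f\<in>F. \<exists>n::nat \<Rightarrow> int. f = (\<lambda>x. \<Sum>i<k. of_int (n i) * b i x)) \<and>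
    (\<forall>n::nat \<Rightarrow> int. (\<forall>x. 0 \<le> (\<Sum>i<k. of_int (n i) * b i x)) \<longrightarrow> (\<forall>i<k. 0 \<le> n i))"
proof -
  \<comment> \<open>Inverses of the values at infinity, with \<open>1\<close> standing in for the
    inverse of zero; a multiplier \<open>Q\<close> for them makes each \<open>Q * f (0, 0)\<close>
    integral.\<close>
  let ?h = "\<lambda>f. inverse (if f (0, 0) = 0 then 1 else f (0, 0))"
  have "\<exists>Q::nat>0. \<forall>h\<in>?h ` F. of_nat Q / h \<in> \<int>"
    by (rule finite_common_multiplier) (use F(1) in \<open>auto split: if_splits\<close>)
  then obtain Q :: nat where Q: "Q > 0" and Q': "\<forall>h\<in>?h ` F. of_nat Q / h \<in> \<int>"
    by (elim exE conjE) (rule that)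
  have Q_int: "f (0, 0) * of_nat Q \<in> \<int>" if "f \<in> F" for f
  proof (cases "f (0, 0) = 0")
    case False
    have "of_nat Q / ?h f \<in> \<int>" using Q' that by blast
    then show ?thesis using False by (simp add: divide_inverse mult.commute)
  qed simp
  have "\<exists>m0. \<forall>m\<ge>m0. (\<lambda>x. f x - f (0, 0)) \<in> D0 m \<and>
      (\<forall>i<m. \<forall>h. f (i, h) \<noteq> f (0, 0) \<longrightarrow> of_int (c m i) / (of_nat Q * h) \<in> \<int>)" if "f \<in> F" for f
  proof -
    obtain n where n: "(\<lambda>x. f x - f (0, 0)) \<in> D0 n" using D_iff[of f] F(2) \<open>f \<in> F\<close> by blast
    obtain m0 where m0: "m0 \<ge> n" "\<forall>m\<ge>m0. \<forall>i<m. \<forall>h. f (i, h) - f (0, 0) \<noteq> 0 \<longrightarrow>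
        of_int (c m i) / (of_nat Q * h) \<in> \<int>"
      using eventually_divisible[OF n Q] by (elim exE conjE) (rule that)
    show ?thesis
    proof (intro exI[of _ m0] allI impI conjI)
      fix m assume "m0 \<le> m"
      then show "(\<lambda>x. f x - f (0, 0)) \<in> D0 m" using D0_mono[OF n] m0(1) by simp
      fix i h assume "i < m" "f (i, h) \<noteq> f (0, 0)"
      then show "of_int (c m i) / (of_nat Q * h) \<in> \<int>" using m0(2) \<open>m0 \<le> m\<close> by simp
    qed
  qed
  then obtain M where M: "\<And>f m. f \<in> F \<Longrightarrow> M f \<le> m \<Longrightarrow> (\<lambda>x. f x - f (0, 0)) \<in> D0 m \<and>
      (\<forall>i<m. \<forall>h. f (i, h) \<noteq> f (0, 0) \<longrightarrow> of_int (c m i) / (of_nat Q * h) \<in> \<int>)"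
    by metis
  define m where "m = Suc (\<Sum>f\<in>F. M f)"
  have m: "0 < m" by (simp add: m_def)
  have Mm: "M f \<le> m" if "f \<in> F" for f
    using member_le_sum[of f F M] F(1) that by (simp add: m_def)
  define S where "S = (\<Union>f\<in>F. {x. fst x < m \<and> f x \<noteq> f (0, 0)})"
  have finS: "finite S" unfolding S_def using F support_rows by (intro finite_UN_I) auto
  have S_row: "fst x < m" if "x \<in> S" for x using that by (auto simp: S_def)
  have S_H: "snd x \<in> H" if "x \<in> S" for x
  proof -
    obtain f where f: "f \<in> F" "f (fst x, snd x) - f (0, 0) \<noteq> 0" using \<open>x \<in> S\<close> by (auto simp: S_def)
    show ?thesis using D0_support[OF conjunct1[OF M[OF f(1) Mm[OF f(1)]]] f(2)] .
  qed
  have S_int: "of_int (c m (fst x)) / (of_nat Q * snd x) \<in> \<int>" if "x \<in> S" for x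
  proof -
    obtain f where f: "f \<in> F" "f (fst x, snd x) \<noteq> f (0, 0)" using \<open>x \<in> S\<close> by (auto simp: S_def)
    show ?thesis using conjunct2[OF M[OF f(1) Mm[OF f(1)]]] f(2) S_row[OF that] by blast
  qed
  obtain s where s: "bij_betw s {..<card S} S" using ex_bij_betw_nat_finite[OF finS] by (auto simp: lessThan_atLeast0)
  \<comment> \<open>Below row \<open>m\<close>, \<open>U\<close> is \<open>0\<close> on
    \<open>S\<close> and \<open>1 / Q\<close> elsewhere, so it carries the values at infinity. It
    lies in \<open>D\<close> because of the spare factor \<open>Q\<close> from eventual
    divisibility.\<close>
  define U where "U = (\<lambda>y. 1 / of_nat Q - (\<Sum>x\<in>S. 1 / of_nat Q * ind m x y))"
  define b where "b i = (if i < card S then unit_vec m (s i) else U)" for i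
  have sum_b: "(\<Sum>i<Suc (card S). of_int (n i) * b i y) =
      (\<Sum>x\<in>S. of_int (n (the_inv_into {..<card S} s x)) * unit_vec m x y) + of_int (n (card S)) * U y"
    for n :: "nat \<Rightarrow> int" and y
  proof -
    have "(\<Sum>i<card S. of_int (n i) * b i y) = (\<Sum>i<card S. of_int (n i) * unit_vec m (s i) y)"
      by (intro sum.cong) (auto simp: b_def)
    also have "\<dots> = (\<Sum>i<card S. of_int (n (the_inv_into {..<card S} s (s i))) * unit_vec m (s i) y)"
      using s by (intro sum.cong) (auto simp: bij_betw_def the_inv_into_f_f)
    also have "\<dots> = (\<Sum>x\<in>S. of_int (n (the_inv_into {..<card S} s x)) * unit_vec m x y)"
      by (rule sum.reindex_bij_betw[OF s])
    finally show ?thesis by (simp add: b_def)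
  qed
  have U_mem: "U \<in> D"
  proof -
    have "(\<lambda>y. \<Sum>x\<in>S. 1 / of_nat Q * ind m x y) \<in> D0 m"
    proof (rule D0_sum[OF m])
      fix x assume "x \<in> S"
      then show "(\<lambda>y. 1 / of_nat Q * ind m x y) \<in> D0 m"
        using scaled_ind_mem[of "fst x" m "snd x" "1 / of_nat Q"] S_row S_H S_int by simp
    qed
    then show ?thesis unfolding U_def by (intro D_diff const_mem_D D0_subset_D)
  qed
  have U_base: "U y = (if y \<in> S then 0 else 1 / of_nat Q)" if "fst y < m" for y
  proof -
    have "(\<Sum>x\<in>S. 1 / of_nat Q * ind m x y) = (\<Sum>x\<in>S. if y = x then 1 / rat_of_nat Q else 0)"
      using that by (intro sum.cong) (simp_all add: ind_base)
    then show ?thesis using finS by (simp add: U_def)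
  qed
  have U_nonneg: "0 \<le> U y" for y
  proof (rule averaging_nonneg[OF _ m])
    show "averaging m U" unfolding U_def
      by (intro averaging_diff averaging_const averaging_sum averaging_cmult ind_averaging m)
  qed (simp add: U_base)
  have uv_nonneg: "0 \<le> unit_vec m x y" if "x \<in> S" for x y
    unfolding unit_vec_def
    by (rule mult_nonneg_nonneg[OF less_imp_le[OF unit_vec_scale_pos[OF S_H[OF that]]] ind_nonneg[OF m]])
  have b1: "b i \<in> D \<and> (\<forall>x. 0 \<le> b i x)" if "i < Suc (card S)" for i
  proof (cases "i < card S")
    case True
    then have "s i \<in> S" using s by (auto simp: bij_betw_def)
    then show ?thesis using True uv_nonneg D0_subset_D[OF unit_vec_mem] S_row S_H by (auto simp: b_def)
  qed (use U_mem U_nonneg in \<open>auto simp: b_def\<close>)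
  have b2: "\<exists>n::nat \<Rightarrow> int. f = (\<lambda>y. \<Sum>i<Suc (card S). of_int (n i) * b i y)" if f: "f \<in> F" for f
  proof -
    define f0 where "f0 x = f x - f (0, 0)" for x
    have f0: "f0 \<in> D0 m" using M[OF f Mm[OF f]] by (simp add: f0_def[abs_def])
    obtain z where z: "f (0, 0) * of_nat Q = of_int z" using Q_int[OF f] by (auto elim: Ints_cases)
    \<comment> \<open>The coefficient at \<open>unit_vec m x\<close> is the normalised full value
      \<open>f x\<close>; its constant part is integral because
      \<open>c m (fst x) / (Q * snd x)\<close> is an integer.\<close>
    have "\<exists>k::int. (f0 x + f (0, 0)) * of_int (c m (fst x)) / snd x = of_int k" if x: "x \<in> S" for x
    proof -
      have "of_int (c m (fst x)) * f0 (fst x, snd x) / snd x + of_int z * (of_int (c m (fst x)) / (of_nat Q * snd x)) \<in> \<int>"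
        by (intro Ints_add D0_int[OF f0 S_row[OF x]] Ints_mult[OF Ints_of_int S_int[OF x]])
      moreover have "of_int z * (of_int (c m (fst x)) / (of_nat Q * snd x)) = f (0, 0) * of_int (c m (fst x)) / snd x"
        unfolding z[symmetric] using Q by simp
      ultimately show ?thesis
        by (auto elim!: Ints_cases simp: algebra_simps add_divide_distrib)
    qed
    then obtain k where k: "\<And>x. x \<in> S \<Longrightarrow> (f0 x + f (0, 0)) * of_int (c m (fst x)) / snd x = rat_of_int (k x)"
      by metis
    define n where "n i = (if i < card S then k (s i) else z)" for i
    have n: "n (the_inv_into {..<card S} s x) = k x" if "x \<in> S" for x
    proof -
      have "s ` {..<card S} = S" "inj_on s {..<card S}" using s by (auto simp: bij_betw_def)
      then have "the_inv_into {..<card S} s x < card S" "s (the_inv_into {..<card S} s x) = x"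
        using that the_inv_into_into[of s "{..<card S}" x "{..<card S}"] f_the_inv_into_f[of s "{..<card S}" x] by auto
      then show ?thesis by (simp add: n_def)
    qed
    have "f y = (\<Sum>i<Suc (card S). of_int (n i) * b i y)" for y
    proof -
      have "f0 = (\<lambda>y. \<Sum>x\<in>S. f0 x * ind m x y)"
      proof (rule averaging_expand[OF D0_averaging[OF f0] m finS])
        show "x \<in> S" if "fst x < m" "f0 x \<noteq> 0" for x
          using that f by (auto simp: S_def f0_def)
      qed (rule S_row)
      then have "f0 y = (\<Sum>x\<in>S. f0 x * ind m x y)" by (rule fun_cong)
      then have "f y = f (0, 0) + (\<Sum>x\<in>S. f0 x * ind m x y)"
        unfolding f0_def[of y] by (simp only: diff_eq_eq add.commute)
      also have "\<dots> = (\<Sum>x\<in>S. (f0 x + f (0, 0)) * ind m x y) + f (0, 0) * (1 - (\<Sum>x\<in>S. ind m x y))"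
        by (simp add: algebra_simps sum.distrib sum_distrib_left)
      also have "(\<Sum>x\<in>S. (f0 x + f (0, 0)) * ind m x y) = (\<Sum>x\<in>S. of_int (k x) * unit_vec m x y)"
      proof (rule sum.cong[OF refl])
        fix x assume x: "x \<in> S"
        then have "snd x \<noteq> 0" using S_H zero_notin_H by metis
        then show "(f0 x + f (0, 0)) * ind m x y = of_int (k x) * unit_vec m x y"
          unfolding k[OF x, symmetric] unit_vec_def using c_pos[of m "fst x"] by simp
      qed
      also have "f (0, 0) * (1 - (\<Sum>x\<in>S. ind m x y)) = of_int z * U y"
        unfolding z[symmetric] U_def sum_distrib_left[symmetric] using Q by (simp add: field_simps)
      finally show ?thesis
        unfolding sum_b using n by (simp add: n_def)
    qed
    then show ?thesis by (intro exI[of _ n]) (rule ext)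
  qed
  \<comment> \<open>Among the generators only the \<open>i\<close>-th is nonzero at
    \<open>s i\<close>, and only \<open>U\<close> at infinity; evaluation there isolates each
    coefficient.\<close>
  have b3: "0 \<le> n i" if pos: "\<forall>y. 0 \<le> (\<Sum>i<Suc (card S). of_int (n i) * b i y)" and i: "i < Suc (card S)"
    for n :: "nat \<Rightarrow> int" and i
  proof (cases "i < card S")
    case True
    then have x: "s i \<in> S" using s by (auto simp: bij_betw_def)
    have inv: "the_inv_into {..<card S} s (s i) = i" using s True by (auto simp: bij_betw_def the_inv_into_f_f)
    have "(\<Sum>x\<in>S. of_int (n (the_inv_into {..<card S} s x)) * unit_vec m x (s i)) =
        (\<Sum>x\<in>S. if x = s i then of_int (n i) * (snd x / of_int (c m (fst x))) else 0)"
      by (rule sum.cong) (auto simp: unit_vec_def ind_base S_row[OF x] inv)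
    also have "\<dots> = of_int (n i) * (snd (s i) / of_int (c m (fst (s i))))"
      using finS x by (simp add: sum.delta')
    finally have "0 \<le> of_int (n i) * (snd (s i) / of_int (c m (fst (s i))))"
      using pos[rule_format, of "s i"] unfolding sum_b by (simp add: U_base S_row x)
    then have "0 \<le> rat_of_int (n i)"
      using mult_right_le_imp_le[of 0 _ "rat_of_int (n i)"] unit_vec_scale_pos[OF S_H[OF x], of m]
      by (metis mult_zero_left)
    then show ?thesis by simp
  next
    case False
    have "(0, 0) \<notin> S" using S_H zero_notin_H by force
    moreover have "(\<Sum>x\<in>S. of_int (n (the_inv_into {..<card S} s x)) * unit_vec m x (0, 0)) = 0"
      using ind_infinity[OF m S_H zero_notin_H] by (intro sum.neutral) (auto simp: unit_vec_def)
    ultimately have "0 \<le> rat_of_int (n (card S)) * (1 / of_nat Q)"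
      using pos[rule_format, of "(0, 0)"] m unfolding sum_b by (simp add: U_base)
    then show ?thesis using Q i False by (auto simp: zero_le_mult_iff less_Suc_eq zero_le_divide_iff)
  qed
  show ?thesis
    by (intro exI[of _ "Suc (card S)"] exI[of _ b] conjI allI impI ballI) (use b1 b2 b3 in auto)
qed

lemma function_dimension_group_D: "function_dimension_group D (\<lambda>_. 1)"
proof
  show "countable D" by (rule countable_D)
  show "\<exists>n::nat. \<forall>x. f x \<le> of_nat n * 1" if "f \<in> D" for f
    using D_bounded[OF that] by (auto simp: abs_le_iff)
qed (use const_mem_D D_add D_cmult[of _ "- 1"] simplicial_D in auto)

section \<open>Failure of infinite divisibility\<close>

lemma finite_escape:
  assumes "finite S" "S \<noteq> {}" "\<And>h. h \<in> S \<Longrightarrow> 0 < h"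
  shows "\<exists>h\<in>S. g j * h \<notin> S"
\<comment> \<open>Multiplication by \<open>g j\<close> moves the maximum of \<open>S\<close> out of
  \<open>S\<close> if \<open>g j\<close> exceeds \<open>1\<close>, and the minimum
  otherwise.\<close>
proof (cases "1 < g j")
  case True
  have M: "Max S \<in> S" using assms by simp
  then have "Max S < g j * Max S" using True assms(3) by simp
  then have "g j * Max S \<notin> S" using Max_ge[OF assms(1)] by force
  then show ?thesis using M by blast
next
  case False
  then have g: "g j < 1" using g_neq_1[of j] by simp
  have M: "Min S \<in> S" using assms by simp
  then have "g j * Min S < Min S" using g assms(3) by simp
  then have "g j * Min S \<notin> S" using Min_le[OF assms(1)] by force
  then show ?thesis using M by blast
qed

lemma infinite_H: "infinite H"
proof
  assume "finite H"
  then obtain h where "h \<in> H" "g 0 * h \<notin> H" using finite_escape[of H 0] one_H H_pos by blast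
  then show False by (simp add: g_mult_in_H_iff)
qed

text \<open>As \<open>num j\<close> is prime to \<open>den j\<close> and \<open>den j\<close> divides \<open>B j\<close>, a row that is not divisible by a prime
  passes this on to its next child row.\<close>

lemma not_infinitely_divisible:
  assumes f: "f \<in> D0 n" and nz: "f x0 \<noteq> 0" and p: "prime (p::int)"
  shows "\<exists>r::nat. \<forall>m. (\<lambda>x. f x / of_int p ^ r) \<notin> D0 m"
proof -
  note n = D0_pos[OF f] and a = D0_averaging[OF f]
  have "\<exists>i<n. \<exists>h. f (i, h) \<noteq> 0"
  proof (rule ccontr)
    assume "\<not> ?thesis"
    then have "f = (\<lambda>_. 0)" by (intro averaging_eqI[OF a averaging_const n]) auto
    then show False using nz by simp
  qed
  then obtain i h1 where i: "i < n" and h1: "f (i, h1) \<noteq> 0" by blast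
  define F where "F h = of_int (c n i) * f (i, h) / h" for h
  have F_int: "F h \<in> \<int>" for h unfolding F_def by (rule D0_int[OF f i])
  have "F h1 \<noteq> 0"
    using h1 c_pos[of n i] H_pos[OF D0_support[OF f h1]] by (simp add: F_def)
  moreover obtain z where z: "F h1 = of_int z" using F_int by (auto elim: Ints_cases)
  ultimately have "z \<noteq> 0" by simp
  have ex: "\<exists>r::nat. \<exists>h. F h / of_int p ^ r \<notin> \<int>"
  proof (intro exI)
    have p2: "2 \<le> p" using p prime_ge_2_int by blast
    have "\<bar>z\<bar> < p ^ nat \<bar>z\<bar>"
    proof -
      have "nat \<bar>z\<bar> < 2 ^ nat \<bar>z\<bar>" by (rule less_exp)
      then have "int (nat \<bar>z\<bar>) < int (2 ^ nat \<bar>z\<bar>)" by (simp only: of_nat_less_iff)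
      then have "\<bar>z\<bar> < 2 ^ nat \<bar>z\<bar>" by simp
      also have "\<dots> \<le> p ^ nat \<bar>z\<bar>" using p2 by (intro power_mono) auto
      finally show ?thesis .
    qed
    then have "\<not> p ^ nat \<bar>z\<bar> dvd z" using \<open>z \<noteq> 0\<close> dvd_imp_le_int[of z "p ^ nat \<bar>z\<bar>"] by auto
    moreover have "p ^ nat \<bar>z\<bar> dvd z" if zi: "of_int z / rat_of_int (p ^ nat \<bar>z\<bar>) \<in> \<int>"
    proof -
      obtain k where "of_int z / rat_of_int (p ^ nat \<bar>z\<bar>) = of_int k" by (rule Ints_cases[OF zi])
      then have "rat_of_int z = of_int (k * p ^ nat \<bar>z\<bar>)" using p2 by (simp add: field_simps)
      then have "z = k * p ^ nat \<bar>z\<bar>" by (simp only: of_int_eq_iff)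
      then show ?thesis by (metis dvd_triv_right)
    qed
    ultimately show "F h1 / of_int p ^ nat \<bar>z\<bar> \<notin> \<int>" by (auto simp: z)
  qed
  \<comment> \<open>Minimality of \<open>r\<close> makes row \<open>i\<close> of
    \<open>f / p ^ r\<close> non-integral but integral after one multiplication by \<open>p\<close>.
    This is the property \<open>bad\<close> that is passed on.\<close>
  define r where "r = (LEAST r. \<exists>h. F h / of_int p ^ r \<notin> \<int>)"
  have r: "\<exists>h. F h / of_int p ^ r \<notin> \<int>" unfolding r_def by (rule LeastI_ex[OF ex])
  have "r \<noteq> 0" using r F_int by (cases "r = 0") auto
  then obtain r' where r': "r = Suc r'" using not0_implies_Suc by blast
  have min: "F h / of_int p ^ r' \<in> \<int>" for h
    using not_less_Least[of r' "\<lambda>r. \<exists>h. F h / of_int p ^ r \<notin> \<int>"] r' unfolding r_def by auto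
  have p0: "rat_of_int p \<noteq> 0" using p by auto
  define f' where "f' x = f x / of_int p ^ r" for x
  have a': "averaging n f'"
    using averaging_cmult[OF a, of "1 / of_int p ^ r"] by (simp add: f'_def[abs_def])
  have f'_nz: "0 < h" if "f' (j, h) \<noteq> 0" for j h
    using that D0_support[OF f, of j h] H_pos by (auto simp: f'_def)
  define bad where "bad m j \<longleftrightarrow> (\<forall>h. of_int p * (of_int (c m j) * f' (j, h) / h) \<in> \<int>) \<and>
    (\<exists>h. of_int (c m j) * f' (j, h) / h \<notin> \<int>)" for m j
  have "\<exists>j<m. bad m j" if "n \<le> m" for m
    using that
  proof (induction m rule: dec_induct)
    case base
    have "bad n i"
      using min r p0 by (simp add: bad_def f'_def r' F_def mult_ac)
    then show ?case using i by blast
  next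
    case (step m)
    then obtain j where j: "j < m" "bad m j" by blast
    show ?case
    proof (cases "j = par m")
      case False
      then have "bad (Suc m) j" using j by (simp add: bad_def c_Suc_other)
      then show ?thesis using j(1) by (metis less_SucI)
    next
      case True
      define y where "y h = of_int (c m j) * f' (j, h) / h" for h
      have row: "of_int (c (Suc m) m) * f' (m, h) / h =
          of_int (den m) * y h + of_int (num m * (B m - 1)) * y (g m * h)" for h
        using new_row[OF averaging_mono[OF a' step.hyps(1)]] by (simp add: y_def True)
      have py: "of_int p * y h \<in> \<int>" for h
        using j(2) by (simp add: bad_def y_def)
      have nint: "\<exists>h. y h \<notin> \<int>"
        using j(2) by (simp add: bad_def y_def)
      have mult_int: "of_int t * y h \<in> \<int>" if "p dvd t" for t h
      proof -
        obtain k where "t = p * k" using \<open>p dvd t\<close> by (auto simp: dvd_def)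
        then have "of_int t * y h = of_int k * (of_int p * y h)" by simp
        also have "\<dots> \<in> \<int>" by (rule Ints_mult[OF Ints_of_int py])
        finally show ?thesis .
      qed
      have "\<exists>h. of_int (den m) * y h + of_int (num m * (B m - 1)) * y (g m * h) \<notin> \<int>"
      \<comment> \<open>If \<open>p\<close> divides \<open>den m\<close>, the first term is integral
        and the second coefficient is prime to \<open>p\<close>. Otherwise finiteness provides an
        \<open>h\<close> where \<open>y h\<close> is non-integral but \<open>y (g m * h)\<close> is
        integral.\<close>
      proof (cases "p dvd den m")
        case True
        then have "\<not> p dvd num m"
          using coprime_num_den[of m] p by (meson coprime_common_divisor not_prime_unit)
        moreover have "\<not> p dvd B m - 1"
        proof
          assume "p dvd B m - 1"
          moreover have "p dvd B m" using True den_dvd_B dvd_trans by blast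
          ultimately have "p dvd 1" using dvd_diff[of p "B m" "B m - 1"] by simp
          then show False using p not_prime_unit by blast
        qed
        ultimately have ndvd: "\<not> p dvd num m * (B m - 1)" using p prime_dvd_mult_iff by blast
        obtain h where h: "y h \<notin> \<int>" using nint by blast
        have gh: "g m * (h / g m) = h" using g_pos[of m] by simp
        have "of_int (num m * (B m - 1)) * y h \<notin> \<int>"
          by (rule prime_mult_notin_Ints[OF p py h ndvd])
        then have "of_int (den m) * y (h / g m) + of_int (num m * (B m - 1)) * y (g m * (h / g m)) \<notin> \<int>"
          unfolding gh using mult_int[OF True, of "h / g m"] by (metis Ints_diff add_diff_cancel_left')
        then show ?thesis by blast
      next
        case False
        let ?S = "{h. y h \<notin> \<int>}"
        have sub: "?S \<subseteq> {h. f' (j, h) \<noteq> 0}" by (auto simp: y_def)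
        have "finite {x. fst x < m \<and> f x \<noteq> 0}" using D0_finite[OF D0_mono[OF f step.hyps(1)]] .
        then have "finite (snd ` {x. fst x < m \<and> f x \<noteq> 0})" by (rule finite_imageI)
        moreover have "?S \<subseteq> snd ` {x. fst x < m \<and> f x \<noteq> 0}"
        proof
          fix h assume "h \<in> ?S"
          then have "(j, h) \<in> {x. fst x < m \<and> f x \<noteq> 0}" using sub j(1) by (auto simp: f'_def)
          then show "h \<in> snd ` {x. fst x < m \<and> f x \<noteq> 0}" by (metis image_eqI snd_conv)
        qed
        ultimately have "finite ?S" by (rule rev_finite_subset)
        moreover have "?S \<noteq> {}" using nint by blast
        moreover have "0 < h" if "h \<in> ?S" for h using that sub f'_nz by blast
        ultimately obtain h where h: "h \<in> ?S" "g m * h \<notin> ?S" using finite_escape by blast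
        have "of_int (den m) * y h \<notin> \<int>"
          using prime_mult_notin_Ints[OF p py _ False] h(1) by blast
        moreover have "of_int (num m * (B m - 1)) * y (g m * h) \<in> \<int>"
          using h(2) by (intro Ints_mult[OF Ints_of_int]) simp
        ultimately have "of_int (den m) * y h + of_int (num m * (B m - 1)) * y (g m * h) \<notin> \<int>"
          by (metis Ints_diff add_diff_cancel_right')
        then show ?thesis by blast
      qed
      moreover have "of_int p * (of_int (den m) * y h + of_int (num m * (B m - 1)) * y (g m * h)) \<in> \<int>" for h
        unfolding distrib_left mult.left_commute[of "rat_of_int p"]
        by (intro Ints_add Ints_mult[OF Ints_of_int py])
      ultimately have "bad (Suc m) m" unfolding bad_def row by blast
      then show ?thesis by blast
    qed
  qed
  then have *: "f' \<notin> D0 m" if "n \<le> m" for m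
    using D0_int[of f' m] that by (metis bad_def)
  have "f' \<notin> D0 m" for m
    using *[of "max n m"] D0_mono[of f' m "max n m"] by auto
  then show ?thesis unfolding f'_def by blast
qed

lemma infinitely_divisible_const:
  assumes f: "f \<in> D" and p: "prime (p::int)" and div: "\<And>r::nat. (\<lambda>x. f x / of_int p ^ r) \<in> D"
  shows "f x = f (0, 0)"
proof (rule ccontr)
  assume nz: "f x \<noteq> f (0, 0)"
  obtain n where n: "(\<lambda>x. f x - f (0, 0)) \<in> D0 n" using f D_iff by blast
  have "f x - f (0, 0) \<noteq> 0" using nz by simp
  from not_infinitely_divisible[OF n this p]
  obtain r where r: "\<And>m. (\<lambda>x. (f x - f (0, 0)) / of_int p ^ r) \<notin> D0 m" by (elim exE) (rule that, blast)
  obtain m where "(\<lambda>x. f x / of_int p ^ r - f (0, 0) / of_int p ^ r) \<in> D0 m"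
    using div[of r] D_iff[of "\<lambda>x. f x / of_int p ^ r"] by blast
  then show False using r[of m] by (simp add: diff_divide_distrib)
qed

section \<open>Arithmetic of the values of \<open>ind\<close>\<close>

lemma P_ind_int:
  assumes n: "0 < n"
  shows "j < m \<Longrightarrow> of_int (P m) * ind n x (j, h) \<in> \<int>"
proof (induction j arbitrary: h m rule: less_induct)
  case (less j)
  show ?case
  proof (cases "j < n")
    case True
    then show ?thesis by (simp add: ind_base)
  next
    case False
    then have "par j < j" using par_less[of j] n by simp
    then have int: "of_int (P j) * ind n x (par j, h') \<in> \<int>" for h' using less.IH by blast
    obtain k where k: "P m = P (Suc j) * k" using P_dvd[of "Suc j" m] less.prems by (auto simp: dvd_def)
    have B0: "rat_of_int (B j) \<noteq> 0" using B_pos[of j] by simp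
    have "of_int (P m) * ind n x (j, h) = of_int k * (of_int (P j) * ind n x (par j, h)) +
        of_int (k * (B j - 1)) * (of_int (P j) * ind n x (par j, g j * h))"
      unfolding averagingD[OF ind_averaging[OF n] leI[OF False]] k P_Suc using B0
      by (simp add: field_simps)
    also have "\<dots> \<in> \<int>" by (intro Ints_add Ints_mult[OF Ints_of_int int])
    finally show ?thesis .
  qed
qed

text \<open>The weight \<open>1 / B j\<close> is too small compared with the denominators of the parent row to create
  coincidences.\<close>

lemma ind_row_distinct:
  assumes n: "0 < n"
  shows "h \<noteq> k \<Longrightarrow> ind n x (j, h) = ind n x (j, k) \<Longrightarrow> ind n x (j, h) = 0"
proof (induction j arbitrary: h k rule: less_induct)
  case (less j)
  show ?case
  proof (cases "j < n")
    case True
    then show ?thesis using less.prems by (auto simp: ind_base split: if_splits)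
  next
    case False
    then have p: "par j < j" using par_less[of j] n by simp
    define a where "a h = ind n x (par j, h)" for h
    have bounds: "0 \<le> a h" "a h \<le> 1" for h using ind_nonneg[OF n] ind_le_1[OF n] by (auto simp: a_def)
    have row: "ind n x (j, h) = a h / of_int (B j) + (1 - 1 / of_int (B j)) * a (g j * h)" for h
      unfolding a_def by (rule averagingD[OF ind_averaging[OF n] leI[OF False]])
    define A where "A h = \<lfloor>of_int (P j) * a h\<rfloor>" for h
    have A: "of_int (P j) * a h = rat_of_int (A h)" for h
      using P_ind_int[OF n p, of x h] unfolding A_def a_def by (auto elim: Ints_cases)
    have A_bounds: "0 \<le> A h" "A h \<le> P j" for h
    proof -
      have "0 \<le> rat_of_int (A h)" using A[of h, symmetric] bounds(1)[of h] P_pos[of j] by simp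
      then show "0 \<le> A h" by simp
      have "rat_of_int (P j) * a h \<le> rat_of_int (P j) * 1"
        using bounds(2)[of h] P_pos[of j] by (intro mult_left_mono) auto
      then show "A h \<le> P j" using A[of h] by simp
    qed
    have B0: "rat_of_int (B j) \<noteq> 0" using B_pos[of j] by simp
    have scaled: "of_int (P j * B j) * ind n x (j, h) = rat_of_int (A h + (B j - 1) * A (g j * h))" for h
      unfolding row using B0 by (simp add: A[symmetric] field_simps)
    then have "A h + (B j - 1) * A (g j * h) = A k + (B j - 1) * A (g j * k)"
      using less.prems(2) by (metis of_int_eq_iff)
    then have eq: "A h - A k = (B j - 1) * (A (g j * k) - A (g j * h))" by (simp add: algebra_simps)
    \<comment> \<open>Numerators between \<open>0\<close> and \<open>P j\<close> differ by at most
      \<open>P j\<close>, less than any nonzero multiple of \<open>B j - 1\<close> in absolute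
      value.\<close>
    have A1: "A (g j * k) = A (g j * h)"
    proof (rule ccontr)
      assume "A (g j * k) \<noteq> A (g j * h)"
      then have "1 \<le> \<bar>A (g j * k) - A (g j * h)\<bar>" by simp
      then have "\<bar>B j - 1\<bar> * 1 \<le> \<bar>B j - 1\<bar> * \<bar>A (g j * k) - A (g j * h)\<bar>" by (intro mult_left_mono) auto
      also have "\<dots> = \<bar>A h - A k\<bar>" unfolding eq abs_mult ..
      also have "\<dots> \<le> P j" using A_bounds[of h] A_bounds[of k] by linarith
      finally have "B j - 1 \<le> P j" by (simp add: abs_le_iff)
      then show False using B_ge_P[of j] P_pos[of j] by linarith
    qed
    then have A2: "A h = A k" using eq by simp
    have inj: "a h = a k" if "A h = A k" for h k
    proof -
      have "rat_of_int (P j) * a h = of_int (P j) * a k" using A that by simp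
      then show ?thesis using P_pos[of j] by simp
    qed
    have "a h = a k" "a (g j * h) = a (g j * k)" using inj[OF A2] inj[OF A1] by simp_all
    moreover have "g j * h \<noteq> g j * k" using less.prems(1) g_pos[of j] by simp
    ultimately have "a h = 0" "a (g j * h) = 0"
      using less.IH[OF p] less.prems(1) unfolding a_def by blast+
    then show ?thesis by (simp add: row)
  qed
qed

text \<open>A proper average of values at most \<open>1\<close> is \<open>1\<close> only if both are
  \<open>1\<close>; then two distinct points of the parent row would share a nonzero value, against
  \<open>ind_row_distinct\<close>.\<close>

lemma ind_eq_1:
  assumes n: "0 < n" and x: "snd x \<in> H" and 1: "ind n x (j, h) = 1"
  shows "(j, h) = x"
proof (cases "j < n")
  case True
  then show ?thesis using 1 by (auto simp: ind_base split: if_splits)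
next
  case False
  define a b where "a = ind n x (par j, h)" and "b = ind n x (par j, g j * h)"
  have eq: "1 = a / of_int (B j) + (1 - 1 / of_int (B j)) * b"
    using averagingD[OF ind_averaging[OF n, of x] leI[OF False], of h] 1 by (simp add: a_def b_def)
  have ab: "a \<le> 1" "b \<le> 1" using ind_le_1[OF n] by (auto simp: a_def b_def)
  define w where "w = 1 / rat_of_int (B j)"
  have w: "0 < w" "w < 1" unfolding w_def by (rule weight_bounds)+
  have "1 = w * a + (1 - w) * b" using eq by (simp add: w_def)
  then have "w * (1 - a) + (1 - w) * (1 - b) = 0" by (simp add: algebra_simps)
  moreover have "0 \<le> w * (1 - a)" "0 \<le> (1 - w) * (1 - b)" using ab w by simp_all
  ultimately have "w * (1 - a) = 0" "(1 - w) * (1 - b) = 0" by linarith+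
  then have "a = 1" "b = 1" using w by auto
  moreover have "h \<in> H" using ind_infinity[OF n x, of h j] 1 by auto
  then have "h \<noteq> g j * h" using H_pos[of h] g_neq_1[of j] by auto
  ultimately have False
    using ind_row_distinct[OF n, of h "g j * h" x "par j"] by (auto simp: a_def b_def)
  then show ?thesis ..
qed

section \<open>The scaling automorphisms\<close>

definition scale :: "rat \<Rightarrow> (nat \<times> rat \<Rightarrow> rat) \<Rightarrow> nat \<times> rat \<Rightarrow> rat" where
  "scale k f = (\<lambda>(i, h). k * f (i, h / k))"

lemma scale_apply: "scale k f (i, h) = k * f (i, h / k)"
  by (simp add: scale_def)

text \<open>\<open>scale k f (i, h) / h\<close> equals \<open>f (i, h / k) / (h / k)\<close>: the
  outer factor \<open>k\<close> is what makes the translation respect integrality.\<close>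

lemma scale_D0:
  assumes f: "f \<in> D0 n" and k: "k \<in> H" shows "scale k f \<in> D0 n"
proof -
  have k0: "0 < k" using H_pos k by blast
  have "averaging n (scale k f)"
    unfolding averaging_def scale_apply
  proof (intro allI impI)
    fix j h assume "n \<le> j"
    then have *: "f (j, h / k) = f (par j, h / k) / of_int (B j) + (1 - 1 / of_int (B j)) * f (par j, g j * h / k)"
      using averagingD[OF D0_averaging[OF f], of j "h / k"] by simp
    show "k * f (j, h / k) = k * f (par j, h / k) / of_int (B j) +
        (1 - 1 / of_int (B j)) * (k * f (par j, g j * h / k))"
      unfolding * by (simp add: algebra_simps)
  qed
  moreover have "finite {x. fst x < n \<and> scale k f x \<noteq> 0}"
  proof (rule finite_subset)
    show "{x. fst x < n \<and> scale k f x \<noteq> 0} \<subseteq> (\<lambda>(i, h). (i, k * h)) ` {x. fst x < n \<and> f x \<noteq> 0}"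
    proof
      fix x assume x: "x \<in> {x. fst x < n \<and> scale k f x \<noteq> 0}"
      obtain i h where ih: "x = (i, h)" by (cases x)
      then have "(i, h / k) \<in> {x. fst x < n \<and> f x \<noteq> 0}" using x by (simp add: scale_apply)
      moreover have "x = (\<lambda>(i, h). (i, k * h)) (i, h / k)" using k0 by (simp add: ih)
      ultimately show "x \<in> (\<lambda>(i, h). (i, k * h)) ` {x. fst x < n \<and> f x \<noteq> 0}" by blast
    qed
  qed (simp add: D0_finite[OF f])
  moreover have "h \<in> H" if "scale k f (i, h) \<noteq> 0" for i h
  proof -
    have "h / k \<in> H" using that D0_support[OF f, of i "h / k"] by (simp add: scale_apply)
    then have "h / k * k \<in> H" using k by (rule mult_H)
    then show ?thesis using k0 by simp
  qed
  moreover have "of_int (c n i) * scale k f (i, h) / h \<in> \<int>" if "i < n" for i h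
    using D0_int[OF f that, of "h / k"] by (simp add: scale_apply mult_ac)
  ultimately show ?thesis using D0_pos[OF f] by (auto simp: D0_def)
qed

lemma scale_D:
  assumes "f \<in> D" and k: "k \<in> H" shows "scale k f \<in> D"
proof -
  obtain q f0 n where f: "f = (\<lambda>x. q + f0 x)" and f0: "f0 \<in> D0 n" using assms(1) by (auto simp: D_def)
  have "scale k f = (\<lambda>x. k * q + scale k f0 x)"
    by (auto simp: f scale_def fun_eq_iff algebra_simps)
  then show ?thesis using D_I[OF scale_D0[OF f0 k]] by simp
qed

lemma scale_scale: "scale k (scale l f) = scale (k * l) f"
  by (auto simp: scale_def fun_eq_iff mult_ac)

lemma scale_1: "scale 1 f = f"
  by (auto simp: scale_def)

lemma scale_bij: "k \<in> H \<Longrightarrow> bij_betw (scale k) D D"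
proof (rule bij_betw_byWitness[of _ "scale (inverse k)"])
  assume k: "k \<in> H"
  then have "0 < k" by (rule H_pos)
  then show "\<forall>f\<in>D. scale (inverse k) (scale k f) = f" "\<forall>f\<in>D. scale k (scale (inverse k) f) = f"
    by (simp_all add: scale_scale scale_1)
  show "scale k ` D \<subseteq> D" "scale (inverse k) ` D \<subseteq> D"
    using scale_D k inverse_H by auto
qed

lemma scale_mono:
  assumes "k \<in> H" shows "(\<forall>x. f x \<le> f' x) \<longleftrightarrow> (\<forall>x. scale k f x \<le> scale k f' x)"
proof -
  have k: "0 < k" using H_pos assms by blast
  have "f (i, h) \<le> f' (i, h)" if "\<forall>i h. f (i, h / k) \<le> f' (i, h / k)" for i h
    using that[rule_format, of i "h * k"] k by simp
  then show ?thesis using k by (auto simp: scale_def split_paired_All)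
qed

text \<open>At a stage where \<open>ind m x\<close> lies in \<open>D\<close>, a multiple of
  \<open>1 - ind m x\<close> vanishes at \<open>x\<close> and dominates the bounded difference
  elsewhere. Thus evaluation at \<open>x\<close> has the last property of a pure state.\<close>

lemma extreme_element:
  assumes f: "f \<in> D" and x: "snd x \<in> H"
  shows "\<exists>e\<in>D. (\<forall>y. 0 \<le> e y) \<and> e x = 0 \<and> (\<forall>y. \<bar>f y - f x\<bar> \<le> e y)"
proof -
  obtain n where n: "(\<lambda>y. f y - f (0, 0)) \<in> D0 n" using f D_iff by blast
  obtain m0 where m0: "\<And>m. m \<ge> m0 \<Longrightarrow> fst x < m \<and> ind m x \<in> D0 m"
    using eventually_ind_mem_D[OF x] by blast
  define m where "m = max n m0"
  have m: "fst x < m" "ind m x \<in> D0 m" using m0[of m] by (auto simp: m_def)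
  then have m_pos: "0 < m" by simp
  have af: "averaging m f" using averaging_mono[OF D_averaging[OF n]] by (simp add: m_def)
  obtain N :: nat where N: "\<forall>y. \<bar>f y - f x\<bar> \<le> of_nat N"
    using D_bounded[OF D_diff[OF f const_mem_D[of "f x"]]] by blast
  define e where "e y = of_int (int N) * (1 - ind m x y)" for y
  have e: "e \<in> D" unfolding e_def[abs_def]
    by (intro D_cmult D_diff const_mem_D D0_subset_D[OF m(2)])
  have ae: "averaging m e" unfolding e_def[abs_def]
    by (intro averaging_cmult averaging_diff averaging_const ind_averaging m_pos)
  have base: "\<bar>f (i, h) - f x\<bar> \<le> e (i, h)" if "i < m" for i h
    using N that by (auto simp: e_def ind_base)
  have "f y - f x \<le> e y" for y
    by (rule averaging_le[OF averaging_diff[OF af averaging_const] ae m_pos])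
      (use base in \<open>simp add: abs_le_iff\<close>)
  moreover have "f x - f y \<le> e y" for y
    by (rule averaging_le[OF averaging_diff[OF averaging_const af] ae m_pos])
      (use base in \<open>simp add: abs_le_iff\<close>)
  moreover have "0 \<le> e y" for y using ind_le_1[OF m_pos] by (simp add: e_def)
  moreover have "e x = 0" using m(1) by (simp add: e_def ind_base)
  ultimately show ?thesis using e by (intro bexI[of _ e]) (auto simp: abs_le_iff)
qed

lemma ind_stage_le:
  assumes "0 < m" "fst z < m" shows "ind (Suc m) z y \<le> ind m z y"
proof (rule averaging_le[of "Suc m"])
  show "averaging (Suc m) (ind m z)" using averaging_mono[OF ind_averaging[OF assms(1)]] by simp
  show "ind (Suc m) z (i, h) \<le> ind m z (i, h)" if "i < Suc m" for i h
    using that assms ind_nonneg[OF assms(1)] by (cases "i = m") (auto simp: ind_base)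
qed (simp_all add: ind_averaging)

text \<open>Up to row \<open>m\<close> the left function lives only at \<open>(m, h)\<close>, where
  the indicator of each parent point has at least the corresponding weight.\<close>

lemma ind_new_row_le:
  assumes m: "0 < m"
  shows "1 / of_int (B m) * ind (Suc m) (m, h) y \<le> ind m (par m, h) y"
    and "(1 - 1 / of_int (B m)) * ind (Suc m) (m, h) y \<le> ind m (par m, g m * h) y"
proof -
  note w = weight_bounds[of m]
  have le: "q * ind (Suc m) (m, h) y \<le> ind m (par m, k) y"
    if "q \<le> ind m (par m, k) (m, h)" for q k
  proof (rule averaging_le[of "Suc m"])
    show "averaging (Suc m) (ind m (par m, k))" using averaging_mono[OF ind_averaging[OF m]] by simp
    show "q * ind (Suc m) (m, h) (i, h') \<le> ind m (par m, k) (i, h')" if "i < Suc m" for i h'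
      using that \<open>q \<le> ind m (par m, k) (m, h)\<close> ind_nonneg[OF m] by (auto simp: ind_base)
  qed (simp_all add: averaging_cmult ind_averaging)
  have row: "ind m (par m, k) (m, h) = ind m (par m, k) (par m, h) / of_int (B m) +
      (1 - 1 / of_int (B m)) * ind m (par m, k) (par m, g m * h)" for k
    by (rule averagingD[OF ind_averaging[OF m] order_refl])
  show "1 / of_int (B m) * ind (Suc m) (m, h) y \<le> ind m (par m, h) y"
    by (rule le) (use row[of h] w par_less[OF m] in \<open>auto simp: ind_base\<close>)
  show "(1 - 1 / of_int (B m)) * ind (Suc m) (m, h) y \<le> ind m (par m, g m * h) y"
    by (rule le) (use row[of "g m * h"] w par_less[OF m] in \<open>auto simp: ind_base\<close>)
qed

end

text \<open>The last assumption holds for the evaluations at points and is invariant under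
  automorphisms; it singles out the evaluations among all states.\<close>

locale pure_state = averaging_tower +
  fixes s :: "(nat \<times> rat \<Rightarrow> rat) \<Rightarrow> rat"
  assumes s_add: "f \<in> D \<Longrightarrow> f' \<in> D \<Longrightarrow> s (\<lambda>y. f y + f' y) = s f + s f'"
    and s_nonneg: "f \<in> D \<Longrightarrow> (\<And>y. 0 \<le> f y) \<Longrightarrow> 0 \<le> s f"
    and s_const: "s (\<lambda>_. q) = q"
    and s_extreme: "f \<in> D \<Longrightarrow> \<exists>e\<in>D. (\<forall>y. 0 \<le> e y) \<and> s e = 0 \<and> (\<forall>y. \<bar>f y - s f\<bar> \<le> e y)"
begin

section \<open>Pure states are evaluations\<close>

lemma s_diff: assumes "f \<in> D" "f' \<in> D" shows "s (\<lambda>y. f y - f' y) = s f - s f'"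
  using s_add[OF D_diff[OF assms] assms(2)] by simp

lemma s_mono: "f \<in> D \<Longrightarrow> f' \<in> D \<Longrightarrow> (\<And>y. f y \<le> f' y) \<Longrightarrow> s f \<le> s f'"
  using s_nonneg[OF D_diff[of f' f]] s_diff[of f' f] by simp

lemma s_nat: "f \<in> D \<Longrightarrow> s (\<lambda>y. of_nat k * f y) = of_nat k * s f"
proof (induction k)
  case 0
  then show ?case using s_const[of 0] by simp
next
  case (Suc k)
  then show ?case
    using s_add[of f "\<lambda>y. of_nat k * f y"] D_cmult[of f "int k"] by (simp add: algebra_simps)
qed

lemma s_int: assumes f: "f \<in> D" shows "s (\<lambda>y. of_int k * f y) = of_int k * s f"
proof (cases "0 \<le> k")
  case True
  then show ?thesis using s_nat[OF f, of "nat k"] by simp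
next
  case False
  define N where "N = nat (- k)"
  have N: "rat_of_int k = - of_nat N" using False by (simp add: N_def)
  have "(\<lambda>y. of_nat N * f y) \<in> D" using D_cmult[OF f, of "int N"] by simp
  then show ?thesis
    using s_diff[OF const_mem_D[of 0]] s_const[of 0] s_nat[OF f, of N] by (simp add: N)
qed

lemma s_sum: "(\<And>x. x \<in> S \<Longrightarrow> F x \<in> D) \<Longrightarrow> s (\<lambda>y. \<Sum>x\<in>S. F x y) = (\<Sum>x\<in>S. s (F x)) \<and> (\<lambda>y. \<Sum>x\<in>S. F x y) \<in> D"
proof (induction S rule: infinite_finite_induct)
  case (insert x S)
  then show ?case using s_add[of "F x" "\<lambda>y. \<Sum>x\<in>S. F x y"] by (simp add: D_add)
qed (use s_const[of 0] const_mem_D[of 0] in auto)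

text \<open>As \<open>D\<close> is only a group, the rational \<open>q\<close> is replaced by a
  natural number \<open>N \<ge> 1 / q\<close>.\<close>

lemma s_pos_mono:
  assumes "f \<in> D" "f' \<in> D" "0 < q" "\<And>y. q * f y \<le> f' y" "\<And>y. 0 \<le> f' y" "0 < s f"
  shows "0 < s f'"
proof -
  obtain N :: nat where N: "1 / q \<le> of_nat N" using real_arch_simple by blast
  have "f y \<le> of_nat N * f' y" for y
  proof -
    have "f y \<le> 1 / q * f' y" using assms(3) assms(4)[of y] by (simp add: field_simps)
    also have "\<dots> \<le> of_nat N * f' y" using N assms(5) by (intro mult_right_mono) auto
    finally show ?thesis .
  qed
  then have "s f \<le> s (\<lambda>y. of_nat N * f' y)"
    using D_cmult[OF assms(2), of "int N"] by (intro s_mono assms) auto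
  then have "0 < of_nat N * s f'" using assms(6) s_nat[OF assms(2)] by simp
  then show ?thesis by (simp add: zero_less_mult_iff)
qed

text \<open>The points given positive mass at stage \<open>m\<close>. For evaluation at a point over
  \<open>H\<close> below row \<open>m\<close> it is that point alone; for the value at infinity it
  is empty.\<close>

definition supp :: "nat \<Rightarrow> (nat \<times> rat) set" where
  "supp m = {z. fst z < m \<and> snd z \<in> H \<and> 0 < s (unit_vec m z)}"

lemma unit_vec_D: "fst z < m \<Longrightarrow> snd z \<in> H \<Longrightarrow> unit_vec m z \<in> D"
  using unit_vec_mem D0_subset_D by blast

lemma unit_vec_nonneg: "0 < m \<Longrightarrow> snd z \<in> H \<Longrightarrow> 0 \<le> unit_vec m z y"
  unfolding unit_vec_def by (rule mult_nonneg_nonneg[OF less_imp_le[OF unit_vec_scale_pos] ind_nonneg])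

lemma supp_dominated:
  assumes z: "z \<in> supp m" and z': "fst z' < m'" "snd z' \<in> H" and q: "0 < q"
    and le: "\<And>y. q * ind m z y \<le> ind m' z' y"
  shows "z' \<in> supp m'"
proof -
  have m: "fst z < m" "snd z \<in> H" "0 < s (unit_vec m z)" using z by (auto simp: supp_def)
  define a where "a = snd z / of_int (c m (fst z))"
  define b where "b = snd z' / of_int (c m' (fst z'))"
  have ab: "0 < a" "0 < b" unfolding a_def b_def using unit_vec_scale_pos m(2) z'(2) by auto
  have "0 < s (unit_vec m' z')"
  proof (rule s_pos_mono[OF unit_vec_D[OF m(1,2)] unit_vec_D[OF z'] _ _ _ m(3)])
    show "0 < b * q / a" using ab q by simp
    show "b * q / a * unit_vec m z y \<le> unit_vec m' z' y" for y
      using mult_left_mono[OF le[of y], of b] ab unfolding unit_vec_def a_def[symmetric] b_def[symmetric]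
      by simp
    show "0 \<le> unit_vec m' z' y" for y
      using unit_vec_nonneg[of m' z' y] z' by simp
  qed
  then show ?thesis using z' by (simp add: supp_def)
qed

text \<open>Positive multiples of the later indicator are dominated by earlier ones, so mass at
  stage \<open>Suc m\<close> forces mass at stage \<open>m\<close>: at the point itself if it is
  old, at both parent points if it is new.\<close>

lemma supp_Suc:
  assumes m: "0 < m" and z: "z \<in> supp (Suc m)"
  shows "fst z < m \<Longrightarrow> z \<in> supp m"
    and "fst z = m \<Longrightarrow> (par m, snd z) \<in> supp m \<and> (par m, g m * snd z) \<in> supp m"
proof -
  have zH: "snd z \<in> H" using z by (simp add: supp_def)
  show "z \<in> supp m" if "fst z < m"
    by (rule supp_dominated[OF z that zH, of 1]) (use ind_stage_le[OF m that] in simp_all)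
  assume "fst z = m"
  then have z': "z = (m, snd z)" by (cases z) simp
  have p: "par m < m" using par_less m by simp
  have "(m, snd z) \<in> supp (Suc m)" using z z' by simp
  note dom = supp_dominated[OF this]
  show "(par m, snd z) \<in> supp m \<and> (par m, g m * snd z) \<in> supp m"
  proof
    show "(par m, snd z) \<in> supp m"
      by (rule dom[where q = "1 / of_int (B m)"])
        (use p zH weight_bounds[of m] ind_new_row_le(1)[OF m] in simp_all)
    show "(par m, g m * snd z) \<in> supp m"
      by (rule dom[where q = "1 - 1 / of_int (B m)"])
        (use p zH weight_bounds[of m] ind_new_row_le(2)[OF m] in \<open>simp_all add: g_mult_in_H_iff\<close>)
  qed
qed

lemma supp_empty_mono:
  assumes "0 < m" "supp m = {}" "m \<le> m'" shows "supp m' = {}"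
  using assms(3)
proof (induction m' rule: dec_induct)
  case (step m')
  have "z \<notin> supp (Suc m')" for z
  proof
    assume z: "z \<in> supp (Suc m')"
    then have "fst z < m' \<or> fst z = m'" by (auto simp: supp_def)
    then show False using supp_Suc[OF _ z] step assms(1) by auto
  qed
  then show ?case by blast
qed (fact assms(2))

text \<open>If the dominating \<open>e\<close> with \<open>s e = 0\<close> were positive at a
  support point \<open>z\<close>, it would exceed a positive multiple of
  \<open>unit_vec m z\<close>, whence \<open>0 < s e\<close>. So \<open>e\<close> vanishes at
  \<open>z\<close> and forces \<open>f z = s f\<close>.\<close>

lemma supp_value:
  assumes f: "f \<in> D"
  shows "\<exists>m0. \<forall>m\<ge>m0. \<forall>z\<in>supp m. f z = s f"
proof -
  obtain e where e: "e \<in> D" "\<And>y. 0 \<le> e y" "s e = 0" "\<And>y. \<bar>f y - s f\<bar> \<le> e y"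
    using s_extreme[OF f] by blast
  obtain n where n: "(\<lambda>y. e y - e (0, 0)) \<in> D0 n" using e(1) D_iff by blast
  have "f z = s f" if m: "n \<le> m" and z: "z \<in> supp m" for m z
  proof -
    have zm: "fst z < m" "snd z \<in> H" "0 < s (unit_vec m z)" using z by (auto simp: supp_def)
    then have m_pos: "0 < m" by simp
    have "e z = 0"
    proof (rule ccontr)
      assume "e z \<noteq> 0"
      then have ez: "0 < e z" using e(2)[of z] by simp
      define a where "a = snd z / of_int (c m (fst z))"
      have a: "0 < a" unfolding a_def by (rule unit_vec_scale_pos[OF zm(2)])
      have "e z * ind m z y \<le> e y" for y
      proof (rule averaging_le[OF averaging_cmult[OF ind_averaging[OF m_pos]] _ m_pos])
        show "averaging m e" using averaging_mono[OF D_averaging[OF n] m] .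
        show "e z * ind m z (i, h) \<le> e (i, h)" if "i < m" for i h
          using that e(2) by (auto simp: ind_base)
      qed
      then have le: "e z / a * unit_vec m z y \<le> e y" for y
        using a by (simp add: unit_vec_def a_def[symmetric])
      then have "0 < s e"
        using ez a by (intro s_pos_mono[OF unit_vec_D[OF zm(1,2)] e(1) _ le e(2) zm(3)]) simp
      then show False using e(3) by simp
    qed
    then show ?thesis using e(4)[of z] by simp
  qed
  then show ?thesis by blast
qed

theorem evaluation: "\<exists>y. (snd y \<in> H \<or> y = (0, 0)) \<and> (\<forall>f\<in>D. s f = f y)"
proof (cases "\<exists>m>0. supp m = {}")
  case True
  then obtain m where m: "0 < m" "supp m = {}" by blast
  \<comment> \<open>Empty support stays empty, so \<open>s\<close> kills the generators of all late
    stages and only the value at infinity remains.\<close>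
  have "s f = f (0, 0)" if f: "f \<in> D" for f
  proof -
    define f0 where "f0 y = f y - f (0, 0)" for y
    obtain n' where n': "f0 \<in> D0 n'" using f D_iff unfolding f0_def[abs_def] by blast
    define n where "n = max m n'"
    have n: "f0 \<in> D0 n" "supp n = {}" "0 < n"
      using D0_mono[OF n'] supp_empty_mono[OF m] m(1) by (auto simp: n_def)
    let ?S = "{x. fst x < n \<and> f0 x \<noteq> 0}"
    have S: "fst x < n" "snd x \<in> H" if "x \<in> ?S" for x
      using that D0_support[OF n(1), of "fst x" "snd x"] by auto
    have exp: "f0 = (\<lambda>y. \<Sum>x\<in>?S. f0 x * ind n x y)"
      by (rule averaging_expand[OF D0_averaging[OF n(1)] n(3) D0_finite[OF n(1)]]) auto
    have "s (\<lambda>y. f0 x * ind n x y) = 0 \<and> (\<lambda>y. f0 x * ind n x y) \<in> D" if x: "x \<in> ?S" for x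
    proof -
      obtain k where k: "of_int (c n (fst x)) * f0 (fst x, snd x) / snd x = of_int k"
        using D0_int[OF n(1) S(1)[OF x]] Ints_cases by blast
      have "0 < snd x" using H_pos S(2)[OF x] by blast
      then have "f0 x = of_int k * (snd x / of_int (c n (fst x)))"
        using k[symmetric] c_pos[of n "fst x"] by (simp add: field_simps)
      then have eq: "(\<lambda>y. f0 x * ind n x y) = (\<lambda>y. of_int k * unit_vec n x y)"
        by (simp add: unit_vec_def fun_eq_iff)
      have uD: "unit_vec n x \<in> D" using unit_vec_D S[OF x] by blast
      have "0 \<le> s (unit_vec n x)" using S[OF x] n(3) unit_vec_nonneg by (intro s_nonneg uD) auto
      moreover have "\<not> 0 < s (unit_vec n x)" using n(2) S[OF x] unfolding supp_def by blast
      ultimately have "s (unit_vec n x) = 0" by simp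
      then show ?thesis unfolding eq using s_int[OF uD] D_cmult[OF uD] by simp
    qed
    then have "s (\<lambda>y. \<Sum>x\<in>?S. f0 x * ind n x y) = 0" using s_sum[of ?S "\<lambda>x y. f0 x * ind n x y"] by simp
    then have "s f0 = 0" using exp by simp
    then show ?thesis
      using s_diff[OF f const_mem_D[of "f (0, 0)"]] s_const[of "f (0, 0)"] by (simp add: f0_def[abs_def])
  qed
  then show ?thesis by blast
next
  case False
  then have ne: "supp m \<noteq> {}" if "0 < m" for m using that by blast
  obtain z1 where z1: "z1 \<in> supp 1" using ne[of 1] by auto
  define f1 where "f1 = unit_vec 1 z1"
  have f1: "f1 \<in> D" "0 < s f1" using z1 unit_vec_D by (auto simp: f1_def supp_def)
  obtain m1 where m1: "\<forall>m\<ge>m1. \<forall>z\<in>supp m. f1 z = s f1" using supp_value[OF f1(1)] by blast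
  define m0 where "m0 = Suc m1"
  \<comment> \<open>A new support point in row \<open>m\<close> would give its two parent points the
    common value \<open>s f1 > 0\<close> of \<open>f1\<close>, whereas distinct points of a row
    never share a nonzero value.\<close>
  have down: "z \<in> supp m" if m: "m0 \<le> m" and z: "z \<in> supp (Suc m)" for m z
  proof (rule ccontr)
    assume nz: "z \<notin> supp m"
    have m_pos: "0 < m" using m by (simp add: m0_def)
    have "fst z = m" using supp_Suc(1)[OF m_pos z] nz z by (auto simp: supp_def)
    then have "(par m, snd z) \<in> supp m" "(par m, g m * snd z) \<in> supp m"
      using supp_Suc(2)[OF m_pos z] by auto
    then have eq: "f1 (par m, snd z) = s f1" "f1 (par m, g m * snd z) = s f1"
      using m1[rule_format, of m] m by (simp_all add: m0_def)
    have "snd z1 \<in> H" using z1 by (simp add: supp_def)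
    then have a: "snd z1 / rat_of_int (c 1 (fst z1)) \<noteq> 0" using unit_vec_scale_pos[of z1 1] by linarith
    have "ind 1 z1 (par m, snd z) = ind 1 z1 (par m, g m * snd z)"
      using trans[OF eq(1) eq(2)[symmetric], unfolded f1_def unit_vec_def] mult_left_cancel[OF a] by blast
    moreover have "snd z \<noteq> g m * snd z"
      using z H_pos[of "snd z"] g_neq_1[of m] by (auto simp: supp_def)
    ultimately have "ind 1 z1 (par m, snd z) = 0" using ind_row_distinct[OF zero_less_one] by blast
    then show False using eq(1) f1(2) by (simp add: f1_def unit_vec_def)
  qed
  have sub: "supp m \<subseteq> supp m0" if "m0 \<le> m" for m
    using that by (induction m rule: dec_induct) (use down in auto)
  obtain z where z: "z \<in> supp m0" using ne[of m0] by (auto simp: m0_def)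
  \<comment> \<open>Late supports lie below row \<open>m0\<close>, where \<open>f2\<close> is
    nonzero only at \<open>z\<close>; as \<open>f2\<close> equals \<open>s f2 > 0\<close> on them,
    they shrink to \<open>{z}\<close>.\<close>
  define f2 where "f2 = unit_vec m0 z"
  have f2: "f2 \<in> D" "0 < s f2" using z unit_vec_D by (auto simp: f2_def supp_def)
  obtain m2 where m2: "\<forall>m\<ge>m2. \<forall>z\<in>supp m. f2 z = s f2" using supp_value[OF f2(1)] by blast
  have single: "supp m = {z}" if "m0 \<le> m" "m2 \<le> m" for m
  proof -
    have "z' = z" if z': "z' \<in> supp m" for z'
    proof (rule ccontr)
      assume "z' \<noteq> z"
      moreover have "fst z' < m0" using sub[OF \<open>m0 \<le> m\<close>] z' by (auto simp: supp_def)
      ultimately have "f2 z' = 0" by (simp add: f2_def unit_vec_def ind_base)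
      then show False using m2[rule_format, OF \<open>m2 \<le> m\<close> z'] f2(2) by simp
    qed
    moreover have "supp m \<noteq> {}" using ne[of m] \<open>m0 \<le> m\<close> by (simp add: m0_def)
    ultimately show ?thesis by blast
  qed
  have "s f = f z" if f: "f \<in> D" for f
  proof -
    obtain m3 where m3: "\<forall>m\<ge>m3. \<forall>z\<in>supp m. f z = s f" using supp_value[OF f] by blast
    have "supp (max m3 (max m0 m2)) = {z}" by (rule single) auto
    then show ?thesis using m3[rule_format, of "max m3 (max m0 m2)" z] by simp
  qed
  moreover have "snd z \<in> H" using z by (simp add: supp_def)
  ultimately show ?thesis by blast
qed

end

section \<open>Recognising a child row by its weights\<close>

context averaging_tower
begin

text \<open>For \<open>w\<close> in row \<open>j'\<close>, clearing denominators in
  \<open>ind n x w = 1 / B j\<close> gives an integer equation. The growth of \<open>B\<close>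
  forces \<open>j' = j\<close>, and then the values \<open>1\<close> and \<open>0\<close> of
  \<open>ind n x\<close> at the two parent points.\<close>

lemma child_identify:
  assumes n: "0 < n" and x: "fst x < n" "snd x \<in> H" and y: "fst y < n" "snd y \<in> H" "x \<noteq> y"
    and j: "n \<le> j" and w: "snd w \<in> H"
    and ix: "ind n x w = 1 / of_int (B j)" and iy: "ind n y w = 1 - 1 / of_int (B j)"
  shows "w = (j, snd w) \<and> x = (par j, snd w) \<and> y = (par j, g j * snd w)"
proof -
  define j' where "j' = fst w"
  define h where "h = snd w"
  have w_eq: "w = (j', h)" by (simp add: j'_def h_def)
  have Bj: "4 \<le> B j" by (rule B_ge_4)
  have val: "0 < ind n x w" "ind n x w < 1" unfolding ix by (rule weight_bounds)+
  have j'n: "n \<le> j'"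
  proof (rule ccontr)
    assume "\<not> n \<le> j'"
    then have "ind n x w \<in> {0, 1}" by (auto simp: w_eq ind_base)
    then show False using val by auto
  qed
  then have p: "par j' < j'" using par_less[of j'] n by simp
  define a where "a = (par j', h)"
  define b where "b = (par j', g j' * h)"
  have bH: "snd a \<in> H" "snd b \<in> H" using w by (auto simp: a_def b_def h_def g_mult_in_H_iff)
  have hne: "h \<noteq> g j' * h" using w H_pos[of h] g_neq_1[of j'] by (auto simp: h_def)
  have row: "ind n t w = ind n t a / of_int (B j') + (1 - 1 / of_int (B j')) * ind n t b" for t
    unfolding w_eq a_def b_def by (rule averagingD[OF ind_averaging[OF n] j'n])
  obtain u where u: "of_int (P j') * ind n x a = rat_of_int u"
    using P_ind_int[OF n p, of x h] Ints_cases unfolding a_def by blast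
  obtain v where v: "of_int (P j') * ind n x b = rat_of_int v"
    using P_ind_int[OF n p, of x "g j' * h"] Ints_cases unfolding b_def by blast
  have bounds: "0 \<le> z \<and> z \<le> P j'" if "of_int (P j') * ind n x t = rat_of_int z" for z t
  proof -
    have P: "0 < rat_of_int (P j')" using P_pos[of j'] by simp
    have "0 \<le> of_int (P j') * ind n x t" "of_int (P j') * ind n x t \<le> of_int (P j') * 1"
      using P ind_nonneg[OF n] ind_le_1[OF n] by (auto simp del: mult_1_right)
    then show ?thesis unfolding that by simp
  qed
  have ub: "0 \<le> u" "u \<le> P j'" and vb: "0 \<le> v" "v \<le> P j'" using bounds[OF u] bounds[OF v] by auto
  have B': "rat_of_int (B j') \<noteq> 0" "rat_of_int (B j) \<noteq> 0" using B_pos by (auto simp: less_imp_neq[symmetric])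
  have "rat_of_int ((u + (B j' - 1) * v) * B j) = of_int (P j' * B j' * B j) * ind n x w"
    unfolding row using B' by (simp add: u[symmetric] v[symmetric] field_simps)
  also have "\<dots> = of_int (P j' * B j')" unfolding ix using B' by simp
  finally have eq: "(u + (B j' - 1) * v) * B j = P j' * B j'" by (simp only: of_int_eq_iff)
  have "j' = j"
  proof (rule linorder_cases[of j' j])
    \<comment> \<open>Values in row \<open>j'\<close> have denominator dividing
      \<open>P j' * B j'\<close>, which is less than \<open>B j\<close>; a value as small as
      \<open>1 / B j\<close> cannot occur.\<close>
    assume "j' < j"
    then have "P (Suc j') \<le> P j" by (intro P_mono) simp
    then have lt: "P j' * B j' < B j" using B_ge_P[of j] P_pos[of j] by (simp add: P_Suc del: P.simps)
    have "0 < P j' * B j'" using P_pos B_pos by simp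
    then have "0 < u + (B j' - 1) * v" using eq B_pos[of j] by (metis zero_less_mult_pos2)
    then have "1 * B j \<le> (u + (B j' - 1) * v) * B j" using B_pos[of j] by (intro mult_right_mono) auto
    then show ?thesis using eq lt by simp
  next
    assume "j < j'"
    then have "P (Suc j) \<le> P j'" by (intro P_mono) simp
    moreover have "1 * B j \<le> P j * B j" using P_pos[of j] B_pos[of j] by (intro mult_right_mono) auto
    ultimately have BP: "B j \<le> P j'" by (simp add: P_Suc del: P.simps)
    \<comment> \<open>\<open>B j'\<close> divides \<open>(u - v) * B j\<close>, which is at most
      \<open>(P j')\<^sup>2\<close> in absolute value, so \<open>u = v\<close>; equal values at
      distinct points of a row vanish.\<close>
    have eq': "(u - v) * B j = B j' * (P j' - v * B j)" using eq by (simp add: algebra_simps)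
    have "u = v"
    proof (rule ccontr)
      assume "u \<noteq> v"
      then have "(u - v) * B j \<noteq> 0" using B_pos[of j] by simp
      moreover have "B j' dvd (u - v) * B j" unfolding eq' by simp
      ultimately have "\<bar>B j'\<bar> \<le> \<bar>(u - v) * B j\<bar>" by (rule dvd_imp_le_int)
      also have "\<dots> = \<bar>u - v\<bar> * B j" using B_pos[of j] by (simp add: abs_mult)
      also have "\<dots> \<le> P j' * P j'" using ub vb BP B_pos[of j] by (intro mult_mono) auto
      finally have "B j' \<le> (P j')\<^sup>2" using B_pos[of j'] by (simp add: power2_eq_square)
      moreover have "0 < (P j')\<^sup>2" using P_pos[of j'] by simp
      ultimately show False using B_ge[of j'] by linarith
    qed
    then have "of_int (P j') * ind n x a = of_int (P j') * ind n x b" using u v by simp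
    then have "ind n x a = ind n x b" using P_pos[of j'] by simp
    then have "ind n x a = 0" unfolding a_def b_def using ind_row_distinct[OF n hne] by blast
    then have "u = 0" "v = 0" using u \<open>u = v\<close> by auto
    then show ?thesis using eq P_pos[of j'] B_pos[of j'] by auto
  qed simp
  have "u + (B j - 1) * v = P j"
    using eq B_pos[of j] unfolding \<open>j' = j\<close> mult_cancel_right by simp
  \<comment> \<open>\<open>B j\<close> divides a number of absolute value at most
    \<open>2 * P j\<close>, so that number is zero.\<close>
  then have eq2: "u - v - P j = B j * (- v)"
    by (simp add: algebra_simps)
  have "u - v - P j = 0"
  proof (rule ccontr)
    assume "u - v - P j \<noteq> 0"
    moreover have "B j dvd u - v - P j" unfolding eq2 by simp
    ultimately have "\<bar>B j\<bar> \<le> \<bar>u - v - P j\<bar>" by (rule dvd_imp_le_int)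
    then show False using ub vb B_ge_P[of j] P_pos[of j] unfolding \<open>j' = j\<close> by linarith
  qed
  then have "u = P j" using ub vb unfolding \<open>j' = j\<close> by linarith
  then have "ind n x a = 1" using u P_pos[of j] \<open>j' = j\<close> by simp
  then have a: "x = a" using ind_eq_1[OF n x(2)] unfolding a_def by blast
  then have "ind n y a = 0" using x(1) y(3) by (simp add: ind_base)
  then have "(1 - 1 / rat_of_int (B j)) * ind n y b = 1 - 1 / of_int (B j)"
    using row[of y] iy \<open>j' = j\<close> by simp
  moreover have "1 - 1 / rat_of_int (B j) \<noteq> 0" using weight_bounds(2)[of j] by linarith
  ultimately have "ind n y b = 1" by (metis mult_cancel_left1 mult.commute)
  then have "y = b" using ind_eq_1[OF n y(2)] unfolding b_def by blast
  then show ?thesis using a \<open>j' = j\<close> by (simp add: w_eq a_def b_def)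
qed

end

section \<open>Automorphisms\<close>

locale order_automorphism = averaging_tower +
  fixes \<phi> :: "(nat \<times> rat \<Rightarrow> rat) \<Rightarrow> nat \<times> rat \<Rightarrow> rat"
  assumes bij: "bij_betw \<phi> D D"
    and add: "f \<in> D \<Longrightarrow> f' \<in> D \<Longrightarrow> \<phi> (\<lambda>x. f x + f' x) = (\<lambda>x. \<phi> f x + \<phi> f' x)"
    and mono: "f \<in> D \<Longrightarrow> f' \<in> D \<Longrightarrow> (\<forall>x. f x \<le> f' x) \<longleftrightarrow> (\<forall>x. \<phi> f x \<le> \<phi> f' x)"
begin

section \<open>Action of an automorphism on constants\<close>

lemma mem: "f \<in> D \<Longrightarrow> \<phi> f \<in> D"
  using bij by (auto simp: bij_betw_def)

lemma surj: assumes "f \<in> D" obtains f' where "f' \<in> D" "\<phi> f' = f"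
proof -
  have "f \<in> \<phi> ` D" using bij assms by (simp add: bij_betw_def)
  then show ?thesis by (rule imageE) (rule that, simp_all)
qed

lemma inj: "f \<in> D \<Longrightarrow> f' \<in> D \<Longrightarrow> \<phi> f = \<phi> f' \<Longrightarrow> f = f'"
  using bij inj_onD[of \<phi> D f f'] by (simp add: bij_betw_def)

lemma zero: "\<phi> (\<lambda>_. 0) = (\<lambda>_. 0)"
  using add[OF const_mem_D[of 0] const_mem_D[of 0]] by (simp add: fun_eq_iff)

lemma diff: assumes "f \<in> D" "f' \<in> D" shows "\<phi> (\<lambda>x. f x - f' x) = (\<lambda>x. \<phi> f x - \<phi> f' x)"
  using add[OF D_diff[OF assms] assms(2)] by (simp add: fun_eq_iff)

lemma nat_mult: "f \<in> D \<Longrightarrow> \<phi> (\<lambda>x. of_nat k * f x) = (\<lambda>x. of_nat k * \<phi> f x)"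
proof (induction k)
  case 0
  then show ?case using zero by simp
next
  case (Suc k)
  then show ?case
    using add[of f "\<lambda>x. of_nat k * f x"] D_cmult[of f "int k"] by (simp add: algebra_simps)
qed

lemma nonneg_iff: "f \<in> D \<Longrightarrow> (\<forall>x. 0 \<le> f x) \<longleftrightarrow> (\<forall>x. 0 \<le> \<phi> f x)"
  using mono[OF const_mem_D[of 0], of f] by (simp add: zero)

definition lam :: rat where "lam = \<phi> (\<lambda>_. 1) (0, 0)"

text \<open>The constant functions are the divisible elements of \<open>D\<close>.\<close>

lemma const_1: "\<phi> (\<lambda>_. 1) = (\<lambda>_. lam)"
proof
  fix x
  have "(\<lambda>x. \<phi> (\<lambda>_. 1) x / of_int 2 ^ r) \<in> D" for r
  proof -
    have "\<phi> (\<lambda>_. 1) = (\<lambda>x. 2 ^ r * \<phi> (\<lambda>_. 1 / 2 ^ r) x)"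
      using nat_mult[OF const_mem_D[of "1 / 2 ^ r"], of "2 ^ r"] by simp
    then have "(\<lambda>x. \<phi> (\<lambda>_. 1) x / of_int 2 ^ r) = \<phi> (\<lambda>_. 1 / 2 ^ r)" by (simp add: fun_eq_iff)
    then show ?thesis using mem const_mem_D by simp
  qed
  then show "\<phi> (\<lambda>_. 1) x = lam"
    unfolding lam_def by (intro infinitely_divisible_const[of _ 2] mem const_mem_D) simp_all
qed

lemma const: "\<phi> (\<lambda>_. q) = (\<lambda>_. q * lam)"
proof -
  have *: "\<phi> (\<lambda>_. q) = (\<lambda>_. q * lam)" if "0 \<le> q" for q
  proof -
    obtain a b where ab: "quotient_of q = (a, b)" by force
    then have b: "b > 0" and q: "q = of_int a / of_int b" by (auto simp: quotient_of_denom_pos quotient_of_div)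
    have a: "0 \<le> a" using \<open>0 \<le> q\<close> b unfolding q by (simp add: zero_le_divide_iff)
    have qa: "of_nat (nat b) * q = of_nat (nat a)" using a b by (simp add: q)
    have "(\<lambda>x. of_nat (nat b) * \<phi> (\<lambda>_. q) x) = \<phi> (\<lambda>_. of_nat (nat b) * q)"
      by (rule nat_mult[OF const_mem_D, symmetric])
    also have "\<dots> = \<phi> (\<lambda>_. of_nat (nat a) * 1)" by (simp only: qa mult_1_right)
    also have "\<dots> = (\<lambda>x. of_nat (nat a) * lam)"
      unfolding nat_mult[OF const_mem_D] const_1 ..
    finally have "of_nat (nat b) * \<phi> (\<lambda>_. q) x = of_nat (nat b) * (q * lam)" for x
      unfolding mult.assoc[symmetric] qa by (rule fun_cong)
    then show ?thesis using b by (simp add: fun_eq_iff)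
  qed
  show ?thesis
  proof (cases "0 \<le> q")
    case False
    then have "\<phi> (\<lambda>x. 0 - (- q)) = (\<lambda>x. 0 - (- q) * lam)"
      using diff[OF const_mem_D[of 0] const_mem_D[of "- q"]] *[of "- q"] zero by simp
    then show ?thesis by simp
  qed (rule *)
qed

lemma lam_pos: "0 < lam"
proof -
  have "0 \<le> lam" using nonneg_iff[OF const_mem_D[of 1]] by (simp add: const_1)
  moreover have "lam \<noteq> 0"
  proof
    assume "lam = 0"
    then have "\<phi> (\<lambda>_. 1) = \<phi> (\<lambda>_. 0)" by (simp add: const_1 zero)
    then have "(\<lambda>_ :: nat \<times> rat. 1 :: rat) = (\<lambda>_. 0)" by (rule inj[OF const_mem_D const_mem_D])
    then show False by (simp add: fun_eq_iff)
  qed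
  ultimately show ?thesis by simp
qed

section \<open>Action on points\<close>

lemma point_image:
  assumes x: "snd x \<in> H"
  shows "\<exists>y. (snd y \<in> H \<or> y = (0, 0)) \<and> (\<forall>f\<in>D. \<phi> f x = lam * f y)"
proof -
  interpret pure_state H par g "\<lambda>f. \<phi> f x / lam"
  proof
    show "\<phi> (\<lambda>y. f y + f' y) x / lam = \<phi> f x / lam + \<phi> f' x / lam" if "f \<in> D" "f' \<in> D" for f f'
      using that by (simp add: add add_divide_distrib)
    show "0 \<le> \<phi> f x / lam" if "f \<in> D" "\<And>y. 0 \<le> f y" for f
    proof -
      have "0 \<le> \<phi> f x" using nonneg_iff[OF that(1)] that(2) by blast
      then show ?thesis using lam_pos by simp
    qed
    show "\<phi> (\<lambda>_. q) x / lam = q" for q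
      using lam_pos by (simp add: const)
    fix f assume f: "f \<in> D"
    \<comment> \<open>The dominating element of \<open>\<phi> f\<close> at \<open>x\<close> is
      pulled back through \<open>\<phi>\<close>; this verifies the last property of a pure
      state.\<close>
    obtain e' where e': "e' \<in> D" "\<forall>y. 0 \<le> e' y" "e' x = 0" "\<And>y. \<bar>\<phi> f y - \<phi> f x\<bar> \<le> e' y"
      using extreme_element[OF mem[OF f] x] by blast
    obtain e where e: "e \<in> D" "\<phi> e = e'" using surj[OF e'(1)] .
    define q where "q = \<phi> f x / lam"
    have cq: "\<phi> (\<lambda>_. q) = (\<lambda>_. \<phi> f x)" using lam_pos by (simp add: const q_def)
    have d1: "\<phi> (\<lambda>y. f y - q) = (\<lambda>y. \<phi> f y - \<phi> f x)" using diff[OF f const_mem_D[of q]] by (simp add: cq)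
    have d2: "\<phi> (\<lambda>y. q - f y) = (\<lambda>y. \<phi> f x - \<phi> f y)" using diff[OF const_mem_D[of q] f] by (simp add: cq)
    have "\<forall>y. f y - q \<le> e y"
      unfolding mono[OF D_diff[OF f const_mem_D] e(1)] d1 e(2) using e'(4) by (simp add: abs_le_iff)
    moreover have "\<forall>y. q - f y \<le> e y"
      unfolding mono[OF D_diff[OF const_mem_D f] e(1)] d2 e(2) using e'(4) by (simp add: abs_le_iff)
    ultimately have "\<forall>y. \<bar>f y - q\<bar> \<le> e y" by (simp add: abs_le_iff)
    moreover have "\<forall>y. 0 \<le> e y" unfolding nonneg_iff[OF e(1)] e(2) by (rule e'(2))
    moreover have "\<phi> e x / lam = 0" using e(2) e'(3) by simp
    ultimately show "\<exists>e\<in>D. (\<forall>y. 0 \<le> e y) \<and> \<phi> e x / lam = 0 \<and> (\<forall>y. \<bar>f y - \<phi> f x / lam\<bar> \<le> e y)"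
      using e(1) unfolding q_def by blast
  qed
  obtain y where y: "snd y \<in> H \<or> y = (0, 0)" "\<forall>f\<in>D. \<phi> f x / lam = f y" using evaluation by blast
  have "\<forall>f\<in>D. \<phi> f x = lam * f y" using y(2) lam_pos by (auto simp: field_simps)
  then show ?thesis using y(1) by blast
qed

lemma inverse: "order_automorphism H par g (inv_into D \<phi>)"
proof
  have i: "inv_into D \<phi> f \<in> D" "\<phi> (inv_into D \<phi> f) = f" if "f \<in> D" for f
    using bij that by (auto simp: bij_betw_def inv_into_into f_inv_into_f)
  show "bij_betw (inv_into D \<phi>) D D" by (rule bij_betw_inv_into[OF bij])
  fix f f' assume f: "f \<in> D" "f' \<in> D"
  show "inv_into D \<phi> (\<lambda>x. f x + f' x) = (\<lambda>x. inv_into D \<phi> f x + inv_into D \<phi> f' x)"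
    by (rule inj) (simp_all only: f i D_add add)
  show "(\<forall>x. f x \<le> f' x) \<longleftrightarrow> (\<forall>x. inv_into D \<phi> f x \<le> inv_into D \<phi> f' x)"
    using mono[OF i(1)[OF f(1)] i(1)[OF f(2)]] by (simp only: i(2)[OF f(1)] i(2)[OF f(2)])
qed

lemma inv_mem: "f \<in> D \<Longrightarrow> inv_into D \<phi> f \<in> D"
  and inv_right: "f \<in> D \<Longrightarrow> \<phi> (inv_into D \<phi> f) = f"
  and inv_left: "f \<in> D \<Longrightarrow> inv_into D \<phi> (\<phi> f) = f"
  using bij by (auto simp: bij_betw_def inv_into_into f_inv_into_f inv_into_f_f)

lemma lam_inverse: "order_automorphism.lam (inv_into D \<phi>) = 1 / lam"
proof -
  interpret inv: order_automorphism H par g "inv_into D \<phi>" by (rule inverse)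
  have "\<phi> (\<lambda>_. 1 / lam) = (\<lambda>_. 1)" using lam_pos by (simp add: const)
  then have "inv_into D \<phi> (\<lambda>_. 1) = (\<lambda>_. 1 / lam)" using inv_left[OF const_mem_D[of "1 / lam"]] by simp
  then show ?thesis by (simp add: inv.lam_def)
qed

lemma separating: assumes "snd x \<in> H" "x \<noteq> y" shows "\<exists>f\<in>D. f x \<noteq> f y"
proof -
  define m where "m = Suc (max (fst x) (fst y))"
  have m: "fst x < m" "fst y < m" by (auto simp: m_def)
  have "unit_vec m x \<in> D" using D0_subset_D[OF unit_vec_mem[OF m(1) assms(1)]] .
  moreover have "unit_vec m x x \<noteq> unit_vec m x y"
    using m assms(2) c_pos[of m "fst x"] H_pos[OF assms(1)] by (simp add: unit_vec_def ind_base)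
  ultimately show ?thesis by blast
qed

lemma eval_inj: assumes "snd x \<in> H" "\<forall>f\<in>D. \<phi> f x = \<phi> f y" shows "x = y"
proof (rule ccontr)
  assume "x \<noteq> y"
  then obtain f where f: "f \<in> D" "f x \<noteq> f y" using separating[OF assms(1)] by blast
  obtain f' where "f' \<in> D" "\<phi> f' = f" using surj[OF f(1)] .
  then show False using f assms(2) by auto
qed

text \<open>A point at which \<open>\<phi>\<close> evaluates at infinity would be the image of almost all points of row \<open>0\<close>
  under the inverse of \<open>\<phi>\<close>.\<close>

lemma point_image_finite:
  assumes x: "snd x \<in> H"
  shows "\<exists>y. snd y \<in> H \<and> (\<forall>f\<in>D. \<phi> f x = lam * f y)"
proof (rule ccontr)
  assume none: "\<not> ?thesis"
  then have inf: "\<forall>f\<in>D. \<phi> f x = lam * f (0, 0)" using point_image[OF x] by auto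
  interpret inv: order_automorphism H par g "inv_into D \<phi>" by (rule inverse)
  obtain m0 where m0: "\<And>m. m \<ge> m0 \<Longrightarrow> fst x < m \<and> ind m x \<in> D0 m"
    using eventually_ind_mem_D[OF x] by blast
  define m where "m = m0"
  have m: "fst x < m" "ind m x \<in> D" using m0[of m] D0_subset_D by (auto simp: m_def)
  then have m_pos: "0 < m" by simp
  \<comment> \<open>\<open>F\<close> is \<open>1 / lam\<close> at infinity, hence at all but
    finitely many points of row \<open>0\<close>; two such points suffice for a
    contradiction.\<close>
  define F where "F = inv_into D \<phi> (ind m x)"
  have F: "F \<in> D" "\<phi> F = ind m x" unfolding F_def using inv_mem inv_right m(2) by auto
  have "ind m x x = lam * F (0, 0)" using inf F by metis
  then have F_inf: "F (0, 0) = 1 / lam" using m(1) lam_pos by (simp add: ind_base field_simps)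
  have "finite (snd ` {y. fst y < 1 \<and> F y \<noteq> F (0, 0)})" using support_rows[OF F(1)] by blast
  then have infin: "infinite (H - snd ` {y. fst y < 1 \<and> F y \<noteq> F (0, 0)})" using infinite_H by simp
  obtain T where T: "T \<subseteq> H - snd ` {y. fst y < 1 \<and> F y \<noteq> F (0, 0)}" "finite T" "card T = 2"
    using infinite_arbitrarily_large[OF infin, of 2] by (elim exE conjE) (rule that)
  then obtain h1 h2 where h: "T = {h1, h2}" "h1 \<noteq> h2" by (auto simp: card_2_iff)
  have img: "\<forall>f\<in>D. inv_into D \<phi> f (0, k) = 1 / lam * f x" if k: "k \<in> T" for k
  proof -
    have kH: "snd (0 :: nat, k) \<in> H" using T(1) k by auto
    have "F (0, k) = F (0, 0)"
    proof (rule ccontr)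
      assume "F (0, k) \<noteq> F (0, 0)"
      then have "(0, k) \<in> {y. fst y < 1 \<and> F y \<noteq> F (0, 0)}" by simp
      then have "snd (0 :: nat, k) \<in> snd ` {y. fst y < 1 \<and> F y \<noteq> F (0, 0)}" by (rule imageI)
      then have "k \<in> snd ` {y. fst y < 1 \<and> F y \<noteq> F (0, 0)}" by (simp only: snd_conv)
      then show False using T(1) k by blast
    qed
    then have Fk: "F (0, k) = 1 / lam" using F_inf by simp
    obtain y where y: "snd y \<in> H \<or> y = (0, 0)" "\<forall>f\<in>D. inv_into D \<phi> f (0, k) = inv.lam * f y"
      using inv.point_image[OF kH] by blast
    \<comment> \<open>The inverse evaluates at a point \<open>y\<close> with
      \<open>ind m x y = 1\<close>, which can only be \<open>x\<close>; so both chosen points lead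
      to \<open>x\<close>.\<close>
    have "1 / lam = 1 / lam * ind m x y"
      using y(2) m(2) Fk unfolding F_def lam_inverse by metis
    then have one: "ind m x y = 1" using lam_pos by simp
    then have "y = x" using ind_eq_1[OF m_pos x, of "fst y" "snd y"] by simp
    then show ?thesis using y(2) unfolding lam_inverse by blast
  qed
  have "\<forall>f\<in>D. inv_into D \<phi> f (0, h1) = inv_into D \<phi> f (0, h2)" using img[of h1] img[of h2] h(1) by simp
  then have "(0 :: nat, h1) = (0, h2)" using T(1) h(1) by (intro inv.eval_inj) auto
  then show False using h(2) by simp
qed

text \<open>The map of points through which \<open>\<phi>\<close> acts. The choice is unique for
  points over \<open>H\<close>, since \<open>D\<close> separates them.\<close>

definition tau :: "nat \<times> rat \<Rightarrow> nat \<times> rat" where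
  "tau x = (SOME y. snd y \<in> H \<and> (\<forall>f\<in>D. \<phi> f x = lam * f y))"

lemma tau_H: "snd x \<in> H \<Longrightarrow> snd (tau x) \<in> H"
  and tau: "snd x \<in> H \<Longrightarrow> f \<in> D \<Longrightarrow> \<phi> f x = lam * f (tau x)"
  using someI_ex[OF point_image_finite, of x] unfolding tau_def by blast+

lemma tau_inj: "snd x \<in> H \<Longrightarrow> tau x = tau y \<Longrightarrow> snd y \<in> H \<Longrightarrow> x = y"
  by (rule eval_inj) (simp_all add: tau)

text \<open>Late rows of \<open>\<phi> (unit_vec n z)\<close> satisfy the averaging equation;
  dividing out the positive factors leaves it for \<open>ind n z\<close> along
  \<open>tau\<close>.\<close>

lemma scaled_ind_relation:
  assumes z: "snd z \<in> H" "fst z < n"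
  shows "\<exists>m. \<forall>j\<ge>m. \<forall>h\<in>H. ind n z (tau (j, h)) = ind n z (tau (par j, h)) / of_int (B j) +
    (1 - 1 / of_int (B j)) * ind n z (tau (par j, g j * h))"
proof -
  have D: "unit_vec n z \<in> D" using D0_subset_D[OF unit_vec_mem[OF z(2,1)]] .
  define a where "a = snd z / of_int (c n (fst z))"
  have a: "0 < a" unfolding a_def by (rule unit_vec_scale_pos[OF z(1)])
  obtain m where m: "(\<lambda>y. \<phi> (unit_vec n z) y - \<phi> (unit_vec n z) (0, 0)) \<in> D0 m"
    using mem[OF D] D_iff by blast
  have val: "\<phi> (unit_vec n z) (i, h) = lam * a * ind n z (tau (i, h))" if "h \<in> H" for i h
    using tau[OF _ D, of "(i, h)"] that by (simp add: unit_vec_def a_def)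
  have "ind n z (tau (j, h)) = ind n z (tau (par j, h)) / of_int (B j) +
      (1 - 1 / of_int (B j)) * ind n z (tau (par j, g j * h))" if "m \<le> j" "h \<in> H" for j h
  proof -
    have "g j * h \<in> H" using that(2) by (simp add: g_mult_in_H_iff)
    then have "lam * a * ind n z (tau (j, h)) = lam * a * ind n z (tau (par j, h)) / of_int (B j) +
        (1 - 1 / of_int (B j)) * (lam * a * ind n z (tau (par j, g j * h)))"
      using averagingD[OF D_averaging[OF m] that(1), of h] val that(2) by simp
    also have "\<dots> = lam * a * (ind n z (tau (par j, h)) / of_int (B j) +
        (1 - 1 / of_int (B j)) * ind n z (tau (par j, g j * h)))"
      by (simp add: algebra_simps)
    finally show ?thesis using lam_pos a by simp
  qed
  then show ?thesis by blast
qed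

text \<open>By \<open>cofinal\<close>, \<open>(i, h)\<close> and \<open>(i, k * h)\<close> are the
  parent points of some late \<open>(j, h)\<close>. Their images see the weights
  \<open>1 / B j\<close> and \<open>1 - 1 / B j\<close> at \<open>tau (j, h)\<close>, and
  \<open>child_identify\<close> recognises them.\<close>

lemma tau_child:
  assumes h: "h \<in> H" and k: "k \<in> H" "k \<noteq> 1"
  shows "\<exists>h'\<in>H. tau (i, h) = (i, h') \<and> tau (i, k * h) = (i, k * h')"
proof -
  let ?x = "tau (i, h)" and ?y = "tau (i, k * h)"
  have H: "snd ?x \<in> H" "snd ?y \<in> H" using tau_H h k mult_H by auto
  have "h \<noteq> k * h" using H_pos[OF h] k(2) by auto
  then have ne: "?x \<noteq> ?y" using tau_inj[of "(i, h)" "(i, k * h)"] h k mult_H by auto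
  define n where "n = Suc (max (fst ?x) (fst ?y))"
  have n: "0 < n" "fst ?x < n" "fst ?y < n" by (auto simp: n_def)
  obtain m1 where m1: "\<forall>j\<ge>m1. \<forall>h\<in>H. ind n ?x (tau (j, h)) = ind n ?x (tau (par j, h)) / of_int (B j) +
      (1 - 1 / of_int (B j)) * ind n ?x (tau (par j, g j * h))"
    using scaled_ind_relation[OF H(1) n(2)] by blast
  obtain m2 where m2: "\<forall>j\<ge>m2. \<forall>h\<in>H. ind n ?y (tau (j, h)) = ind n ?y (tau (par j, h)) / of_int (B j) +
      (1 - 1 / of_int (B j)) * ind n ?y (tau (par j, g j * h))"
    using scaled_ind_relation[OF H(2) n(3)] by blast
  obtain j where j: "max n (max m1 m2) \<le> j" "par j = i" "g j = k" using cofinal[OF k] by blast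
  have ix: "ind n ?x (tau (j, h)) = 1 / of_int (B j)"
    using m1[rule_format, of j h] j h n ne by (simp add: ind_base)
  have iy: "ind n ?y (tau (j, h)) = 1 - 1 / of_int (B j)"
    using m2[rule_format, of j h] j h n ne by (simp add: ind_base)
  have wH: "snd (tau (j, h)) \<in> H" using tau_H h by simp
  have "n \<le> j" using j(1) by simp
  then have "?x = (par j, snd (tau (j, h))) \<and> ?y = (par j, g j * snd (tau (j, h)))"
    using child_identify[OF n(1,2) H(1) n(3) H(2) ne _ wH ix iy] by blast
  then show ?thesis using wH j(2,3) by auto
qed

lemma tau_row: "\<exists>k. \<forall>i. k i \<in> H \<and> (\<forall>h\<in>H. tau (i, h) = (i, k i * h))"
proof -
  have "\<exists>k\<in>H. \<forall>h\<in>H. tau (i, h) = (i, k * h)" for i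
  proof -
    obtain k where k: "k \<in> H" "tau (i, 1) = (i, k)"
      using tau_child[OF one_H g_H[of 0] g_neq_1, of i] by auto
    have "tau (i, h) = (i, k * h)" if h: "h \<in> H" for h
    proof (cases "h = 1")
      case False
      then show ?thesis using tau_child[OF one_H h False, of i] k by (auto simp: mult.commute)
    qed (simp add: k)
    then show ?thesis using k(1) by blast
  qed
  then show ?thesis by metis
qed

definition shift :: "nat \<Rightarrow> rat" where
  "shift = (SOME k. \<forall>i. k i \<in> H \<and> (\<forall>h\<in>H. tau (i, h) = (i, k i * h)))"

lemma shift_H: "shift i \<in> H"
  and tau_shift: "h \<in> H \<Longrightarrow> tau (i, h) = (i, shift i * h)"
  using someI_ex[OF tau_row] unfolding shift_def by blast+

lemma D_outside: "f \<in> D \<Longrightarrow> h \<notin> H \<Longrightarrow> f (i, h) = f (0, 0)"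
proof -
  assume "f \<in> D" "h \<notin> H"
  then obtain n where "(\<lambda>x. f x - f (0, 0)) \<in> D0 n" using D_iff by blast
  from D0_outside[OF this \<open>h \<notin> H\<close>, of i] show "f (i, h) = f (0, 0)" by simp
qed

text \<open>A point of row \<open>0\<close> is chosen outside the finitely many exceptions of
  \<open>\<phi> f\<close> and, after the shift, of \<open>f\<close>; there both take their values at
  infinity.\<close>

lemma at_infinity: assumes f: "f \<in> D" shows "\<phi> f (0, 0) = lam * f (0, 0)"
proof -
  let ?S = "snd ` {y. fst y < 1 \<and> \<phi> f y \<noteq> \<phi> f (0, 0)} \<union>
    (\<lambda>h. h / shift 0) ` snd ` {y. fst y < 1 \<and> f y \<noteq> f (0, 0)}"
  have "finite ?S" using support_rows[OF f] support_rows[OF mem[OF f]] by blast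
  then obtain h where h: "h \<in> H" "h \<notin> ?S" using infinite_H by (meson finite_subset subsetI)
  have "\<phi> f (0, h) = \<phi> f (0, 0)"
  proof (rule ccontr)
    assume "\<phi> f (0, h) \<noteq> \<phi> f (0, 0)"
    then have "(0, h) \<in> {y. fst y < 1 \<and> \<phi> f y \<noteq> \<phi> f (0, 0)}" by simp
    then have "snd (0 :: nat, h) \<in> snd ` {y. fst y < 1 \<and> \<phi> f y \<noteq> \<phi> f (0, 0)}" by (rule imageI)
    then have "h \<in> snd ` {y. fst y < 1 \<and> \<phi> f y \<noteq> \<phi> f (0, 0)}" by (simp only: snd_conv)
    then show False using h(2) by blast
  qed
  moreover have "f (0, shift 0 * h) = f (0, 0)"
  proof (rule ccontr)
    assume "f (0, shift 0 * h) \<noteq> f (0, 0)"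
    then have "(0, shift 0 * h) \<in> {y. fst y < 1 \<and> f y \<noteq> f (0, 0)}" by simp
    then have "snd (0 :: nat, shift 0 * h) \<in> snd ` {y. fst y < 1 \<and> f y \<noteq> f (0, 0)}" by (rule imageI)
    then have "shift 0 * h \<in> snd ` {y. fst y < 1 \<and> f y \<noteq> f (0, 0)}" by (simp only: snd_conv)
    then have "shift 0 * h / shift 0 \<in> (\<lambda>h. h / shift 0) ` snd ` {y. fst y < 1 \<and> f y \<noteq> f (0, 0)}" by (rule imageI)
    moreover have "shift 0 * h / shift 0 = h" using H_pos[OF shift_H[of 0]] by simp
    ultimately show False using h(2) by simp
  qed
  ultimately show ?thesis using tau[of "(0, h)", OF _ f] h(1) by (simp add: tau_shift)
qed

section \<open>The automorphism is a scaling\<close>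

lemma shift_formula: assumes f: "f \<in> D" shows "\<phi> f (i, h) = lam * f (i, shift i * h)"
proof (cases "h \<in> H")
  case True
  then show ?thesis using tau[of "(i, h)", OF _ f] by (simp add: tau_shift)
next
  case False
  then have "shift i * h \<notin> H"
    using H_divide[of "shift i * h" "shift i"] shift_H[of i] H_pos[OF shift_H[of i]] by auto
  then show ?thesis
    using False D_outside[OF f] D_outside[OF mem[OF f]] at_infinity[OF f] by metis
qed

lemma inverse_formula: assumes f: "f \<in> D" shows "inv_into D \<phi> f (i, h) = f (i, h / shift i) / lam"
proof -
  have "f (i, h / shift i) = \<phi> (inv_into D \<phi> f) (i, h / shift i)" by (simp add: inv_right f)
  also have "\<dots> = lam * inv_into D \<phi> f (i, h)"
    using shift_formula[OF inv_mem[OF f], of i "h / shift i"] H_pos[OF shift_H[of i]] by simp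
  finally show ?thesis using lam_pos by simp
qed

text \<open>All rows that descend from row \<open>i\<close> after a certain stage are shifted like row \<open>i\<close>.\<close>

lemma shift_descendants:
  "\<exists>m>i. \<forall>j. (\<exists>h. ind m (i, 1) (j, h) \<noteq> 0) \<longrightarrow> shift j = shift i"
proof -
  define n where "n = Suc i"
  let ?z = "(i, 1 :: rat)"
  have n: "0 < n" and zH: "snd ?z \<in> H" and zn: "fst ?z < n" by (auto simp: n_def one_H)
  obtain m1 where m1: "\<forall>j\<ge>m1. \<forall>h\<in>H. ind n ?z (tau (j, h)) = ind n ?z (tau (par j, h)) / of_int (B j) +
      (1 - 1 / of_int (B j)) * ind n ?z (tau (par j, g j * h))"
    using scaled_ind_relation[OF zH zn] by blast
  define m where "m = max m1 n"
  have m: "0 < m" "n \<le> m" "i < m" by (auto simp: m_def n_def)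
  \<comment> \<open>The induction follows the support of \<open>ind m ?z\<close>, which starts late
    enough for the equation along \<open>tau\<close>. It also carries nonvanishing of
    \<open>ind n ?z\<close>, the function to which that equation refers.\<close>
  have "shift j = shift i \<and> h \<in> H \<and> ind n ?z (j, h) \<noteq> 0" if "ind m ?z (j, h) \<noteq> 0" for j h
    using that
  proof (induction j arbitrary: h rule: less_induct)
    case (less j)
    have hH: "h \<in> H" using less.prems ind_infinity[OF m(1) zH, of h j] by blast
    show ?case
    proof (cases "j < m")
      case True
      then have "(j, h) = ?z" using less.prems by (auto simp: ind_base split: if_splits)
      then show ?thesis using hH zn by (auto simp: ind_base)
    next
      case False
      then have jm: "m \<le> j" by simp
      have p: "par j < j" using par_less[of j] jm m by simp
      have gH: "g j * h \<in> H" using hH by (simp add: g_mult_in_H_iff)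
      have "ind m ?z (par j, h) \<noteq> 0 \<or> ind m ?z (par j, g j * h) \<noteq> 0"
        using averagingD[OF ind_averaging[OF m(1)] jm, of ?z h] less.prems by auto
      then have IH: "shift (par j) = shift i" "ind n ?z (par j, h) \<noteq> 0 \<or> ind n ?z (par j, g j * h) \<noteq> 0"
        using less.IH[OF p] by blast+
      have jn: "n \<le> j" using jm m by simp
      note row = averagingD[OF ind_averaging[OF n] jn, of ?z]
      have pos: "0 < ind n ?z (j, h)"
      proof -
        define u v where "u = ind n ?z (par j, h)" and "v = ind n ?z (par j, g j * h)"
        have uv: "0 \<le> u" "0 \<le> v" "u \<noteq> 0 \<or> v \<noteq> 0" using IH(2) ind_nonneg[OF n] by (auto simp: u_def v_def)
        have w: "0 < 1 / rat_of_int (B j)" "0 < 1 - 1 / rat_of_int (B j)" using weight_bounds[of j] by auto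
        have "0 < 1 / of_int (B j) * u + (1 - 1 / of_int (B j)) * v"
          using uv w by (metis add_nonneg_pos add_pos_nonneg less_imp_le mult_nonneg_nonneg mult_pos_pos order_le_less)
        then show ?thesis using row[of h] by (simp add: u_def v_def)
      qed
      define h' where "h' = h / shift i"
      have k0: "0 < shift i" using H_pos[OF shift_H] .
      have h'H: "h' \<in> H" unfolding h'_def by (rule H_divide[OF hH shift_H])
      have gh'H: "g j * h' \<in> H" using h'H by (simp add: g_mult_in_H_iff)
      have "j \<ge> m1" using jm by (simp add: m_def)
      \<comment> \<open>Both parent points are shifted by \<open>shift i\<close>, so
        \<open>ind n ?z\<close> takes one nonzero value at \<open>shift j * h'\<close> and
        \<open>shift i * h'\<close>; the two points coincide.\<close>
      then have "ind n ?z (j, shift j * h') = ind n ?z (par j, shift i * h') / of_int (B j) +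
          (1 - 1 / of_int (B j)) * ind n ?z (par j, shift i * (g j * h'))"
        using m1 h'H gh'H by (simp add: tau_shift IH(1))
      also have "\<dots> = ind n ?z (j, shift i * h')"
        using row[of "shift i * h'"] by (simp add: mult_ac)
      finally have eq: "ind n ?z (j, shift j * h') = ind n ?z (j, shift i * h')" .
      have ih': "shift i * h' = h" using k0 by (simp add: h'_def)
      have "shift j * h' = shift i * h'"
      proof (rule ccontr)
        assume "shift j * h' \<noteq> shift i * h'"
        then have "ind n ?z (j, shift j * h') = 0" by (rule ind_row_distinct[OF n _ eq])
        then show False using eq pos by (simp add: ih')
      qed
      then have "shift j = shift i" using H_pos[OF h'H] by simp
      then show ?thesis using hH pos by simp
    qed
  qed
  then show ?thesis using m(3) by blast
qed

text \<open>If a prime \<open>p\<close> divided the denominator of \<open>q\<close>, Bezout would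
  make \<open>1 / p ^ r\<close> an integer combination of \<open>q ^ r\<close> and \<open>1\<close>,
  and \<open>f\<close> divisible by all powers of \<open>p\<close>.\<close>

lemma powers_integral:
  assumes f: "f \<in> D" "f x \<noteq> f (0, 0)" and q: "0 < q" and pow: "\<And>r::nat. (\<lambda>x. q ^ r * f x) \<in> D"
  shows "q \<in> \<int>"
proof -
  obtain a b where ab: "quotient_of q = (a, b)" by force
  then have b: "b > 0" and qe: "q = of_int a / of_int b" and co: "coprime a b"
    by (auto simp: quotient_of_denom_pos quotient_of_div quotient_of_coprime)
  have "b = 1"
  proof (rule ccontr)
    assume "b \<noteq> 1"
    then obtain p where p: "prime p" "p dvd b" using b prime_factor_int[of b] by auto
    obtain b' where b': "b = p * b'" using p(2) by (auto simp: dvd_def)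
    have "(\<lambda>x. f x / of_int p ^ r) \<in> D" for r
    proof -
      have "coprime (a ^ r) (b ^ r)" using co by simp
      then obtain u v where uv: "u * a ^ r + v * b ^ r = 1" by (metis bezout_int coprime_iff_gcd_eq_1)
      have bq: "rat_of_int (b ^ r) * q ^ r = of_int (a ^ r)" using b by (simp add: qe power_divide)
      have "of_int (u * b' ^ r) * (q ^ r * f x) + of_int (v * b' ^ r) * f x = f x / of_int p ^ r" for x
      proof -
        have p0: "rat_of_int p \<noteq> 0" using p(1) by auto
        have "of_int p ^ r * (of_int (u * b' ^ r) * (q ^ r * f x) + of_int (v * b' ^ r) * f x) =
            (of_int u * (of_int (b ^ r) * q ^ r) + of_int (v * b ^ r)) * f x"
          by (simp add: b' power_mult_distrib algebra_simps)
        also have "\<dots> = of_int (u * a ^ r + v * b ^ r) * f x" unfolding bq by simp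
        also have "\<dots> = f x" unfolding uv by simp
        finally show ?thesis using p0 by (simp add: field_simps)
      qed
      then show ?thesis using D_lincomb[OF pow f(1), of "u * b' ^ r" r "v * b' ^ r"] by simp
    qed
    then show False using infinitely_divisible_const[OF f(1) p(1)] f(2) by blast
  qed
  then show ?thesis by (simp add: qe)
qed

text \<open>On a generator supported in rows with one shift \<open>k\<close>, \<open>\<phi>\<close>
  followed by \<open>scale k\<close> is multiplication by \<open>mu = lam * k\<close>, and the
  inverses divide by \<open>mu\<close>. So the positive number \<open>mu\<close> and its inverse are
  integers.\<close>

lemma lam_shift: "lam * shift i = 1"
proof -
  obtain m where m: "i < m" and S: "\<And>j h. ind m (i, 1) (j, h) \<noteq> 0 \<Longrightarrow> shift j = shift i"
    using shift_descendants[of i] by blast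
  define k where "k = shift i"
  have kH: "k \<in> H" and k0: "0 < k" using shift_H H_pos by (auto simp: k_def)
  define mu where "mu = lam * k"
  have mu: "0 < mu" using lam_pos k0 by (simp add: mu_def)
  define f where "f = unit_vec m (i, 1)"
  have f: "f \<in> D" using D0_subset_D[OF unit_vec_mem] m one_H by (auto simp: f_def)
  have f_row: "shift j = k" if "f (j, h) \<noteq> 0" for j h
    using that S by (auto simp: f_def unit_vec_def k_def)
  have up: "(\<lambda>x. mu ^ r * f x) \<in> D" for r
  proof (induction r)
    case (Suc r)
    have "scale k (\<phi> (\<lambda>x. mu ^ r * f x)) = (\<lambda>x. mu ^ Suc r * f x)"
    proof
      fix x :: "nat \<times> rat"
      obtain j h where x: "x = (j, h)" by (cases x)
      have "f (j, shift j * (h / k)) = f (j, h)"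
      proof (cases "shift j = k")
        case False
        then show ?thesis using f_row by metis
      qed (use k0 in simp)
      then have "scale k (\<phi> (\<lambda>x. mu ^ r * f x)) x = k * (lam * (mu ^ r * f (j, h)))"
        by (simp only: x scale_apply shift_formula[OF Suc.IH])
      also have "\<dots> = mu ^ Suc r * f x" by (simp add: x mu_def)
      finally show "scale k (\<phi> (\<lambda>x. mu ^ r * f x)) x = mu ^ Suc r * f x" .
    qed
    then show ?case using scale_D[OF mem[OF Suc.IH] kH] by simp
  qed (use f in simp)
  have down: "(\<lambda>x. (1 / mu) ^ r * f x) \<in> D" for r
  proof (induction r)
    case (Suc r)
    have "scale (inverse k) (inv_into D \<phi> (\<lambda>x. (1 / mu) ^ r * f x)) = (\<lambda>x. (1 / mu) ^ Suc r * f x)"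
    proof
      fix x :: "nat \<times> rat"
      obtain j h where x: "x = (j, h)" by (cases x)
      have "f (j, h / inverse k / shift j) = f (j, h)"
      proof (cases "shift j = k")
        case False
        then show ?thesis using f_row by metis
      qed (use k0 in simp)
      then have "scale (inverse k) (inv_into D \<phi> (\<lambda>x. (1 / mu) ^ r * f x)) x =
          inverse k * ((1 / mu) ^ r * f (j, h) / lam)"
        by (simp only: x scale_apply inverse_formula[OF Suc.IH])
      also have "\<dots> = (1 / mu) ^ Suc r * f x" using lam_pos k0 by (simp add: x mu_def field_simps)
      finally show "scale (inverse k) (inv_into D \<phi> (\<lambda>x. (1 / mu) ^ r * f x)) x = (1 / mu) ^ Suc r * f x" .
    qed
    then show ?case using scale_D[OF inv_mem[OF Suc.IH] inverse_H[OF kH]] by simp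
  qed (use f in simp)
  have fne: "f (i, 1) \<noteq> f (0, 0)"
  proof -
    have "f (0, 0) = 0" using ind_infinity[of m "(i, 1)" 0 0] m one_H zero_notin_H by (simp add: f_def unit_vec_def)
    moreover have "f (i, 1) \<noteq> 0" using m c_pos[of m i] by (simp add: f_def unit_vec_def ind_base)
    ultimately show ?thesis by simp
  qed
  have "mu \<in> \<int>" by (rule powers_integral[OF f fne mu up])
  moreover have "1 / mu \<in> \<int>" by (rule powers_integral[OF f fne _ down]) (use mu in simp)
  ultimately obtain y z where yz: "mu = of_int y" "1 / mu = of_int z" by (auto elim!: Ints_cases)
  have "rat_of_int (y * z) = mu * (1 / mu)" by (simp only: yz[symmetric] of_int_mult)
  also have "\<dots> = 1" using mu by simp
  finally have "rat_of_int (y * z) = 1" .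
  then have "y * z = 1" by (simp only: of_int_eq_1_iff)
  moreover have "0 < y" using mu yz by simp
  ultimately have "y = 1" by (simp add: zmult_eq_1_iff)
  then show ?thesis using yz by (simp add: mu_def k_def)
qed

theorem eq_scale: "lam \<in> H" "f \<in> D \<Longrightarrow> \<phi> f = scale lam f"
proof -
  have s: "shift i = inverse lam" for i
    using lam_shift[of i] lam_pos by (simp add: field_simps)
  have "inverse (shift 0) \<in> H" by (rule inverse_H[OF shift_H])
  then show "lam \<in> H" by (simp add: s)
  assume f: "f \<in> D"
  show "\<phi> f = scale lam f"
    by (auto simp: fun_eq_iff shift_formula[OF f] s scale_apply divide_inverse mult.commute)
qed

end

section \<open>The main result\<close>

text \<open>\<open>j - 1\<close> codes a parent row, an element of \<open>H - {1}\<close> and a free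
  number. The free number makes \<open>j\<close> arbitrarily large; \<open>par j < j\<close> since a
  pair code is at least its components.\<close>

lemma averaging_tower_exists:
  assumes H: "subgroup H pos_rat_group" and ne: "H \<noteq> {1}"
  obtains par g where "averaging_tower H par g"
proof -
  have pos: "0 < h" if "h \<in> H" for h
    using subgroup.subset[OF H] that by (auto simp: pos_rat_group_def)
  have one: "1 \<in> H" using subgroup.one_closed[OF H] by (simp add: pos_rat_group_def)
  have mult: "h * k \<in> H" if "h \<in> H" "k \<in> H" for h k
    using subgroup.m_closed[OF H that] by (simp add: pos_rat_group_def)
  have grp: "group pos_rat_group"
  proof (rule groupI)
    fix x assume "x \<in> carrier pos_rat_group"
    then show "\<exists>y\<in>carrier pos_rat_group. y \<otimes>\<^bsub>pos_rat_group\<^esub> x = \<one>\<^bsub>pos_rat_group\<^esub>"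
      by (intro bexI[of _ "inverse x"]) (auto simp: pos_rat_group_def)
  qed (auto simp: pos_rat_group_def)
  have inv: "inverse h \<in> H" if h: "h \<in> H" for h
  proof -
    have "inv\<^bsub>pos_rat_group\<^esub> h = inverse h"
      using pos[OF h] by (intro group.inv_equality[OF grp]) (auto simp: pos_rat_group_def)
    then show ?thesis using subgroup.m_inv_closed[OF H h] by simp
  qed
  define K where "K = H - {1}"
  have K: "K \<noteq> {}" using ne one by (auto simp: K_def)
  have cK: "countable K" by (rule countableI_type)
  define par where "par j = fst (prod_decode (j - 1))" for j
  define g where "g j = from_nat_into K (fst (prod_decode (snd (prod_decode (j - 1)))))" for j
  have gK: "g j \<in> K" for j unfolding g_def by (rule from_nat_into[OF K])
  have "averaging_tower H par g"
  proof
    show "g j \<in> H" "g j \<noteq> 1" for j using gK[of j] by (auto simp: K_def)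
    show "par j < j" if "0 < j" for j
    proof -
      have "par j \<le> prod_encode (prod_decode (j - 1))"
        unfolding par_def by (metis le_prod_encode_1 prod.collapse)
      then show ?thesis using that by simp
    qed
    fix k m i assume "k \<in> H" "k \<noteq> (1 :: rat)"
    then have k: "k \<in> K" by (simp add: K_def)
    define j where "j = Suc (prod_encode (i, prod_encode (to_nat_on K k, m)))"
    have "m \<le> prod_encode (to_nat_on K k, m)" by (rule le_prod_encode_2)
    also have "\<dots> \<le> prod_encode (i, prod_encode (to_nat_on K k, m))" by (rule le_prod_encode_2)
    finally have "m \<le> j" by (simp add: j_def)
    moreover have "par j = i" "g j = k" using k cK by (simp_all add: par_def g_def j_def)
    ultimately show "\<exists>j\<ge>m. 0 < j \<and> par j = i \<and> g j = k"
      by (intro exI[of _ j]) (simp add: j_def)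
  qed (use pos one mult inv in auto)
  then show thesis by (rule that)
qed

theorem theorem1p1:
  fixes H :: "rat set"
  assumes "subgroup H pos_rat_group"
  shows "\<exists>(D :: nat monoid) (leq :: nat \<Rightarrow> nat \<Rightarrow> bool) (u :: nat) (\<phi> :: rat \<Rightarrow> nat \<Rightarrow> nat).
    dimension_group D leq u \<and>
    \<phi> \<in> iso (pos_rat_group\<lparr>carrier := H\<rparr>) (order_auto_group D leq) \<and>
    (\<forall>h\<in>H. \<forall>(a::nat) (b::nat). a > 0 \<longrightarrow> b > 0 \<longrightarrow> h = of_nat a / of_nat b \<longrightarrow>
       \<phi> h u [^]\<^bsub>D\<^esub> b = u [^]\<^bsub>D\<^esub> a)"
proof (cases "H = {1}")
  case True
  interpret function_dimension_group "range (\<lambda>z :: int. \<lambda>_ :: unit. rat_of_int z)" "\<lambda>_. 1"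
    by (rule function_dimension_group_int)
  show ?thesis
  proof (rule dimension_group_realization[where \<Phi> = "\<lambda>_ f. f"])
    show "\<exists>h\<in>H. \<forall>f\<in>range (\<lambda>z :: int. \<lambda>_ :: unit. rat_of_int z). \<psi> f = f"
      if "bij_betw \<psi> (range (\<lambda>z :: int. \<lambda>_ :: unit. rat_of_int z)) (range (\<lambda>z :: int. \<lambda>_ :: unit. rat_of_int z))"
        "\<And>f g. f \<in> range (\<lambda>z :: int. \<lambda>_ :: unit. rat_of_int z) \<Longrightarrow> g \<in> range (\<lambda>z :: int. \<lambda>_ :: unit. rat_of_int z) \<Longrightarrow>
          \<psi> (\<lambda>x. f x + g x) = (\<lambda>x. \<psi> f x + \<psi> g x)"
        "\<And>f g. f \<in> range (\<lambda>z :: int. \<lambda>_ :: unit. rat_of_int z) \<Longrightarrow> g \<in> range (\<lambda>z :: int. \<lambda>_ :: unit. rat_of_int z) \<Longrightarrow>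
          (\<forall>x. f x \<le> g x) \<longleftrightarrow> (\<forall>x. \<psi> f x \<le> \<psi> g x)" for \<psi>
      using int_order_automorphism[OF that] True by blast
  qed (use assms True in \<open>auto simp: bij_betw_def\<close>)
next
  case False
  then obtain par g where "averaging_tower H par g" using averaging_tower_exists assms by blast
  then interpret averaging_tower H par g .
  interpret function_dimension_group D "\<lambda>_. 1" by (rule function_dimension_group_D)
  show ?thesis
  proof (rule dimension_group_realization[where \<Phi> = scale])
    show "\<exists>h\<in>H. \<forall>f\<in>D. \<psi> f = scale h f"
      if "bij_betw \<psi> D D"
        "\<And>f g. f \<in> D \<Longrightarrow> g \<in> D \<Longrightarrow> \<psi> (\<lambda>x. f x + g x) = (\<lambda>x. \<psi> f x + \<psi> g x)"
        "\<And>f g. f \<in> D \<Longrightarrow> g \<in> D \<Longrightarrow> (\<forall>x. f x \<le> g x) \<longleftrightarrow> (\<forall>x. \<psi> f x \<le> \<psi> g x)" for \<psi>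
    proof -
      interpret order_automorphism H par g \<psi>
        by unfold_locales (fact that)+
      show ?thesis using eq_scale by blast
    qed
    show "scale h (\<lambda>x. f x + f' x) = (\<lambda>x. scale h f x + scale h f' x)" for h f f'
      by (auto simp: scale_def fun_eq_iff algebra_simps)
    show "scale h (\<lambda>_. 1) = (\<lambda>_. h * 1)" for h
      by (auto simp: scale_def)
    show "scale (h * k) f = scale h (scale k f)" for h k f
      by (rule scale_scale[symmetric])
    show "(\<forall>x. f x \<le> f' x) \<longleftrightarrow> (\<forall>x. scale h f x \<le> scale h f' x)" if "h \<in> H" for h f f'
      by (rule scale_mono[OF that])
  qed (simp_all add: assms scale_bij)
qed

end
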